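(* For all integers $n,w\ge1$ and all $\delta\in(0,1)$ there exists an explicit generator $G:\{0,1\}^r\to\{0,1\}^n$ that $\delta$-fools the class of all width-$w$ DNF formulae on $n$ variables and has seed-length $$r=\tilde O\!\left(w^2+w\log\left(\tfrac1\delta\right)+\log\log n\right).$$
   Context: A DNF formula is an OR of terms, each term being an AND of literals; it has width $w$ if every term contains at most $w$ literals (the number of terms is arbitrary). For $f:\{0,1\}^n\to\{0,1\}$ let $\mathsf{Bias}(f)=\Pr_{x}[f(x)=1]$, $x$ uniform in $\{0,1\}^n$. A generator $G:\{0,1\}^r\to\{0,1\}^n$ $\delta$-fools a class $\mathcal F$ of functions if $\left|\Pr_{y\in\{0,1\}^r}[f(G(y))=1]-\mathsf{Bias}(f)\right|\le\delta$ for all $f\in\mathcal F$, where $y$ is uniform. The generator is explicit if $G$ is computable in time polynomial in $r$ and $n$ (by a single algorithm that is also given $n,w,\delta$). Notation: $r=\tilde O(T)$ means $r\le C\,T(\log T)^{C}$ for an absolute constant $C$. Convention: in asymptotic bounds $\log(y)$ is read as $\max\{2,\log_2 y\}$. *)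

theory Defs
  imports "HOL-Probability.Probability"
begin

section \<open>Boolean cube and DNF formulae\<close>

definition cube :: "nat \<Rightarrow> bool list set" where
  "cube n = {x. length x = n}"

text \<open>A literal \<open>(i, b)\<close> requires variable number \<open>i\<close> (counted from 0) to have value \<open>b\<close>.\<close>

type_synonym lit = "nat \<times> bool"
type_synonym dnf = "lit list list"

definition eval_dnf :: "dnf \<Rightarrow> bool list \<Rightarrow> bool" where
  "eval_dnf \<phi> x \<longleftrightarrow> (\<exists>t\<in>set \<phi>. \<forall>(i, b)\<in>set t. x ! i = b)"

definition dnf_on :: "nat \<Rightarrow> dnf \<Rightarrow> bool" where
  "dnf_on n \<phi> \<longleftrightarrow> (\<forall>t\<in>set \<phi>. \<forall>(i, b)\<in>set t. i < n)"

definition dnf_width_le :: "nat \<Rightarrow> dnf \<Rightarrow> bool" where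
  "dnf_width_le w \<phi> \<longleftrightarrow> (\<forall>t\<in>set \<phi>. length t \<le> w)"

definition width_dnfs :: "nat \<Rightarrow> nat \<Rightarrow> (bool list \<Rightarrow> bool) set" where
  "width_dnfs n w = {eval_dnf \<phi> | \<phi>. dnf_on n \<phi> \<and> dnf_width_le w \<phi>}"


section \<open>Fooling\<close>

definition Bias :: "nat \<Rightarrow> (bool list \<Rightarrow> bool) \<Rightarrow> real" where
  "Bias n f = measure_pmf.prob (pmf_of_set (cube n)) {x. f x}"

definition fools ::
  "real \<Rightarrow> nat \<Rightarrow> nat \<Rightarrow> (bool list \<Rightarrow> bool list) \<Rightarrow> (bool list \<Rightarrow> bool) set \<Rightarrow> bool" where
  "fools \<delta> r n G F \<longleftrightarrow>
     (\<forall>f\<in>F. \<bar>measure_pmf.prob (pmf_of_set (cube r)) {y. f (G y)} - Bias n f\<bar> \<le> \<delta>)"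


section \<open>Algorithms and running time\<close>

text \<open>
  The machine model is a random access machine in structured form: a while-language whose memory
  consists of named arrays of natural numbers (a scalar is entry 0 of an array). The only
  arithmetic is addition and truncated subtraction, so under the unit-cost measure (one step per
  executed assignment or test) the bit length of the numbers grows by at most a constant per step,
  and polynomial time agrees with polynomial time on multitape Turing machines (Cook and Reckhow).
  The expressions occurring in a program have constant size, hence are charged one step.
\<close>

type_synonym store = "string \<Rightarrow> nat \<Rightarrow> nat"

datatype aexp =
    Const nat
  | Read string aexp
  | Plus aexp aexp
  | Minus aexp aexp

fun aval :: "aexp \<Rightarrow> store \<Rightarrow> nat" where
  "aval (Const k) s = k"
| "aval (Read a e) s = s a (aval e s)"
| "aval (Plus e1 e2) s = aval e1 s + aval e2 s"
| "aval (Minus e1 e2) s = aval e1 s - aval e2 s"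

datatype com =
    Skip
  | Write string aexp aexp
  | Seq com com
  | IfLess aexp aexp com com
  | WhileLess aexp aexp com

inductive exec :: "com \<Rightarrow> store \<Rightarrow> nat \<Rightarrow> store \<Rightarrow> bool" where
  Skip: "exec Skip s 1 s"
| Write: "exec (Write a i e) s 1 (s(a := (s a)(aval i s := aval e s)))"
| Seq: "exec c1 s k1 s' \<Longrightarrow> exec c2 s' k2 s'' \<Longrightarrow> exec (Seq c1 c2) s (k1 + k2) s''"
| IfTrue: "aval e1 s < aval e2 s \<Longrightarrow> exec c1 s k s'
    \<Longrightarrow> exec (IfLess e1 e2 c1 c2) s (1 + k) s'"
| IfFalse: "\<not> aval e1 s < aval e2 s \<Longrightarrow> exec c2 s k s'
    \<Longrightarrow> exec (IfLess e1 e2 c1 c2) s (1 + k) s'"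
| WhileFalse: "\<not> aval e1 s < aval e2 s \<Longrightarrow> exec (WhileLess e1 e2 c) s 1 s"
| WhileTrue: "aval e1 s < aval e2 s \<Longrightarrow> exec c s k s' \<Longrightarrow> exec (WhileLess e1 e2 c) s' k' s''
    \<Longrightarrow> exec (WhileLess e1 e2 c) s (1 + k + k') s''"

text \<open>
  The real number \<open>\<delta> \<in> (0,1)\<close> is handed to the algorithm as its infinite binary expansion:
  entry \<open>i\<close> of the array is the digit of weight \<open>2^-(i+1)\<close> (for dyadic \<open>\<delta>\<close>, of the
  expansion ending in zeros). A run of \<open>k\<close> steps inspects only
  \<open>O(k)\<close> digits.
\<close>

definition binary_digit :: "real \<Rightarrow> nat \<Rightarrow> nat" where
  "binary_digit \<delta> i = nat \<lfloor>\<delta> * 2 ^ (i + 1)\<rfloor> mod 2"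

definition input_store :: "nat \<Rightarrow> nat \<Rightarrow> real \<Rightarrow> bool list \<Rightarrow> store" where
  "input_store n w \<delta> y = (\<lambda>_ _. 0)
     (''n'' := (\<lambda>_. 0)(0 := n),
      ''w'' := (\<lambda>_. 0)(0 := w),
      ''delta'' := binary_digit \<delta>,
      ''seed'' := (\<lambda>i. if i < length y then of_bool (y ! i) else 0),
      ''seedlen'' := (\<lambda>_. 0)(0 := length y))"

definition out_values :: "nat \<Rightarrow> store \<Rightarrow> nat list" where
  "out_values n s = map (s ''out'') [0..<n]"

definition explicit ::
  "(nat \<Rightarrow> nat \<Rightarrow> real \<Rightarrow> nat) \<Rightarrow> (nat \<Rightarrow> nat \<Rightarrow> real \<Rightarrow> bool list \<Rightarrow> bool list) \<Rightarrow> bool" where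
  "explicit r G \<longleftrightarrow>
     (\<exists>P K. \<forall>n w \<delta>. 1 \<le> n \<longrightarrow> 1 \<le> w \<longrightarrow> 0 < \<delta> \<longrightarrow> \<delta> < 1 \<longrightarrow>
        (\<forall>y\<in>cube (r n w \<delta>). \<exists>k s. exec P (input_store n w \<delta> y) k s
           \<and> k \<le> K * (r n w \<delta> + n) ^ K
           \<and> out_values n s = map of_bool (G n w \<delta> y)))"


section \<open>Asymptotic notation\<close>

definition lg :: "real \<Rightarrow> real" where
  "lg y = max 2 (log 2 y)"

definition soft_O_bound :: "real \<Rightarrow> real \<Rightarrow> real" where
  "soft_O_bound C T = C * T * lg T powr C"

end

theory Submission
  imports Defs "HOL-Algebra.Algebraic_Closure_Type"
    "HOL-Number_Theory.Residue_Primitive_Roots" "HOL-Library.Z2"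
begin

text \<open>
  The seed consists of three elements \<open>x\<close>, \<open>z\<close>, \<open>u\<close> of \<open>R = GF(2)[t] / (t ^ N - 1)\<close> with
  \<open>N = 3 ^ l\<close>. The binary digits of an index \<open>i\<close>, read as a polynomial and evaluated at \<open>x\<close>, give a
  node \<open>a i\<close>, and output bit \<open>i\<close> is the inner product of \<open>u\<close> and the sum of the \<open>(a i * z) ^ j\<close> for
  \<open>j < N\<close>. Since 2 is a primitive root modulo \<open>3 ^ l\<close>, sending \<open>t\<close> to a root of unity of order \<open>N\<close>
  maps \<open>R\<close> onto a finite field with at least \<open>2 ^ (2 N / 3)\<close> elements. In this field the nodes of
  at most \<open>N\<close> indices are distinct with high probability, and then the sum of their geometric series is a
  non-zero polynomial in \<open>z\<close>; so the parity of any at most \<open>N\<close> output bits is exponentially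
  close to unbiased.

  Such a distribution fools every function that is sandwiched tightly between polynomials of degree at
  most \<open>N\<close> with a small coefficient norm. Bazzi's construction gives them for a DNF with few terms,
  starting from low-degree \<open>L\<^sup>2\<close> approximations. The latter exist because Razborov's encoding bounds the
  number of pairs of a set \<open>T\<close> and a point where the derivative of a narrow DNF in the directions \<open>T\<close>
  does not vanish, which controls both the norm of a Fourier level and the Fourier tail.

  A DNF of width \<open>w\<close> is approximated from both sides by DNFs with \<open>(w + log (1 / \<delta>)) ^ O(w)\<close> terms. A
  larger family contains a spread subfamily around a common core, and if the core is satisfied, then
  with high probability so is some term of the subfamily. So one term can be dropped (from below), or the whole
  subfamily can be replaced by its core (from above), at an error that is summable over all steps.
\<close>

section \<open>Fourier analysis on the cube\<close>

text \<open>The obstacle is the summand log log n. Controlling all parities would cost log n seed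
  bits, so only parities of at most \<open>N\<close> outputs are controlled. Then \<open>n\<close>
  enters the bias only through the degree D = log n of the digit polynomials, as a factor
  \<open>N\<^sup>2 * D + N\<close> against 2^(2 N / 3); this is why indices are hashed to nodes by
  \<open>x\<close>. For distinct nodes the vectors of their powers form a Vandermonde matrix;
  \<open>z\<close> compresses each vector to one ring element, and \<open>u\<close> turns that
  element into a bit. Working modulo t^N - 1 avoids any search for an irreducible polynomial: the
  program only adds exponents modulo \<open>N\<close>, and the field occurs in the analysis alone.
  Degree and norm of the sandwiching polynomials depend on the number M of terms, which may grow
  with n. Sparsification gives log M = O(w log (w + log (1 / \<delta>))). The order k is O(log M +
  log (1 / \<delta>)), and the norm M^3 (8 w)^(32 w k) demands that N be w k times a logarithm,
  which is w^2 + w log (1 / \<delta>) up to logarithms.\<close>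

definition avg :: "'a set \<Rightarrow> ('a set \<Rightarrow> real) \<Rightarrow> real" where
  "avg V f = (\<Sum>A\<in>Pow V. f A) / 2 ^ card V"

text \<open>Points of the cube are subsets of \<open>V\<close>, the coordinates with value 1;
  restrictions, flips and characters thus become set operations.\<close>

definition chi :: "'a set \<Rightarrow> 'a set \<Rightarrow> real" where
  "chi S A = (- 1) ^ card (S \<inter> A)"

definition fourier :: "'a set \<Rightarrow> ('a set \<Rightarrow> real) \<Rightarrow> 'a set \<Rightarrow> real" where
  "fourier V f S = avg V (\<lambda>A. f A * chi S A)"

text \<open>The points \<open>x - T \<union> Z\<close> form the subcube through \<open>x\<close> in
  the directions \<open>T\<close>, so \<open>x \<inter> T\<close> has no influence. The
  normalisation turns \<open>chi S\<close> into \<open>chi (S - T)\<close> when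
  \<open>T \<subseteq> S\<close>.\<close>

definition deriv_on :: "'a set \<Rightarrow> ('a set \<Rightarrow> real) \<Rightarrow> 'a set \<Rightarrow> real" where
  "deriv_on T f x = (\<Sum>Z\<in>Pow T. (- 1) ^ card Z * f (x - T \<union> Z)) / 2 ^ card T"

lemma avg_add: "avg V (\<lambda>A. f A + g A) = avg V f + avg V g"
  by (simp add: avg_def sum.distrib add_divide_distrib)

lemma avg_diff: "avg V (\<lambda>A. f A - g A) = avg V f - avg V g"
  by (simp add: avg_def sum_subtractf diff_divide_distrib)

lemma avg_cmult: "avg V (\<lambda>A. c * f A) = c * avg V f"
  by (simp add: avg_def sum_distrib_left)

lemma avg_sum: "avg V (\<lambda>A. \<Sum>i\<in>I. f i A) = (\<Sum>i\<in>I. avg V (f i))"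
  unfolding avg_def by (subst sum.swap) (simp add: sum_divide_distrib)

lemma avg_mono: "(\<And>A. A \<subseteq> V \<Longrightarrow> f A \<le> g A) \<Longrightarrow> avg V f \<le> avg V g"
  by (auto simp: avg_def intro!: divide_right_mono sum_mono)

lemma avg_cong: "(\<And>A. A \<subseteq> V \<Longrightarrow> f A = g A) \<Longrightarrow> avg V f = avg V g"
  by (auto simp: avg_def intro!: sum.cong)

lemma avg_const: "finite V \<Longrightarrow> avg V (\<lambda>_. c) = c"
  by (simp add: avg_def card_Pow)

lemma avg_nonneg: "(\<And>A. A \<subseteq> V \<Longrightarrow> 0 \<le> f A) \<Longrightarrow> 0 \<le> avg V f"
  by (auto simp: avg_def intro!: divide_nonneg_nonneg sum_nonneg)

lemma abs_avg_le: "\<bar>avg V f\<bar> \<le> avg V (\<lambda>A. \<bar>f A\<bar>)"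
  by (simp add: avg_def divide_right_mono sum_abs)

lemma avg_of_bool: "finite V \<Longrightarrow> avg V (\<lambda>A. of_bool (P A)) = card {A \<in> Pow V. P A} / 2 ^ card V"
  by (simp add: avg_def Int_def)

text \<open>Elements of \<open>S \<inter> T \<inter> A\<close> are counted twice and so do not
  affect the sign.\<close>

lemma chi_mult: "finite A \<Longrightarrow> chi S A * chi T A = chi (sym_diff S T) A"
proof -
  assume "finite A"
  have "card (S \<inter> A) + card (T \<inter> A) = card (sym_diff S T \<inter> A) + 2 * card (S \<inter> T \<inter> A)"
  proof -
    have "card (S \<inter> A) = card ((S - T) \<inter> A) + card (S \<inter> T \<inter> A)"
      using \<open>finite A\<close> by (subst card_Un_disjoint [symmetric]) (auto intro!: arg_cong [where f=card])
    moreover have "card (T \<inter> A) = card ((T - S) \<inter> A) + card (S \<inter> T \<inter> A)"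
      using \<open>finite A\<close> by (subst card_Un_disjoint [symmetric]) (auto intro!: arg_cong [where f=card])
    moreover have "card (sym_diff S T \<inter> A) = card ((S - T) \<inter> A) + card ((T - S) \<inter> A)"
      using \<open>finite A\<close> by (subst card_Un_disjoint [symmetric]) (auto intro!: arg_cong [where f=card])
    ultimately show ?thesis by simp
  qed
  then show ?thesis
    unfolding chi_def power_add [symmetric] by (simp add: power_add power_mult)
qed

lemma chi_commute: "chi S A = chi A S"
  by (simp add: chi_def Int_commute)

lemma sum_chi:
  assumes "finite V" "S \<subseteq> V"
  shows "(\<Sum>A\<in>Pow V. chi S A) = (if S = {} then 2 ^ card V else 0)"
proof (cases "S = {}")
  case True
  then show ?thesis using assms by (simp add: chi_def card_Pow)
next
  case False
  then obtain v where v: "v \<in> S" by auto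
  \<comment> \<open>Flipping the membership of one \<open>v \<in> S\<close> in \<open>A\<close>
    reverses the sign, so the sum equals its own negative.\<close>
  have "(\<Sum>A\<in>Pow V. chi S A) = (\<Sum>A\<in>Pow V. chi S (sym_diff A {v}))"
    by (rule sum.reindex_bij_witness [where i="\<lambda>A. sym_diff A {v}" and j="\<lambda>A. sym_diff A {v}"])
      (use v assms in \<open>auto intro!: arg_cong [where f="chi S"]\<close>)
  also have "\<dots> = (\<Sum>A\<in>Pow V. - chi S A)"
  proof (rule sum.cong [OF refl])
    fix A assume "A \<in> Pow V"
    then have "finite A" using assms finite_subset by blast
    have "chi S (sym_diff A {v}) = chi A S * chi {v} S"
      using chi_mult [of S A "{v}"] finite_subset [OF assms(2,1)] by (simp add: chi_commute)
    also have "chi {v} S = - 1" using v by (simp add: chi_def)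
    finally show "chi S (sym_diff A {v}) = - chi S A" by (simp add: chi_commute)
  qed
  finally show ?thesis using False by (simp add: sum_negf)
qed

lemma avg_chi:
  assumes "finite V" "S \<subseteq> V"
  shows "avg V (chi S) = of_bool (S = {})"
  by (simp add: avg_def sum_chi [OF assms])

lemma avg_chi_mult:
  assumes "finite V" "S \<subseteq> V" "T \<subseteq> V"
  shows "avg V (\<lambda>A. chi S A * chi T A) = of_bool (S = T)"
proof -
  have "avg V (\<lambda>A. chi S A * chi T A) = avg V (chi (sym_diff S T))"
    by (rule avg_cong) (simp add: chi_mult finite_subset [OF _ assms(1)])
  also have "\<dots> = of_bool (S = T)"
    using assms by (subst avg_chi) auto
  finally show ?thesis .
qed

text \<open>By the symmetry \<open>chi S A = chi A S\<close>, summing over \<open>S\<close> is the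
  orthogonality relation between \<open>chi B\<close> and \<open>chi A\<close>.\<close>

lemma fourier_inversion:
  assumes "finite V" "A \<subseteq> V"
  shows "f A = (\<Sum>S\<in>Pow V. fourier V f S * chi S A)"
proof -
  have "(\<Sum>S\<in>Pow V. fourier V f S * chi S A)
      = (\<Sum>S\<in>Pow V. \<Sum>B\<in>Pow V. f B * (chi S B * chi S A) / 2 ^ card V)"
    unfolding fourier_def avg_def sum_divide_distrib sum_distrib_right
    by (intro sum.cong refl) simp
  also have "\<dots> = (\<Sum>B\<in>Pow V. f B * avg V (\<lambda>S. chi B S * chi A S))"
    by (subst sum.swap) (simp add: avg_def sum_distrib_left sum_divide_distrib chi_commute)
  also have "\<dots> = (\<Sum>B\<in>Pow V. f B * of_bool (B = A))"
    using assms by (intro sum.cong refl) (simp add: avg_chi_mult)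
  also have "\<dots> = f A"
    using assms by simp
  finally show ?thesis by simp
qed

text \<open>Parseval's identity. The index map \<open>s\<close> admits expansions in the shifted
  characters \<open>chi (S - T)\<close> of a derivative.\<close>

lemma avg_square_expansion:
  assumes "finite V" "finite I" "\<And>i. i \<in> I \<Longrightarrow> s i \<subseteq> V" "inj_on s I"
  shows "avg V (\<lambda>A. (\<Sum>i\<in>I. c i * chi (s i) A)\<^sup>2) = (\<Sum>i\<in>I. (c i)\<^sup>2)"
proof -
  have "avg V (\<lambda>A. (\<Sum>i\<in>I. c i * chi (s i) A)\<^sup>2)
      = avg V (\<lambda>A. \<Sum>i\<in>I. \<Sum>j\<in>I. (c i * c j) * (chi (s i) A * chi (s j) A))"
    by (simp add: power2_eq_square sum_product algebra_simps)
  also have "\<dots> = (\<Sum>i\<in>I. \<Sum>j\<in>I. (c i * c j) * of_bool (s i = s j))"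
    using assms by (simp add: avg_sum avg_cmult avg_chi_mult)
  also have "\<dots> = (\<Sum>i\<in>I. \<Sum>j\<in>I. (c i * c j) * of_bool (i = j))"
    using assms(4) by (intro sum.cong refl) (auto simp: inj_on_def)
  also have "\<dots> = (\<Sum>i\<in>I. (c i)\<^sup>2)"
    using assms by (intro sum.cong refl) (simp add: power2_eq_square)
  finally show ?thesis .
qed

section \<open>Derivatives in a set of directions\<close>

lemma deriv_on_chi:
  assumes "finite S" "finite T" "finite x"
  shows "deriv_on T (chi S) x = of_bool (T \<subseteq> S) * chi (S - T) x"
proof -
  \<comment> \<open>In directions belonging to \<open>S\<close> the sign of the derivative cancels
    that of the character. Those outside \<open>S\<close> leave \<open>chi (T - S) Z\<close>, whose
    sum over \<open>Z\<close> vanishes unless \<open>T \<subseteq> S\<close>.\<close>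
  have *: "(- 1) ^ card Z * chi S (x - T \<union> Z) = chi (S - T) x * chi (T - S) Z" if "Z \<in> Pow T" for Z
  proof -
    have fZ: "finite Z" using that assms finite_subset by auto
    have "card (S \<inter> (x - T \<union> Z)) = card ((S - T) \<inter> x) + card (S \<inter> Z)"
      using that assms fZ
      by (subst card_Un_disjoint [symmetric]) (auto intro!: arg_cong [where f=card])
    moreover have "card Z = card (S \<inter> Z) + card ((T - S) \<inter> Z)"
      using that assms fZ
      by (subst card_Un_disjoint [symmetric]) (auto intro!: arg_cong [where f=card])
    ultimately have "(- 1) ^ card Z * chi S (x - T \<union> Z)
        = (- 1 :: real) ^ (2 * card (S \<inter> Z) + card ((S - T) \<inter> x) + card ((T - S) \<inter> Z))"
      unfolding chi_def power_add [symmetric] by (simp add: algebra_simps mult_2)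
    then show ?thesis by (simp add: chi_def power_add power_mult)
  qed
  have "deriv_on T (chi S) x = chi (S - T) x * (\<Sum>Z\<in>Pow T. chi (T - S) Z) / 2 ^ card T"
    unfolding deriv_on_def sum_distrib_left by (intro arg_cong [where f="\<lambda>u. u / _"] sum.cong refl *)
  also have "\<dots> = of_bool (T \<subseteq> S) * chi (S - T) x"
    using assms by (subst sum_chi) auto
  finally show ?thesis .
qed

lemma deriv_on_fourier:
  assumes "finite V" "T \<subseteq> V" "x \<subseteq> V"
  shows "deriv_on T f x = (\<Sum>S\<in>{S \<in> Pow V. T \<subseteq> S}. fourier V f S * chi (S - T) x)"
proof -
  have fin: "finite T" "finite x" using assms finite_subset by auto
  have "deriv_on T f x = (\<Sum>Z\<in>Pow T. \<Sum>S\<in>Pow V. fourier V f S * ((- 1) ^ card Z * chi S (x - T \<union> Z))) / 2 ^ card T"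
    unfolding deriv_on_def
  proof (intro arg_cong [where f="\<lambda>u. u / _"] sum.cong refl)
    fix Z assume "Z \<in> Pow T"
    then have "x - T \<union> Z \<subseteq> V" using assms by auto
    from fourier_inversion [OF assms(1) this, of f]
    show "(- 1) ^ card Z * f (x - T \<union> Z) = (\<Sum>S\<in>Pow V. fourier V f S * ((- 1) ^ card Z * chi S (x - T \<union> Z)))"
      by (simp add: sum_distrib_left algebra_simps)
  qed
  also have "\<dots> = (\<Sum>S\<in>Pow V. fourier V f S * deriv_on T (chi S) x)"
    by (subst sum.swap) (simp add: deriv_on_def sum_distrib_left sum_divide_distrib)
  also have "\<dots> = (\<Sum>S\<in>Pow V. fourier V f S * (of_bool (T \<subseteq> S) * chi (S - T) x))"
    using assms fin finite_subset [OF _ assms(1)] by (intro sum.cong refl) (simp add: deriv_on_chi)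
  also have "\<dots> = (\<Sum>S\<in>Pow V. if T \<subseteq> S then fourier V f S * chi (S - T) x else 0)"
    by (intro sum.cong refl) simp
  also have "\<dots> = (\<Sum>S\<in>{S \<in> Pow V. T \<subseteq> S}. fourier V f S * chi (S - T) x)"
    using assms by (subst sum.inter_filter) auto
  finally show ?thesis .
qed

text \<open>Only the constant character has a non-zero mean, and among the supersets
  \<open>S\<close> of \<open>T\<close> only \<open>T\<close> itself has
  \<open>S - T = {}\<close>.\<close>

lemma avg_deriv_on:
  assumes "finite V" "T \<subseteq> V"
  shows "avg V (deriv_on T f) = fourier V f T"
proof -
  have "avg V (deriv_on T f)
      = avg V (\<lambda>x. \<Sum>S\<in>{S \<in> Pow V. T \<subseteq> S}. fourier V f S * chi (S - T) x)"
    using assms by (intro avg_cong) (simp add: deriv_on_fourier)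
  also have "\<dots> = (\<Sum>S\<in>{S \<in> Pow V. T \<subseteq> S}. fourier V f S * of_bool (S = T))"
    unfolding avg_sum avg_cmult
    by (intro sum.cong refl, subst avg_chi) (use assms in auto)
  also have "\<dots> = fourier V f T"
    using assms by simp
  finally show ?thesis .
qed

lemma avg_deriv_on_square:
  assumes "finite V" "T \<subseteq> V"
  shows "avg V (\<lambda>x. (deriv_on T f x)\<^sup>2) = (\<Sum>S\<in>{S \<in> Pow V. T \<subseteq> S}. (fourier V f S)\<^sup>2)"
proof -
  have "avg V (\<lambda>x. (deriv_on T f x)\<^sup>2)
      = avg V (\<lambda>x. (\<Sum>S\<in>{S \<in> Pow V. T \<subseteq> S}. fourier V f S * chi (S - T) x)\<^sup>2)"
    using assms by (intro avg_cong) (simp add: deriv_on_fourier)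
  also have "\<dots> = (\<Sum>S\<in>{S \<in> Pow V. T \<subseteq> S}. (fourier V f S)\<^sup>2)"
    using assms by (intro avg_square_expansion) (auto simp: inj_on_def)
  finally show ?thesis .
qed

text \<open>Differentiation in the directions \<open>T - s\<close> and then in \<open>s\<close>.
  Hence a non-zero derivative remains non-zero in the directions \<open>T - s\<close> after a
  suitable assignment \<open>P\<close> to \<open>s\<close>.\<close>

lemma deriv_on_split:
  assumes "finite T" "s \<subseteq> T"
  shows "deriv_on T f x
    = (\<Sum>P\<in>Pow s. (- 1) ^ card P * deriv_on (T - s) f (x - s \<union> P)) / 2 ^ card s"
proof -
  have fin: "finite s" using assms finite_subset by auto
  have "(\<Sum>Z\<in>Pow T. (- 1) ^ card Z * f (x - T \<union> Z))
      = (\<Sum>(P,Q)\<in>Pow s \<times> Pow (T - s). (- 1) ^ card (P \<union> Q) * f (x - T \<union> (P \<union> Q)))"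
    by (rule sum.reindex_bij_witness [where i="\<lambda>(P,Q). P \<union> Q" and j="\<lambda>Z. (Z \<inter> s, Z - s)"])
      (use assms in \<open>auto simp: Un_Diff Int_Un_distrib2 Un_Diff_Int Un_commute\<close>)
  also have "\<dots> = (\<Sum>P\<in>Pow s. \<Sum>Q\<in>Pow (T - s). (- 1) ^ card (P \<union> Q) * f (x - T \<union> (P \<union> Q)))"
    by (simp add: sum.cartesian_product)
  also have "\<dots> = (\<Sum>P\<in>Pow s. (- 1) ^ card P * (deriv_on (T - s) f (x - s \<union> P) * 2 ^ card (T - s)))"
  proof (intro sum.cong refl)
    fix P assume P: "P \<in> Pow s"
    have "(- 1) ^ card (P \<union> Q) * f (x - T \<union> (P \<union> Q))
        = (- 1) ^ card P * ((- 1) ^ card Q * f (x - s \<union> P - (T - s) \<union> Q))" if "Q \<in> Pow (T - s)" for Q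
    proof -
      have "card (P \<union> Q) = card P + card Q"
        using P that assms fin finite_subset [of Q T] finite_subset [of P s] by (intro card_Un_disjoint) auto
      moreover have "x - T \<union> (P \<union> Q) = x - s \<union> P - (T - s) \<union> Q"
        using P that assms by auto
      ultimately show ?thesis by (simp add: power_add)
    qed
    then show "(\<Sum>Q\<in>Pow (T - s). (- 1) ^ card (P \<union> Q) * f (x - T \<union> (P \<union> Q)))
        = (- 1) ^ card P * (deriv_on (T - s) f (x - s \<union> P) * 2 ^ card (T - s))"
      by (simp add: deriv_on_def sum_distrib_left)
  qed
  finally have "(\<Sum>Z\<in>Pow T. (- 1) ^ card Z * f (x - T \<union> Z))
      = (\<Sum>P\<in>Pow s. (- 1) ^ card P * deriv_on (T - s) f (x - s \<union> P)) * 2 ^ card (T - s)"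
    by (simp add: sum_distrib_right mult.assoc)
  moreover have "card T = card s + card (T - s)"
    using assms fin by (simp add: card_Diff_subset card_mono)
  ultimately show ?thesis
    by (simp add: deriv_on_def power_add)
qed

text \<open>Only values on the subcube through \<open>x\<close> enter. It serves for subcubes on
  which a DNF is constantly 0 or constantly 1.\<close>

lemma deriv_on_const:
  assumes "finite T" "T \<noteq> {}" "\<And>Z. Z \<subseteq> T \<Longrightarrow> f (x - T \<union> Z) = c"
  shows "deriv_on T f x = 0"
proof -
  have "(\<Sum>Z\<in>Pow T. (- 1) ^ card Z * f (x - T \<union> Z)) = c * (\<Sum>Z\<in>Pow T. chi T Z)"
    using assms by (auto simp: sum_distrib_left chi_def Int_absorb1 intro!: sum.cong)
  then show ?thesis
    using assms by (simp add: deriv_on_def sum_chi)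
qed

lemma abs_deriv_on_le:
  assumes "finite T" "\<And>x. \<bar>f x\<bar> \<le> 1"
  shows "\<bar>deriv_on T f x\<bar> \<le> 1"
proof -
  have "\<bar>\<Sum>Z\<in>Pow T. (- 1) ^ card Z * f (x - T \<union> Z)\<bar> \<le> (\<Sum>Z\<in>Pow T. \<bar>(- 1) ^ card Z * f (x - T \<union> Z)\<bar>)"
    by (rule sum_abs)
  also have "\<dots> \<le> (\<Sum>Z\<in>Pow T. 1)"
    using assms(2) by (intro sum_mono) (simp add: abs_mult power_abs)
  finally show ?thesis
    using assms by (simp add: deriv_on_def card_Pow)
qed

section \<open>Fourier tails of narrow DNF formulae\<close>

definition sat_term :: "'a set \<Rightarrow> ('a \<times> bool) list \<Rightarrow> bool" where
  "sat_term A t \<longleftrightarrow> (\<forall>(i, b)\<in>set t. (i \<in> A) = b)"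

definition sat_dnf :: "'a set \<Rightarrow> ('a \<times> bool) list list \<Rightarrow> bool" where
  "sat_dnf A \<phi> \<longleftrightarrow> (\<exists>t\<in>set \<phi>. sat_term A t)"

abbreviation dnf_fun :: "('a \<times> bool) list list \<Rightarrow> 'a set \<Rightarrow> real" where
  "dnf_fun \<phi> A \<equiv> of_bool (sat_dnf A \<phi>)"

text \<open>
  A code is a list of triples \<open>(flag, position, bit)\<close>. A raised flag makes the decoder look up the
  first term satisfied by the current assignment; the position selects a variable of that term,
  which is reset to the given bit and added to the decoded set.
\<close>

fun decode :: "('a \<times> bool) list list \<Rightarrow> ('a \<times> bool) list \<Rightarrow> (bool \<times> nat \<times> bool) list
    \<Rightarrow> 'a set \<Rightarrow> 'a set \<times> 'a set" where
  "decode \<phi> t [] y = ({}, y)"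
| "decode \<phi> t ((flag, p, b) # cs) y =
    (let t' = (if flag then hd (filter (sat_term y) \<phi>) else t);
         v = fst (t' ! p);
         r = decode \<phi> t' cs (if b then insert v y else y - {v})
     in (insert v (fst r), snd r))"

lemma decode_set: "finite (fst (decode \<phi> t cs y)) \<and> card (fst (decode \<phi> t cs y)) \<le> length cs"
proof (induction cs arbitrary: t y)
  case (Cons c cs)
  obtain flag p b where c: "c = (flag, p, b)" by (cases c)
  define t' where "t' = (if flag then hd (filter (sat_term y) \<phi>) else t)"
  define r where "r = fst (decode \<phi> t' cs (if b then insert (fst (t' ! p)) y else y - {fst (t' ! p)}))"
  have "fst (decode \<phi> t (c # cs) y) = insert (fst (t' ! p)) r"
    by (simp add: c t'_def r_def Let_def)
  moreover have "finite r \<and> card r \<le> length cs"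
    unfolding r_def by (rule Cons.IH)
  ultimately show ?case
    by (simp add: card_insert_if)
qed simp

text \<open>Unflagged entries keep the current term, so one block can list all relevant variables of
  a single term.\<close>

lemma decode_block:
  assumes "\<forall>v\<in>set vs. fst (t ! pos v) = v" "distinct vs"
  shows "decode \<phi> t (map (\<lambda>v. (False, pos v, v \<in> P)) vs @ cs) y
    = (set vs \<union> fst (decode \<phi> t cs (y - set vs \<union> (P \<inter> set vs))),
       snd (decode \<phi> t cs (y - set vs \<union> (P \<inter> set vs))))"
  using assms
proof (induction vs arbitrary: y)
  case Nil
  then show ?case by simp
next
  case (Cons v vs)
  define y1 where "y1 = (if v \<in> P then insert v y else y - {v})"
  have *: "y1 - set vs \<union> (P \<inter> set vs) = y - set (v # vs) \<union> (P \<inter> set (v # vs))"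
    using Cons.prems by (auto simp: y1_def)
  have "decode \<phi> t (map (\<lambda>v. (False, pos v, v \<in> P)) (v # vs) @ cs) y
      = (insert v (fst (decode \<phi> t (map (\<lambda>v. (False, pos v, v \<in> P)) vs @ cs) y1)),
         snd (decode \<phi> t (map (\<lambda>v. (False, pos v, v \<in> P)) vs @ cs) y1))"
    using Cons.prems by (simp add: Let_def y1_def)
  with Cons.IH [of y1] Cons.prems * show ?case by simp
qed

text \<open>The flag of the first entry makes the result independent of the previous term
  \<open>t0\<close>; therefore blocks can be concatenated.\<close>

lemma decode_first_block:
  assumes "\<forall>v\<in>set vs. fst (t ! pos v) = v" "distinct vs" "vs \<noteq> []"
    and "hd (filter (sat_term y) \<phi>) = t"
  shows "\<exists>blk. length blk = length vs \<and> set blk \<subseteq> UNIV \<times> pos ` set vs \<times> UNIV \<and>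
    (\<forall>t0 cs. decode \<phi> t0 (blk @ cs) y
      = (set vs \<union> fst (decode \<phi> t cs (y - set vs \<union> (P \<inter> set vs))),
         snd (decode \<phi> t cs (y - set vs \<union> (P \<inter> set vs)))))"
proof -
  obtain v us where vs: "vs = v # us" using assms(3) by (cases vs) auto
  define blk where "blk = (True, pos v, v \<in> P) # map (\<lambda>v. (False, pos v, v \<in> P)) us"
  have "decode \<phi> t0 (blk @ cs) y = decode \<phi> t (map (\<lambda>v. (False, pos v, v \<in> P)) vs @ cs) y" for t0 cs
    using assms(4) by (simp add: blk_def vs Let_def)
  with decode_block [OF assms(1,2)] show ?thesis
    by (intro exI [of _ blk]) (auto simp: blk_def vs)
qed

lemma hd_filter_eqI:
  "xs = us @ x # ws \<Longrightarrow> P x \<Longrightarrow> (\<And>u. u \<in> set us \<Longrightarrow> \<not> P u) \<Longrightarrow> hd (filter P xs) = x"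
  by simp

text \<open>
  This is Razborov's encoding from the proof of the switching lemma. The code replaces the values of
  the free variables of the first term that is still alive by the values that satisfy it; that term
  can then be recovered as the first satisfied one.
\<close>

lemma deriv_on_nonzero_imp_decode:
  assumes width: "\<forall>t\<in>set \<phi>. length t \<le> w"
    and "finite V" "T \<subseteq> V" "x \<subseteq> V" "deriv_on T (dnf_fun \<phi>) x \<noteq> 0"
  shows "\<exists>cs y. length cs = card T \<and> set cs \<subseteq> UNIV \<times> {..<w} \<times> UNIV \<and> y \<subseteq> V \<and> y - T = x - T \<and>
    (\<forall>t. fst (decode \<phi> t cs y) = T \<and> snd (decode \<phi> t cs y) - T = x - T)"
  using assms(3-5)
proof (induction "card T" arbitrary: T x rule: less_induct)
  case less
  have finT: "finite T" using less.prems \<open>finite V\<close> finite_subset by blast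
  show ?case
  proof (cases "T = {}")
    case True
    with less.prems show ?thesis
      by (intro exI [of _ "[]"] exI [of _ x]) auto
  next
    case False
    define alive where "alive t \<longleftrightarrow> (\<exists>Z\<subseteq>T. sat_term (x - T \<union> Z) t)" for t
    have "\<exists>t\<in>set \<phi>. alive t"
    proof (rule ccontr)
      assume none: "\<not> (\<exists>t\<in>set \<phi>. alive t)"
      have "\<not> sat_dnf (x - T \<union> Z) \<phi>" if "Z \<subseteq> T" for Z
        using none that unfolding alive_def sat_dnf_def by blast
      then have "deriv_on T (dnf_fun \<phi>) x = 0"
        using False finT by (intro deriv_on_const [where c=0]) auto
      with less.prems show False by simp
    qed
    then obtain us t ws where \<phi>: "\<phi> = us @ t # ws" and "alive t" and us: "\<forall>u\<in>set us. \<not> alive u"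
      using split_list_first_prop [of \<phi> alive] by blast
    then obtain Z0 where Z0: "Z0 \<subseteq> T" "sat_term (x - T \<union> Z0) t"
      by (auto simp: alive_def)
    define s where "s = fst ` set t \<inter> T"
    have sT: "s \<subseteq> T" and fs: "finite s" using finT by (auto simp: s_def)
    have sat_t: "sat_term z t" if "z - T = x - T" "z \<inter> s = Z0 \<inter> s" for z
      unfolding sat_term_def
    proof (intro ballI, clarify)
      fix i b assume ib: "(i, b) \<in> set t"
      then have "(i \<in> x - T \<union> Z0) = b" using Z0(2) by (auto simp: sat_term_def)
      moreover have "i \<in> z \<longleftrightarrow> i \<in> x - T \<union> Z0"
      proof (cases "i \<in> T")
        case True
        then have "i \<in> s" using ib by (force simp: s_def)
        then show ?thesis using that(2) True by blast
      next
        case False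
        then show ?thesis using that(1) Z0(1) by blast
      qed
      ultimately show "(i \<in> z) = b" by simp
    qed
    \<comment> \<open>If no variable of \<open>t\<close> were free, \<open>t\<close> would hold on
      the whole subcube and the derivative would vanish. A non-empty \<open>s\<close> also makes
      \<open>T - s\<close> smaller than \<open>T\<close>.\<close>
    have "s \<noteq> {}"
    proof
      assume "s = {}"
      then have "sat_dnf (x - T \<union> Z) \<phi>" if "Z \<subseteq> T" for Z
      proof -
        have "sat_term (x - T \<union> Z) t"
          by (rule sat_t) (use that \<open>s = {}\<close> in auto)
        then show ?thesis unfolding sat_dnf_def \<phi> by simp
      qed
      then have "deriv_on T (dnf_fun \<phi>) x = 0"
        using False finT by (intro deriv_on_const [where c=1]) auto
      with less.prems show False by simp
    qed
    obtain P where P: "P \<subseteq> s" "deriv_on (T - s) (dnf_fun \<phi>) (x - s \<union> P) \<noteq> 0"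
    proof -
      have "(\<Sum>P\<in>Pow s. (- 1) ^ card P * deriv_on (T - s) (dnf_fun \<phi>) (x - s \<union> P)) \<noteq> 0"
        using less.prems(3) unfolding deriv_on_split [OF finT sT] by simp
      then have "\<exists>P\<in>Pow s. deriv_on (T - s) (dnf_fun \<phi>) (x - s \<union> P) \<noteq> 0"
        by (rule contrapos_np) simp
      then show ?thesis
        using that unfolding Pow_def by blast
    qed
    have "card (T - s) < card T"
      using finT sT \<open>s \<noteq> {}\<close> by (intro psubset_card_mono) auto
    moreover have "T - s \<subseteq> V" "x - s \<union> P \<subseteq> V" using less.prems P(1) sT by auto
    ultimately have "\<exists>cs y. length cs = card (T - s) \<and> set cs \<subseteq> UNIV \<times> {..<w} \<times> UNIV \<and> y \<subseteq> V \<and>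
        y - (T - s) = x - s \<union> P - (T - s) \<and>
        (\<forall>t. fst (decode \<phi> t cs y) = T - s \<and> snd (decode \<phi> t cs y) - (T - s) = x - s \<union> P - (T - s))"
      using P(2) by (rule less.hyps)
    then obtain cs y where "length cs = card (T - s) \<and> set cs \<subseteq> UNIV \<times> {..<w} \<times> UNIV \<and> y \<subseteq> V \<and>
        y - (T - s) = x - s \<union> P - (T - s) \<and>
        (\<forall>t. fst (decode \<phi> t cs y) = T - s \<and> snd (decode \<phi> t cs y) - (T - s) = x - s \<union> P - (T - s))"
      by (elim exE)
    then have IH: "length cs = card (T - s)" "set cs \<subseteq> UNIV \<times> {..<w} \<times> UNIV" "y \<subseteq> V"
      "y - (T - s) = x - s \<union> P - (T - s)"
      "fst (decode \<phi> t cs y) = T - s"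
      "snd (decode \<phi> t cs y) - (T - s) = x - s \<union> P - (T - s)" for t
      by simp_all
    \<comment> \<open>The code for \<open>T - s\<close> belongs to a point with the values
      \<open>P\<close> on \<open>s\<close>. These are overwritten by values that satisfy
      \<open>t\<close>, while \<open>P\<close> goes into the bits of the new block, which restores
      it once \<open>t\<close> has been found.\<close>
    define y' where "y' = y - s \<union> (Z0 \<inter> s)"
    have y'T: "y' - T = x - T"
      using IH(4) sT P(1) by (auto simp: y'_def)
    have hd: "hd (filter (sat_term y') \<phi>) = t"
    proof (rule hd_filter_eqI [OF \<phi>])
      show "sat_term y' t"
      proof (rule sat_t [OF y'T])
        show "y' \<inter> s = Z0 \<inter> s" by (auto simp: y'_def)
      qed
      \<comment> \<open>Terms before \<open>t\<close> are not alive, so no point that agrees with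
        \<open>x\<close> outside \<open>T\<close> satisfies them.\<close>
      fix u assume "u \<in> set us"
      then have "\<not> sat_term (x - T \<union> (y' \<inter> T)) u"
        using us unfolding alive_def by blast
      moreover have "x - T \<union> (y' \<inter> T) = y'" using y'T by blast
      ultimately show "\<not> sat_term y' u" by simp
    qed
    have "\<forall>v\<in>s. \<exists>p<length t. fst (t ! p) = v"
    proof
      fix v assume "v \<in> s"
      then obtain b where "(v, b) \<in> set t" by (auto simp: s_def)
      then show "\<exists>p<length t. fst (t ! p) = v" by (metis fst_conv in_set_conv_nth)
    qed
    then obtain pos where pos: "\<And>v. v \<in> s \<Longrightarrow> pos v < length t \<and> fst (t ! pos v) = v"
      by metis
    obtain vs where vs: "set vs = s" "distinct vs"
      using finite_distinct_list [OF fs] by blast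
    have "length t \<le> w" using width \<phi> by auto
    obtain blk where blk: "length blk = card s" "set blk \<subseteq> UNIV \<times> pos ` s \<times> UNIV"
      and dec: "\<And>t0 cs. decode \<phi> t0 (blk @ cs) y'
        = (s \<union> fst (decode \<phi> t cs (y' - s \<union> (P \<inter> s))), snd (decode \<phi> t cs (y' - s \<union> (P \<inter> s))))"
    proof -
      have "vs \<noteq> []" using vs(1) \<open>s \<noteq> {}\<close> by auto
      from decode_first_block [OF _ vs(2) this hd, of pos P] pos
      show ?thesis using that distinct_card [OF vs(2)] unfolding vs(1) by auto
    qed
    have y: "y' - s \<union> (P \<inter> s) = y"
    proof -
      have "y \<inter> s = P" using IH(4) P(1) sT by blast
      then show ?thesis using P(1) by (auto simp: y'_def)
    qed
    show ?thesis
    proof (intro exI [of _ "blk @ cs"] exI [of _ y'] conjI allI)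
      show "length (blk @ cs) = card T"
        using blk IH(1) finT sT fs by (simp add: card_Diff_subset card_mono)
      show "set (blk @ cs) \<subseteq> UNIV \<times> {..<w} \<times> UNIV"
        proof -
        have "pos ` s \<subseteq> {..<w}" using pos \<open>length t \<le> w\<close> by force
        with blk(2) IH(2) show ?thesis unfolding set_append by blast
      qed
      show "y' \<subseteq> V"
        using IH(3) sT less.prems(1) by (auto simp: y'_def)
      show "y' - T = x - T" by fact
      fix t0
      show "fst (decode \<phi> t0 (blk @ cs) y') = T"
        using sT by (auto simp: dec y IH(5))
      show "snd (decode \<phi> t0 (blk @ cs) y') - T = x - T"
        using IH(6) [of t] sT P(1) by (auto simp: dec y)
    qed
  qed
qed

text \<open>Each of the \<open>k\<close> code entries has 2 * w * 2 values, and there are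
  \<open>2 ^ card V\<close> choices of \<open>y\<close>. Decoding recovers \<open>T\<close> and the
  part of \<open>x\<close> outside \<open>T\<close>; the lost part \<open>x \<inter> T\<close> costs
  another factor \<open>2 ^ k\<close>.\<close>

lemma card_deriv_on_nonzero:
  assumes width: "\<forall>t\<in>set \<phi>. length t \<le> w" and "finite V"
  shows "card {(T, x). T \<subseteq> V \<and> card T = k \<and> x \<subseteq> V \<and> deriv_on T (dnf_fun \<phi>) x \<noteq> 0}
    \<le> (8 * w) ^ k * 2 ^ card V" (is "card ?E \<le> _")
proof -
  define codes where "codes = {cs. set cs \<subseteq> (UNIV :: bool set) \<times> {..<w} \<times> (UNIV :: bool set) \<and> length cs = k}"
  define F where "F = (\<lambda>(cs, y). (\<lambda>Q. (fst (decode \<phi> [] cs y), snd (decode \<phi> [] cs y) - fst (decode \<phi> [] cs y) \<union> Q))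
    ` Pow (fst (decode \<phi> [] cs y)))"
  have fA: "finite ((UNIV :: bool set) \<times> {..<w} \<times> (UNIV :: bool set))" by simp
  have cA: "card ((UNIV :: bool set) \<times> {..<w} \<times> (UNIV :: bool set)) = 4 * w"
    by (simp only: card_cartesian_product card_UNIV_bool card_lessThan)
  have fc: "finite codes" and cc: "card codes = (4 * w) ^ k"
    unfolding codes_def by (rule finite_lists_length_eq [OF fA], simp only: card_lists_length_eq [OF fA] cA)
  have "?E \<subseteq> (\<Union>z\<in>codes \<times> Pow V. F z)"
  proof clarify
    fix T x assume *: "T \<subseteq> V" "x \<subseteq> V" "deriv_on T (dnf_fun \<phi>) x \<noteq> 0" "k = card T"
    from deriv_on_nonzero_imp_decode [OF width \<open>finite V\<close> *(1,2,3)]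
    obtain cs y where "length cs = card T \<and> set cs \<subseteq> UNIV \<times> {..<w} \<times> UNIV \<and> y \<subseteq> V \<and> y - T = x - T \<and>
      (\<forall>t. fst (decode \<phi> t cs y) = T \<and> snd (decode \<phi> t cs y) - T = x - T)"
      by (elim exE)
    then have cs: "length cs = card T" "set cs \<subseteq> UNIV \<times> {..<w} \<times> UNIV" "y \<subseteq> V"
      "fst (decode \<phi> [] cs y) = T" "snd (decode \<phi> [] cs y) - T = x - T"
      by simp_all
    have "(T, x) \<in> F (cs, y)"
      unfolding F_def prod.case cs(4,5) by (rule image_eqI [of _ _ "x \<inter> T"]) (blast, blast)
    moreover have "(cs, y) \<in> codes \<times> Pow V"
      unfolding codes_def using cs(1-3) *(4) by simp
    ultimately show "(T, x) \<in> (\<Union>z\<in>codes \<times> Pow V. F z)" by blast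
  qed
  moreover have "finite (\<Union>z\<in>codes \<times> Pow V. F z)"
  proof (intro finite_UN_I)
    show "finite (codes \<times> Pow V)" using fc \<open>finite V\<close> by simp
    show "finite (F z)" for z
      unfolding F_def by (cases z) (simp add: decode_set [THEN conjunct1])
  qed
  ultimately have "card ?E \<le> card (\<Union>z\<in>codes \<times> Pow V. F z)"
    by (intro card_mono)
  also have "\<dots> \<le> (\<Sum>z\<in>codes \<times> Pow V. card (F z))"
    using fc \<open>finite V\<close> by (intro card_UN_le) auto
  also have "\<dots> \<le> (\<Sum>z\<in>codes \<times> Pow V. 2 ^ k)"
  proof (rule sum_mono)
    fix z assume z: "z \<in> codes \<times> Pow V"
    obtain cs y where zz: "z = (cs, y)" by (cases z)
    have "card (F z) \<le> card (Pow (fst (decode \<phi> [] cs y)))"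
      unfolding F_def zz prod.case using decode_set by (intro card_image_le) auto
    also have "\<dots> = 2 ^ card (fst (decode \<phi> [] cs y))"
      using decode_set by (subst card_Pow) auto
    also have "\<dots> \<le> 2 ^ k"
      using decode_set [of \<phi> "[]" cs y] z zz by (intro power_increasing) (auto simp: codes_def)
    finally show "card (F z) \<le> 2 ^ k" .
  qed
  also have "\<dots> = card codes * card (Pow V) * 2 ^ k"
    by (simp only: sum_constant card_cartesian_product of_nat_id)
  also have "\<dots> = (4 * w) ^ k * 2 ^ k * 2 ^ card V"
    using \<open>finite V\<close> by (simp only: cc card_Pow mult_ac)
  also have "(4 * w) ^ k * 2 ^ k = (8 * w) ^ k"
    unfolding power_mult_distrib [symmetric] by simp
  finally show ?thesis .
qed

section \<open>From the count to Fourier levels and tails\<close>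

lemma sum_avg_deriv_on_nonzero:
  assumes width: "\<forall>t\<in>set \<phi>. length t \<le> w" and "finite V"
  shows "(\<Sum>T\<in>{T \<in> Pow V. card T = k}. avg V (\<lambda>x. of_bool (deriv_on T (dnf_fun \<phi>) x \<noteq> 0)))
    \<le> (8 * real w) ^ k"
proof -
  let ?E = "{(T, x). T \<subseteq> V \<and> card T = k \<and> x \<subseteq> V \<and> deriv_on T (dnf_fun \<phi>) x \<noteq> 0}"
  have E: "?E = (SIGMA T:{T \<in> Pow V. card T = k}. {x \<in> Pow V. deriv_on T (dnf_fun \<phi>) x \<noteq> 0})"
    by auto
  have "(\<Sum>T\<in>{T \<in> Pow V. card T = k}. avg V (\<lambda>x. of_bool (deriv_on T (dnf_fun \<phi>) x \<noteq> 0)))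
      = real (card ?E) / 2 ^ card V"
    unfolding E using \<open>finite V\<close>
    by (subst card_SigmaI) (auto simp: avg_of_bool sum_divide_distrib)
  also have "\<dots> \<le> real ((8 * w) ^ k * 2 ^ card V) / 2 ^ card V"
    by (intro divide_right_mono of_nat_mono card_deriv_on_nonzero assms) auto
  finally show ?thesis by simp
qed

text \<open>A Fourier coefficient is the mean of a derivative bounded by 1, hence at most the
  probability that this derivative is non-zero.\<close>

lemma fourier_level_l1:
  assumes width: "\<forall>t\<in>set \<phi>. length t \<le> w" and "finite V"
  shows "(\<Sum>T\<in>{T \<in> Pow V. card T = k}. \<bar>fourier V (dnf_fun \<phi>) T\<bar>) \<le> (8 * real w) ^ k"
proof -
  have "\<bar>fourier V (dnf_fun \<phi>) T\<bar> \<le> avg V (\<lambda>x. of_bool (deriv_on T (dnf_fun \<phi>) x \<noteq> 0))"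
    if "T \<in> Pow V" for T
  proof -
    have "finite T" using that \<open>finite V\<close> finite_subset by auto
    then have *: "\<bar>deriv_on T (dnf_fun \<phi>) x\<bar> \<le> of_bool (deriv_on T (dnf_fun \<phi>) x \<noteq> 0)" for x
      using abs_deriv_on_le [of T "dnf_fun \<phi>" x] by auto
    have "\<bar>fourier V (dnf_fun \<phi>) T\<bar> = \<bar>avg V (deriv_on T (dnf_fun \<phi>))\<bar>"
      using that \<open>finite V\<close> by (simp add: avg_deriv_on)
    also have "\<dots> \<le> avg V (\<lambda>x. \<bar>deriv_on T (dnf_fun \<phi>) x\<bar>)" by (rule abs_avg_le)
    also have "\<dots> \<le> avg V (\<lambda>x. of_bool (deriv_on T (dnf_fun \<phi>) x \<noteq> 0))"
      by (rule avg_mono) (rule *)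
    finally show ?thesis .
  qed
  then show ?thesis
    by (intro order_trans [OF sum_mono sum_avg_deriv_on_nonzero [OF assms]]) auto
qed

text \<open>The mean square of the derivative in the directions \<open>T\<close> collects all
  \<open>S\<close> above \<open>T\<close>; summation over \<open>T\<close> of size \<open>k\<close>
  counts each \<open>S\<close> as often as it has \<open>k\<close>-subsets.\<close>

lemma fourier_binomial_weight:
  assumes width: "\<forall>t\<in>set \<phi>. length t \<le> w" and "finite V"
  shows "(\<Sum>S\<in>Pow V. real (card S choose k) * (fourier V (dnf_fun \<phi>) S)\<^sup>2) \<le> (8 * real w) ^ k"
proof -
  let ?f = "\<lambda>S. (fourier V (dnf_fun \<phi>) S)\<^sup>2"
  have "(\<Sum>S\<in>Pow V. real (card S choose k) * ?f S) = (\<Sum>S\<in>Pow V. \<Sum>T\<in>{T. T \<subseteq> S \<and> card T = k}. ?f S)"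
    using finite_subset [OF _ \<open>finite V\<close>] by (intro sum.cong refl) (simp add: n_subsets)
  also have "\<dots> = (\<Sum>S\<in>Pow V. \<Sum>T\<in>{T \<in> {T \<in> Pow V. card T = k}. T \<subseteq> S}. ?f S)"
    by (intro sum.cong refl) auto
  also have "\<dots> = (\<Sum>T\<in>{T \<in> Pow V. card T = k}. \<Sum>S\<in>{S \<in> Pow V. T \<subseteq> S}. ?f S)"
    using \<open>finite V\<close> by (subst sum.swap_restrict) auto
  also have "\<dots> = (\<Sum>T\<in>{T \<in> Pow V. card T = k}. avg V (\<lambda>x. (deriv_on T (dnf_fun \<phi>) x)\<^sup>2))"
    using \<open>finite V\<close> by (intro sum.cong refl) (simp add: avg_deriv_on_square)
  also have "\<dots> \<le> (\<Sum>T\<in>{T \<in> Pow V. card T = k}. avg V (\<lambda>x. of_bool (deriv_on T (dnf_fun \<phi>) x \<noteq> 0)))"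
  proof (intro sum_mono avg_mono)
    fix T x assume "T \<in> {T \<in> Pow V. card T = k}"
    then have "finite T" using \<open>finite V\<close> finite_subset by auto
    then have "\<bar>deriv_on T (dnf_fun \<phi>) x\<bar> \<le> 1" by (rule abs_deriv_on_le) simp
    then show "(deriv_on T (dnf_fun \<phi>) x)\<^sup>2 \<le> of_bool (deriv_on T (dnf_fun \<phi>) x \<noteq> 0)"
      by (auto simp: abs_square_le_1)
  qed
  also have "\<dots> \<le> (8 * real w) ^ k"
    by (rule sum_avg_deriv_on_nonzero [OF assms])
  finally show ?thesis .
qed

section \<open>Sandwiching polynomials\<close>

text \<open>\<open>low_norm V d B p\<close>: on the subsets of \<open>V\<close>, \<open>p\<close> is a combination of characters of degree at
  most \<open>d\<close> whose coefficients have absolute sum at most \<open>B\<close>.\<close>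

inductive low_norm :: "'a set \<Rightarrow> nat \<Rightarrow> real \<Rightarrow> ('a set \<Rightarrow> real) \<Rightarrow> bool" for V where
  low_norm_chi: "S \<subseteq> V \<Longrightarrow> card S \<le> d \<Longrightarrow> low_norm V d 1 (chi S)"
| low_norm_cmult: "low_norm V d B p \<Longrightarrow> low_norm V d (\<bar>c\<bar> * B) (\<lambda>A. c * p A)"
| low_norm_add: "low_norm V d B p \<Longrightarrow> low_norm V d B' q \<Longrightarrow> low_norm V d (B + B') (\<lambda>A. p A + q A)"
| low_norm_mono: "low_norm V d B p \<Longrightarrow> d \<le> d' \<Longrightarrow> B \<le> B' \<Longrightarrow> (\<And>A. A \<subseteq> V \<Longrightarrow> p A = q A) \<Longrightarrow> low_norm V d' B' q"

lemma low_norm_nonneg: "low_norm V d B p \<Longrightarrow> 0 \<le> B"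
  by (induction rule: low_norm.induct) auto

lemma low_norm_const: "low_norm V d \<bar>c\<bar> (\<lambda>_. c)"
proof -
  have "low_norm V d (\<bar>c\<bar> * 1) (\<lambda>A. c * chi {} A)"
    by (intro low_norm_cmult low_norm_chi) auto
  then show ?thesis by (simp add: chi_def)
qed

lemma low_norm_diff:
  assumes "low_norm V d B p" "low_norm V d B' q"
  shows "low_norm V d (B + B') (\<lambda>A. p A - q A)"
  using low_norm_add [OF assms(1) low_norm_cmult [OF assms(2), of "- 1"]] by simp

lemma low_norm_sum:
  assumes "finite I" "\<And>i. i \<in> I \<Longrightarrow> low_norm V d (B i) (p i)"
  shows "low_norm V d (\<Sum>i\<in>I. B i) (\<lambda>A. \<Sum>i\<in>I. p i A)"
  using assms
proof (induction I rule: finite_induct)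
  case empty
  then show ?case using low_norm_const [of V d 0] by simp
next
  case (insert i I)
  then show ?case by (simp add: low_norm_add)
qed

text \<open>Characters multiply to characters of the symmetric difference, whose size is at most the
  sum of the sizes. The general case follows by bilinearity, that is, by an induction on each
  factor.\<close>

lemma low_norm_mult:
  assumes "finite V" "low_norm V d B p" "low_norm V d' B' q"
  shows "low_norm V (d + d') (B * B') (\<lambda>A. p A * q A)"
  using assms(2,3)
proof (induction arbitrary: d' B' q rule: low_norm.induct)
  case (low_norm_chi S d)
  show ?case
    using low_norm_chi.prems low_norm_chi.hyps
  proof (induction rule: low_norm.induct)
    case (low_norm_chi T d')
    have fin: "finite S" "finite T" using low_norm_chi assms(1) finite_subset by auto
    have "card (sym_diff S T) \<le> card (S \<union> T)"
      using fin by (intro card_mono) auto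
    also have "\<dots> \<le> d + d'"
      using card_Un_le [of S T] low_norm_chi by linarith
    finally have "low_norm V (d + d') 1 (chi (sym_diff S T))"
      using low_norm_chi by (intro low_norm.low_norm_chi) auto
    then show ?case
      by (rule low_norm_mono) (auto simp: chi_mult finite_subset [OF _ assms(1)])
  next
    case (low_norm_cmult d' B' q c)
    from low_norm.low_norm_cmult [OF low_norm_cmult.IH [OF low_norm_cmult.prems], of c]
    show ?case by (rule low_norm_mono) (auto simp: algebra_simps)
  next
    case (low_norm_add d' B1 q1 B2 q2)
    from low_norm.low_norm_add [OF low_norm_add.IH(1,2) [OF low_norm_add.prems]]
    show ?case by (rule low_norm_mono) (auto simp: algebra_simps)
  next
    case (low_norm_mono d1 B1 p d2 B2 q)
    from low_norm_mono.IH [OF low_norm_mono.prems]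
    show ?case by (rule low_norm.low_norm_mono) (use low_norm_mono in auto)
  qed
next
  case (low_norm_cmult d B p c)
  from low_norm.low_norm_cmult [OF low_norm_cmult.IH [OF low_norm_cmult.prems], of c]
  show ?case by (rule low_norm_mono) (auto simp: algebra_simps)
next
  case (low_norm_add d B1 p1 B2 p2)
  from low_norm.low_norm_add [OF low_norm_add.IH(1,2) [OF low_norm_add.prems]]
  show ?case by (rule low_norm_mono) (auto simp: algebra_simps)
next
  case (low_norm_mono d1 B1 p d2 B2 p')
  from low_norm_mono.IH [OF low_norm_mono.prems]
  show ?case
    by (rule low_norm.low_norm_mono)
      (use low_norm_mono low_norm_nonneg [OF low_norm_mono.prems] in \<open>auto intro: mult_right_mono\<close>)
qed

lemma low_norm_power2:
  assumes "finite V" "low_norm V d B p"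
  shows "low_norm V (2 * d) (B\<^sup>2) (\<lambda>A. (p A)\<^sup>2)"
  using low_norm_mult [OF assms(1,2,2)] by (simp add: power2_eq_square mult_2)

text \<open>A literal is 1/2 plus or minus half a character (minus for a positive one, as
  \<open>chi {i} A\<close> is -1 for \<open>i \<in> A\<close>). Its norm is 1, so the norm of a term
  does not grow with its length.\<close>

lemma low_norm_sat_term:
  assumes "finite V" "\<forall>(i, b)\<in>set t. i \<in> V"
  shows "low_norm V (length t) 1 (\<lambda>A. of_bool (sat_term A t))"
  using assms(2)
proof (induction t)
  case Nil
  then show ?case using low_norm_const [of V 0 1] by (simp add: sat_term_def)
next
  case (Cons l t)
  obtain i b where l: "l = (i, b)" by (cases l)
  have *: "low_norm V 1 1 (\<lambda>A. of_bool ((i \<in> A) = b))"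
  proof -
    have "low_norm V 1 1 (chi {i})"
      using Cons.prems l by (intro low_norm_chi) auto
    from low_norm_add [OF low_norm_const [of V 1 "1/2"] low_norm_cmult [OF this, of "if b then - (1/2) else 1/2"]]
    show ?thesis
      by (rule low_norm_mono) (auto simp: chi_def)
  qed
  have "low_norm V (1 + length t) (1 * 1) (\<lambda>A. of_bool ((i \<in> A) = b) * of_bool (sat_term A t))"
    using Cons by (intro low_norm_mult assms *) auto
  then show ?case
    by (rule low_norm_mono) (auto simp: sat_term_def l)
qed

text \<open>The empty character has no error and each other one at most \<open>\<epsilon>\<close>;
  by the triangle inequality the coefficient norm multiplies this error.\<close>

lemma low_norm_fooled:
  fixes g :: "'b \<Rightarrow> 'a set"
  assumes "low_norm V d B p" "d \<le> N" "finite V" "finite Y" "Y \<noteq> {}" "g ` Y \<subseteq> Pow V" "0 \<le> \<epsilon>"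
    and bias: "\<And>S. S \<subseteq> V \<Longrightarrow> S \<noteq> {} \<Longrightarrow> card S \<le> N \<Longrightarrow> \<bar>(\<Sum>y\<in>Y. chi S (g y)) / card Y\<bar> \<le> \<epsilon>"
  shows "\<bar>(\<Sum>y\<in>Y. p (g y)) / card Y - avg V p\<bar> \<le> \<epsilon> * B"
  using assms(1,2)
proof (induction rule: low_norm.induct)
  case (low_norm_chi S d)
  show ?case
  proof (cases "S = {}")
    case True
    then show ?thesis
      using assms by (simp add: avg_chi) (simp add: chi_def)
  next
    case False
    then show ?thesis
      using bias [of S] low_norm_chi assms by (simp add: avg_chi)
  qed
next
  case (low_norm_cmult d B p c)
  have "(\<Sum>y\<in>Y. c * p (g y)) / card Y - avg V (\<lambda>A. c * p A) = c * ((\<Sum>y\<in>Y. p (g y)) / card Y - avg V p)"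
    by (simp add: avg_cmult sum_distrib_left [symmetric] algebra_simps)
  then have "\<bar>(\<Sum>y\<in>Y. c * p (g y)) / card Y - avg V (\<lambda>A. c * p A)\<bar>
      = \<bar>c\<bar> * \<bar>(\<Sum>y\<in>Y. p (g y)) / card Y - avg V p\<bar>"
    by (simp only: abs_mult)
  also have "\<dots> \<le> \<bar>c\<bar> * (\<epsilon> * B)"
    by (intro mult_left_mono low_norm_cmult) simp
  finally show ?case by (simp only: mult_ac)
next
  case (low_norm_add d B1 p B2 q)
  have "(\<Sum>y\<in>Y. p (g y) + q (g y)) / card Y - avg V (\<lambda>A. p A + q A)
      = ((\<Sum>y\<in>Y. p (g y)) / card Y - avg V p) + ((\<Sum>y\<in>Y. q (g y)) / card Y - avg V q)"
    by (simp add: avg_add sum.distrib add_divide_distrib)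
  then show ?case
    using low_norm_add by (simp add: algebra_simps)
next
  case (low_norm_mono d B p d' B' q)
  have "(\<Sum>y\<in>Y. q (g y)) = (\<Sum>y\<in>Y. p (g y))"
    using assms(6) low_norm_mono.hyps(4) by (intro sum.cong refl) (metis PowD image_subset_iff)
  moreover have "avg V q = avg V p"
    using low_norm_mono.hyps(4) by (intro avg_cong) simp
  moreover have "\<epsilon> * B \<le> \<epsilon> * B'"
    using low_norm_mono assms(7) by (intro mult_left_mono)
  ultimately show ?case
    using low_norm_mono by simp
qed

section \<open>Low-degree approximation and Bazzi's construction\<close>

lemma sum_powers_le:
  fixes x :: real
  assumes "2 \<le> x"
  shows "(\<Sum>j<m. x ^ j) \<le> x ^ m"
proof (induction m)
  case (Suc m)
  have "(\<Sum>j<Suc m. x ^ j) \<le> 2 * x ^ m" using Suc by simp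
  also have "\<dots> \<le> x ^ Suc m" using assms by (simp add: mult_right_mono)
  finally show ?case .
qed simp

text \<open>The Fourier expansion is cut off at level \<open>m = 16 * w * k\<close>. Above it the
  binomial weight is at least (m / k)^k = (16 w)^k, but the weighted total is at most (8 w)^k, so
  the tail is at most 2^-k.\<close>

lemma dnf_low_degree_approx:
  assumes width: "\<forall>t\<in>set \<phi>. length t \<le> w" and "finite V" "1 \<le> w" "1 \<le> k"
  shows "\<exists>h. low_norm V (16 * w * k) ((8 * real w) ^ (16 * w * k)) h \<and>
    avg V (\<lambda>A. (dnf_fun \<phi> A - h A)\<^sup>2) \<le> (1 / 2) ^ k"
proof -
  define m where "m = 16 * w * k"
  define c where "c = fourier V (dnf_fun \<phi>)"
  define Lo where "Lo = {S \<in> Pow V. card S < m}"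
  define Hi where "Hi = {S \<in> Pow V. \<not> card S < m}"
  define h where "h = (\<lambda>A. \<Sum>S\<in>Lo. c S * chi S A)"
  have fin: "finite Lo" "finite Hi" using \<open>finite V\<close> by (auto simp: Lo_def Hi_def)
  have "low_norm V m (\<Sum>S\<in>Lo. \<bar>c S\<bar> * 1) h"
    unfolding h_def
    by (intro low_norm_sum fin low_norm_cmult low_norm_chi) (auto simp: Lo_def)
  moreover have "(\<Sum>S\<in>Lo. \<bar>c S\<bar> * 1) \<le> (8 * real w) ^ m"
  proof -
    have "(\<Sum>S\<in>Lo. \<bar>c S\<bar> * 1) = (\<Sum>j<m. \<Sum>S\<in>{S \<in> Lo. card S = j}. \<bar>c S\<bar>)"
      using fin by (subst sum.group) (auto simp: Lo_def)
    also have "\<dots> = (\<Sum>j<m. \<Sum>S\<in>{S \<in> Pow V. card S = j}. \<bar>c S\<bar>)"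
      by (intro sum.cong refl) (auto simp: Lo_def)
    also have "\<dots> \<le> (\<Sum>j<m. (8 * real w) ^ j)"
      unfolding c_def by (intro sum_mono fourier_level_l1 assms)
    also have "\<dots> \<le> (8 * real w) ^ m"
      using assms by (intro sum_powers_le) simp
    finally show ?thesis .
  qed
  ultimately have "low_norm V m ((8 * real w) ^ m) h"
    by (rule low_norm_mono [OF _ order_refl]) auto
  moreover have "avg V (\<lambda>A. (dnf_fun \<phi> A - h A)\<^sup>2) \<le> (1 / 2) ^ k"
  proof -
    have "dnf_fun \<phi> A - h A = (\<Sum>S\<in>Hi. c S * chi S A)" if "A \<subseteq> V" for A
    proof -
      have "Pow V = Lo \<union> Hi" "Lo \<inter> Hi = {}" by (auto simp: Lo_def Hi_def)
      then show ?thesis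
        using fourier_inversion [OF \<open>finite V\<close> that, of "dnf_fun \<phi>"] fin
        by (simp add: h_def c_def sum.union_disjoint)
    qed
    then have "avg V (\<lambda>A. (dnf_fun \<phi> A - h A)\<^sup>2) = avg V (\<lambda>A. (\<Sum>S\<in>Hi. c S * chi S A)\<^sup>2)"
      by (intro avg_cong) simp
    also have "\<dots> = (\<Sum>S\<in>Hi. (c S)\<^sup>2)"
      using fin \<open>finite V\<close> by (intro avg_square_expansion) (auto simp: Hi_def)
    finally have *: "avg V (\<lambda>A. (dnf_fun \<phi> A - h A)\<^sup>2) = (\<Sum>S\<in>Hi. (c S)\<^sup>2)" .
    have "(16 * real w) ^ k * (\<Sum>S\<in>Hi. (c S)\<^sup>2) \<le> (\<Sum>S\<in>Hi. real (card S choose k) * (c S)\<^sup>2)"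
      unfolding sum_distrib_left
    proof (intro sum_mono mult_right_mono)
      fix S assume "S \<in> Hi"
      then have "m \<le> card S" by (simp add: Hi_def)
      have "k \<le> m" using assms by (simp add: m_def)
      have "(16 * real w) ^ k = (real m / real k) ^ k"
        using assms by (simp add: m_def)
      also have "\<dots> \<le> real (m choose k)"
        using \<open>k \<le> m\<close> by (rule binomial_ge_n_over_k_pow_k)
      also have "\<dots> \<le> real (card S choose k)"
        using \<open>m \<le> card S\<close> by (simp add: binomial_right_mono)
      finally show "(16 * real w) ^ k \<le> real (card S choose k)" .
    qed simp
    also have "\<dots> \<le> (\<Sum>S\<in>Pow V. real (card S choose k) * (c S)\<^sup>2)"
      using \<open>finite V\<close> by (intro sum_mono2) (auto simp: Hi_def)
    also have "\<dots> \<le> (8 * real w) ^ k"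
      unfolding c_def by (rule fourier_binomial_weight [OF width \<open>finite V\<close>])
    also have "\<dots> = (16 * real w) ^ k * (1 / 2) ^ k"
      unfolding power_mult_distrib [symmetric] by simp
    finally show ?thesis
      using assms * by simp
  qed
  ultimately show ?thesis unfolding m_def by blast
qed

lemma dnf_fun_snoc: "dnf_fun (\<phi> @ [t]) A = dnf_fun \<phi> A + of_bool (sat_term A t) * (1 - dnf_fun \<phi> A)"
  by (auto simp: sat_dnf_def)

text \<open>Only the first satisfied term contributes. Each summand keeps its term as a factor, so
  approximating the other factor cannot produce a non-zero value where the DNF is false.\<close>

lemma dnf_fun_telescope:
  "dnf_fun \<phi> A = (\<Sum>i<length \<phi>. of_bool (sat_term A (\<phi> ! i)) * (1 - dnf_fun (take i \<phi>) A))"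
proof (induction \<phi> rule: rev_induct)
  case Nil
  then show ?case by (simp add: sat_dnf_def)
next
  case (snoc t \<phi>)
  show ?case
    unfolding dnf_fun_snoc by (subst snoc) (simp add: nth_append)
qed

text \<open>With \<open>s\<close> the number of satisfied terms, the polynomials are Bazzi's \<open>1 - (1 - g)\<^sup>2\<close> from below
  and \<open>1 - (1 - s) (1 - g)\<^sup>2\<close> from above, where \<open>g\<close> vanishes whenever no term is satisfied.\<close>

lemma dnf_sandwich:
  assumes width: "\<forall>t\<in>set \<phi>. length t \<le> w" and vars: "\<forall>t\<in>set \<phi>. \<forall>(i, b)\<in>set t. i \<in> V"
    and "finite V" "1 \<le> w" "1 \<le> k" "length \<phi> \<le> M" "1 \<le> M"
  defines "d \<equiv> 3 * (w + 16 * w * k)" and "B \<equiv> 19 * real M ^ 3 * (8 * real w) ^ (32 * w * k)"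
  shows "\<exists>L U. low_norm V d B L \<and> low_norm V d B U \<and>
    (\<forall>A. L A \<le> dnf_fun \<phi> A \<and> dnf_fun \<phi> A \<le> U A) \<and>
    avg V (\<lambda>A. dnf_fun \<phi> A - L A) \<le> real M ^ 3 * (1 / 2) ^ k \<and>
    avg V (\<lambda>A. U A - dnf_fun \<phi> A) \<le> real M ^ 3 * (1 / 2) ^ k"
proof -
  define H where "H = (8 * real w) ^ (16 * w * k)"
  have H1: "1 \<le> H" unfolding H_def using assms by (intro one_le_power) simp
  have "\<exists>h. low_norm V (16 * w * k) H h \<and> avg V (\<lambda>A. (dnf_fun (take i \<phi>) A - h A)\<^sup>2) \<le> (1 / 2) ^ k" for i
    unfolding H_def using width
    by (intro dnf_low_degree_approx assms) (auto dest: in_set_takeD)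
  then obtain h where h: "\<And>i. low_norm V (16 * w * k) H (h i)"
    and h2: "\<And>i. avg V (\<lambda>A. (dnf_fun (take i \<phi>) A - h i A)\<^sup>2) \<le> (1 / 2) ^ k"
    by metis
  define n where "n = length \<phi>"
  define C where "C i A = (of_bool (sat_term A (\<phi> ! i)) :: real)" for i A
  \<comment> \<open>In the telescoping sum each prefix DNF is replaced by its approximation. The
    factors \<open>C i\<close> force \<open>g\<close> to vanish where \<open>f\<close> does.\<close>
  define g where "g A = (\<Sum>i<n. C i A * (1 - h i A))" for A
  define s where "s A = (\<Sum>i<n. C i A)" for A
  define f where "f = dnf_fun \<phi>"
  define L where "L A = 1 - (1 - g A)\<^sup>2" for A
  define U where "U A = 1 - (1 - s A) * (1 - g A)\<^sup>2" for A
  have C01: "0 \<le> C i A" "C i A \<le> 1" for i A by (auto simp: C_def)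
  have f01: "f A = 0 \<or> f A = 1" for A by (auto simp: f_def)
  have C0: "C i A = 0" if "f A = 0" "i < n" for i A
    using that by (auto simp: f_def C_def n_def sat_dnf_def split: if_splits)
  have g0: "g A = 0" "s A = 0" if "f A = 0" for A
    using C0 [OF that] by (simp_all add: g_def s_def)
  have s1: "1 \<le> s A" if "f A = 1" for A
  proof -
    obtain i where i: "i < n" "C i A = 1"
    proof -
      have "sat_dnf A \<phi>" using \<open>f A = 1\<close> by (auto simp: f_def)
      then obtain i where "i < n" "sat_term A (\<phi> ! i)"
        unfolding sat_dnf_def n_def by (auto simp: in_set_conv_nth)
      then show ?thesis using that by (simp add: C_def)
    qed
    have "C i A \<le> s A"
      unfolding s_def using i C01 by (intro member_le_sum) auto
    with i show ?thesis by simp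
  qed
  have sM: "s A \<le> M" for A
  proof -
    have "s A \<le> (\<Sum>i<n. 1)" unfolding s_def by (intro sum_mono C01)
    with assms show ?thesis by (simp add: n_def)
  qed
  have M1: "1 \<le> real M" using assms by simp
  have nM: "real n \<le> M" using assms by (simp add: n_def)
  \<comment> \<open>Cauchy-Schwarz over at most \<open>M\<close> summands gives one factor
    \<open>M\<close>, the sum of their errors the other.\<close>
  have close: "avg V (\<lambda>A. (f A - g A)\<^sup>2) \<le> real M ^ 2 * (1 / 2) ^ k"
  proof -
    have "(f A - g A)\<^sup>2 \<le> real M * (\<Sum>i<n. (dnf_fun (take i \<phi>) A - h i A)\<^sup>2)" for A
    proof -
      have "f A - g A = (\<Sum>i<n. C i A * (h i A - dnf_fun (take i \<phi>) A))"
        unfolding f_def g_def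
        by (subst dnf_fun_telescope) (simp add: C_def n_def sum_subtractf [symmetric] algebra_simps)
      then have "(f A - g A)\<^sup>2 \<le> (\<Sum>i<n. (C i A * (h i A - dnf_fun (take i \<phi>) A))\<^sup>2) * card {..<n}"
        using sum_squared_le_sum_of_squares [of "\<lambda>i. C i A * (h i A - dnf_fun (take i \<phi>) A)" "{..<n}"]
        by simp
      also have "\<dots> \<le> (\<Sum>i<n. (dnf_fun (take i \<phi>) A - h i A)\<^sup>2) * card {..<n}"
        by (intro mult_right_mono sum_mono) (auto simp: C_def power2_commute)
      also have "\<dots> \<le> (\<Sum>i<n. (dnf_fun (take i \<phi>) A - h i A)\<^sup>2) * real M"
        using nM by (intro mult_left_mono sum_nonneg) auto
      finally show ?thesis by (simp add: mult.commute)
    qed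
    then have "avg V (\<lambda>A. (f A - g A)\<^sup>2) \<le> avg V (\<lambda>A. real M * (\<Sum>i<n. (dnf_fun (take i \<phi>) A - h i A)\<^sup>2))"
      by (intro avg_mono)
    also have "\<dots> = real M * (\<Sum>i<n. avg V (\<lambda>A. (dnf_fun (take i \<phi>) A - h i A)\<^sup>2))"
      by (simp add: avg_cmult avg_sum)
    also have "\<dots> \<le> real M * (\<Sum>i<n. (1 / 2) ^ k)"
      by (intro mult_left_mono sum_mono h2) simp
    also have "\<dots> \<le> real M * (real M * (1 / 2) ^ k)"
      using nM by (intro mult_left_mono) (auto intro: mult_right_mono)
    finally show ?thesis by (simp add: power2_eq_square)
  qed
  have close3: "real M * avg V (\<lambda>A. (f A - g A)\<^sup>2) \<le> real M ^ 3 * (1 / 2) ^ k"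
    using mult_left_mono [OF close, of "real M"] by (simp add: power3_eq_cube power2_eq_square)
  have nonneg: "0 \<le> avg V (\<lambda>A. (f A - g A)\<^sup>2)"
    by (rule avg_nonneg) simp
  \<comment> \<open>Where \<open>f\<close> is 0, so are \<open>g\<close> and \<open>L\<close>; where
    \<open>f\<close> is 1, the gap \<open>f - L\<close> is exactly the squared error of
    \<open>g\<close>.\<close>
  have fL: "f A - L A \<le> (f A - g A)\<^sup>2" "L A \<le> f A" for A
    using f01 [of A] g0 [of A] by (auto simp: L_def)
  have fU: "U A - f A \<le> real M * (f A - g A)\<^sup>2" "f A \<le> U A" for A
  proof -
    show "U A - f A \<le> real M * (f A - g A)\<^sup>2"
    proof (cases "f A = 0")
      case True
      then show ?thesis using g0 [of A] by (simp add: U_def)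
    next
      case False
      then have "f A = 1" using f01 by blast
      moreover have "(s A - 1) * (1 - g A)\<^sup>2 \<le> real M * (1 - g A)\<^sup>2"
        using sM [of A] by (intro mult_right_mono) auto
      ultimately show ?thesis by (simp add: U_def algebra_simps)
    qed
    show "f A \<le> U A"
    proof (cases "f A = 0")
      case True
      then show ?thesis using g0 [of A] by (simp add: U_def)
    next
      case False
      then have "f A = 1" using f01 by blast
      moreover have "0 \<le> (s A - 1) * (1 - g A)\<^sup>2"
        using s1 [of A] \<open>f A = 1\<close> by simp
      ultimately show ?thesis by (simp add: U_def algebra_simps)
    qed
  qed
  have normC: "low_norm V w 1 (C i)" if "i < n" for i
  proof -
    have "low_norm V (length (\<phi> ! i)) 1 (C i)"
      unfolding C_def using vars that by (intro low_norm_sat_term assms) (auto simp: n_def)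
    then show ?thesis
      by (rule low_norm_mono) (use width that in \<open>auto simp: n_def\<close>)
  qed
  have norm1: "low_norm V e 1 (\<lambda>_. 1)" for e
    using low_norm_const [of V e 1] by simp
  define D where "D = w + 16 * w * k"
  have normg: "low_norm V D (real n * (1 + H)) g"
  proof -
    have "low_norm V D (1 * (1 + H)) (\<lambda>A. C i A * (1 - h i A))" if "i < n" for i
      unfolding D_def by (intro low_norm_mult assms normC low_norm_diff norm1 h that)
    then have "low_norm V D (\<Sum>i<n. 1 * (1 + H)) g"
      unfolding g_def by (intro low_norm_sum) auto
    then show ?thesis by simp
  qed
  define Q where "Q = 3 * real M * H"
  have MH: "1 \<le> real M * H" using mult_mono [of 1 "real M" 1 H] M1 H1 by simp
  have normQ: "low_norm V D Q (\<lambda>A. 1 - g A)"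
  proof (rule low_norm_mono [OF low_norm_diff [OF norm1 normg]])
    have "real n * (1 + H) \<le> real M * (2 * H)"
      using nM H1 by (intro mult_mono) auto
    then show "1 + real n * (1 + H) \<le> Q"
      using MH by (simp add: Q_def)
  qed auto
  have Q2: "low_norm V (2 * D) (Q\<^sup>2) (\<lambda>A. (1 - g A)\<^sup>2)"
    by (intro low_norm_power2 assms normQ)
  have Qsq: "Q\<^sup>2 = 9 * real M ^ 2 * (8 * real w) ^ (32 * w * k)"
  proof -
    have "H\<^sup>2 = (8 * real w) ^ (32 * w * k)"
      unfolding H_def power_mult [symmetric] by (rule arg_cong [where f="power (8 * real w)"]) simp
    then show ?thesis by (simp add: Q_def power_mult_distrib)
  qed
  have "1 \<le> Q" using MH by (simp add: Q_def)
  then have "1 \<le> Q\<^sup>2" by simp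
  \<comment> \<open>This is the origin of 19 = 18 + 1: the part 2 M Q^2 bounds (1 + M) Q^2, and the
    remaining M^3 (8 w)^(32 w k) bounds the constant 1.\<close>
  have MQ: "B = 2 * real M * Q\<^sup>2 + real M * (real M)\<^sup>2 * (8 * real w) ^ (32 * w * k)"
    unfolding Qsq B_def by (simp add: power3_eq_cube power2_eq_square)
  have MB: "1 + (1 + real M) * Q\<^sup>2 \<le> B"
  proof -
    have "1 \<le> real M ^ 2 * (8 * real w) ^ (32 * w * k)"
      using M1 assms by (intro mult_ge1_I one_le_power) auto
    then have "1 \<le> real M * ((real M)\<^sup>2 * (8 * real w) ^ (32 * w * k))"
      using M1 mult_mono [of 1 "real M" 1 "(real M)\<^sup>2 * (8 * real w) ^ (32 * w * k)"] by simp
    moreover have "Q\<^sup>2 \<le> real M * Q\<^sup>2"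
      using mult_right_mono [OF M1, of "Q\<^sup>2"] by simp
    ultimately show ?thesis
      unfolding MQ by (simp add: algebra_simps)
  qed
  have "low_norm V d B L"
    unfolding L_def
  proof (rule low_norm_mono [OF low_norm_diff [OF norm1 Q2]])
    have "Q\<^sup>2 \<le> (1 + real M) * Q\<^sup>2" by (simp add: algebra_simps)
    with MB show "1 + Q\<^sup>2 \<le> B" by simp
  qed (auto simp: d_def D_def)
  moreover have "low_norm V d B U"
  proof -
    have "low_norm V w (\<Sum>i<n. 1) s"
      unfolding s_def by (intro low_norm_sum) (auto intro: normC)
    then have "low_norm V w (1 + real n) (\<lambda>A. 1 - s A)"
      using low_norm_diff [OF norm1] by simp
    from low_norm_diff [OF norm1 low_norm_mult [OF \<open>finite V\<close> this Q2]]
    show ?thesis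
      unfolding U_def
    proof (rule low_norm_mono)
      \<comment> \<open>\<open>1 - s\<close> has degree \<open>w\<close> and the square degree
        \<open>2 * D\<close>; together they stay below \<open>3 * D\<close>, which is
        \<open>d\<close>.\<close>
      show "w + 2 * D \<le> d" by (simp add: d_def D_def)
      have "(1 + real n) * Q\<^sup>2 \<le> (1 + real M) * Q\<^sup>2" using nM by (intro mult_right_mono) auto
      with MB show "1 + (1 + real n) * Q\<^sup>2 \<le> B" by simp
    qed (simp add: mult.commute)
  qed
  moreover have "avg V (\<lambda>A. f A - L A) \<le> real M ^ 3 * (1 / 2) ^ k"
  proof -
    have "avg V (\<lambda>A. f A - L A) \<le> avg V (\<lambda>A. (f A - g A)\<^sup>2)"
      by (intro avg_mono fL)
    also have "\<dots> \<le> real M * avg V (\<lambda>A. (f A - g A)\<^sup>2)"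
      using mult_right_mono [OF M1 nonneg] by simp
    finally show ?thesis using close3 by simp
  qed
  moreover have "avg V (\<lambda>A. U A - f A) \<le> real M ^ 3 * (1 / 2) ^ k"
  proof -
    have "avg V (\<lambda>A. U A - f A) \<le> avg V (\<lambda>A. real M * (f A - g A)\<^sup>2)"
      by (intro avg_mono fU)
    then show ?thesis using close3 by (simp add: avg_cmult)
  qed
  ultimately show ?thesis
    using fL fU unfolding f_def by blast
qed

text \<open>The gap between the polynomials is needed only under the uniform distribution; under the
  generator, monotonicity suffices, since \<open>L\<close> and \<open>U\<close> themselves are
  fooled.\<close>

lemma small_dnf_fooled:
  fixes g :: "'b \<Rightarrow> 'a set"
  assumes width: "\<forall>t\<in>set \<phi>. length t \<le> w" and vars: "\<forall>t\<in>set \<phi>. \<forall>(i, b)\<in>set t. i \<in> V"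
    and "finite V" "1 \<le> w" "1 \<le> k" "length \<phi> \<le> M" "1 \<le> M"
    and Y: "finite Y" "Y \<noteq> {}" "g ` Y \<subseteq> Pow V" "0 \<le> \<epsilon>" "3 * (w + 16 * w * k) \<le> N"
    and bias: "\<And>S. S \<subseteq> V \<Longrightarrow> S \<noteq> {} \<Longrightarrow> card S \<le> N \<Longrightarrow> \<bar>(\<Sum>y\<in>Y. chi S (g y)) / card Y\<bar> \<le> \<epsilon>"
  shows "\<bar>(\<Sum>y\<in>Y. dnf_fun \<phi> (g y)) / card Y - avg V (dnf_fun \<phi>)\<bar>
    \<le> real M ^ 3 * (1 / 2) ^ k + \<epsilon> * (19 * real M ^ 3 * (8 * real w) ^ (32 * w * k))"
proof -
  let ?d = "3 * (w + 16 * w * k)" and ?B = "19 * real M ^ 3 * (8 * real w) ^ (32 * w * k)"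
  obtain L U where LU: "low_norm V ?d ?B L" "low_norm V ?d ?B U"
    "\<And>A. L A \<le> dnf_fun \<phi> A" "\<And>A. dnf_fun \<phi> A \<le> U A"
    "avg V (\<lambda>A. dnf_fun \<phi> A - L A) \<le> real M ^ 3 * (1 / 2) ^ k"
    "avg V (\<lambda>A. U A - dnf_fun \<phi> A) \<le> real M ^ 3 * (1 / 2) ^ k"
    using dnf_sandwich [OF assms(1-7)] by blast
  have "\<bar>(\<Sum>y\<in>Y. L (g y)) / card Y - avg V L\<bar> \<le> \<epsilon> * ?B"
    by (rule low_norm_fooled [OF LU(1) Y(5) \<open>finite V\<close> Y(1-4) bias])
  moreover have "\<bar>(\<Sum>y\<in>Y. U (g y)) / card Y - avg V U\<bar> \<le> \<epsilon> * ?B"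
    by (rule low_norm_fooled [OF LU(2) Y(5) \<open>finite V\<close> Y(1-4) bias])
  moreover have "(\<Sum>y\<in>Y. L (g y)) / card Y \<le> (\<Sum>y\<in>Y. dnf_fun \<phi> (g y)) / card Y"
    by (intro divide_right_mono sum_mono LU) simp
  moreover have "(\<Sum>y\<in>Y. dnf_fun \<phi> (g y)) / card Y \<le> (\<Sum>y\<in>Y. U (g y)) / card Y"
    by (intro divide_right_mono sum_mono LU) simp
  ultimately show ?thesis
    using LU(5,6) unfolding avg_diff by linarith
qed

section \<open>Spread families of terms\<close>

text \<open>Terms become sets of literals here, so that a family can be measured by how many members
  contain a given subterm.\<close>

definition satisfies :: "'a set \<Rightarrow> ('a \<times> bool) set \<Rightarrow> bool" where
  "satisfies A C \<longleftrightarrow> (\<forall>(i, b)\<in>C. (i \<in> A) = b)"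

lemma satisfies_Un: "satisfies A (C \<union> D) \<longleftrightarrow> satisfies A C \<and> satisfies A D"
  by (auto simp: satisfies_def)

lemma satisfies_subset: "satisfies A C \<Longrightarrow> D \<subseteq> C \<Longrightarrow> satisfies A D"
  by (auto simp: satisfies_def)

lemma satisfies_Int: "fst ` C \<subseteq> W \<Longrightarrow> satisfies (A \<inter> W) C \<longleftrightarrow> satisfies A C"
  by (force simp: satisfies_def)

lemma avg_satisfies:
  assumes "finite V" "finite C" "inj_on fst C" "fst ` C \<subseteq> V"
  shows "avg V (\<lambda>A. of_bool (satisfies A C)) = (1 / 2) ^ card C"
proof -
  define T where "T = {i. (i, True) \<in> C}"
  have T: "T \<subseteq> fst ` C" by (force simp: T_def)
  have uniq: "b = b'" if "(i, b) \<in> C" "(i, b') \<in> C" for i b b'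
    using inj_onD [OF assms(3), of "(i, b)" "(i, b')"] that by simp
  have sat: "satisfies A C \<longleftrightarrow> A \<inter> fst ` C = T" for A
  proof
    assume "satisfies A C"
    then show "A \<inter> fst ` C = T" by (force simp: satisfies_def T_def)
  next
    assume A: "A \<inter> fst ` C = T"
    show "satisfies A C"
      unfolding satisfies_def
    proof clarify
      fix i b assume "(i, b) \<in> C"
      moreover from this have "i \<in> fst ` C" by force
      moreover have "(i, True) \<in> C \<longleftrightarrow> b" using uniq \<open>(i, b) \<in> C\<close> by (cases b) auto
      ultimately show "(i \<in> A) = b" using A by (auto simp: T_def)
    qed
  qed
  have "bij_betw (\<lambda>A. A - fst ` C) {A \<in> Pow V. satisfies A C} (Pow (V - fst ` C))"
    by (rule bij_betw_byWitness [where f'="\<lambda>B. B \<union> T"]) (use T assms(4) in \<open>auto simp: sat\<close>)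
  then have "card {A \<in> Pow V. satisfies A C} = 2 ^ card (V - fst ` C)"
    using assms(1) by (simp add: bij_betw_same_card card_Pow)
  moreover have "card V = card (V - fst ` C) + card C"
    using assms by (simp add: card_Diff_subset card_image card_mono [of V "fst ` C", unfolded card_image [OF assms(3)]])
  ultimately show ?thesis
    using assms(1) by (simp add: avg_of_bool power_add power_one_over)
qed

text \<open>Two consistent terms can contradict each other. Such unions contribute nothing to the
  second moment below.\<close>

lemma avg_satisfies_inconsistent:
  assumes "\<not> inj_on fst C"
  shows "avg V (\<lambda>A. of_bool (satisfies A C)) = 0"
proof -
  from assms obtain p q where pq: "p \<in> C" "q \<in> C" "p \<noteq> q" "fst p = fst q"
    unfolding inj_on_def by blast
  then have "snd p \<noteq> snd q" by (simp add: prod_eq_iff)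
  have "\<not> satisfies A C" for A
  proof
    assume "satisfies A C"
    then have "(fst p \<in> A) = snd p" "(fst q \<in> A) = snd q"
      using pq(1,2) unfolding satisfies_def by force+
    with \<open>snd p \<noteq> snd q\<close> pq(4) show False by simp
  qed
  then show ?thesis by (simp add: avg_def)
qed

text \<open>A subset of \<open>V\<close> is a pair of a subset of \<open>W\<close> and one of
  \<open>V - W\<close>, so the sum factors. The same factorisation with one function constantly 1
  yields the normalisation.\<close>

lemma avg_mult_indep:
  assumes "finite V" "W \<subseteq> V"
    and F: "\<And>x. x \<subseteq> V \<Longrightarrow> F x = F (x \<inter> W)" and G: "\<And>x. x \<subseteq> V \<Longrightarrow> G x = G (x - W)"
  shows "avg V (\<lambda>x. F x * G x) = avg V F * avg V G"
proof -
  have split: "(\<Sum>x\<in>Pow V. F' x * G' x) = (\<Sum>P\<in>Pow W. F' P) * (\<Sum>Q\<in>Pow (V - W). G' Q)"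
    if "\<And>x. x \<subseteq> V \<Longrightarrow> F' x = F' (x \<inter> W)" "\<And>x. x \<subseteq> V \<Longrightarrow> G' x = G' (x - W)"
    for F' G' :: "'a set \<Rightarrow> real"
  proof -
    have "(\<Sum>x\<in>Pow V. F' x * G' x) = (\<Sum>(P, Q)\<in>Pow W \<times> Pow (V - W). F' P * G' Q)"
    proof (rule sum.reindex_bij_witness [where i="\<lambda>(P, Q). P \<union> Q" and j="\<lambda>x. (x \<inter> W, x - W)"])
      fix x assume "x \<in> Pow V"
      then show "(case (x \<inter> W, x - W) of (P, Q) \<Rightarrow> F' P * G' Q) = F' x * G' x"
        using that(1) [of x] that(2) [of x] by simp
    qed (use assms(2) in auto)
    then show ?thesis by (simp add: sum_product sum.cartesian_product)
  qed
  have card: "(2::real) ^ card V = 2 ^ card W * 2 ^ card (V - W)"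
    using assms finite_subset [OF assms(2,1)]
    by (simp add: power_add [symmetric] card_Diff_subset card_mono)
  have fin: "finite W" "finite (V - W)" using assms finite_subset by auto
  have "(\<Sum>x\<in>Pow V. F x * G x) = (\<Sum>P\<in>Pow W. F P) * (\<Sum>Q\<in>Pow (V - W). G Q)"
    by (rule split) (fact F G)+
  moreover have "(\<Sum>x\<in>Pow V. F x * 1) = (\<Sum>P\<in>Pow W. F P) * (\<Sum>Q\<in>Pow (V - W). 1)"
    using F by (intro split) auto
  moreover have "(\<Sum>x\<in>Pow V. 1 * G x) = (\<Sum>P\<in>Pow W. 1) * (\<Sum>Q\<in>Pow (V - W). G Q)"
    using G by (intro split) auto
  ultimately show ?thesis
    using fin by (simp add: avg_def card card_Pow)
qed

lemma avg_prod_indep: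
  assumes "finite V" "finite I" "\<And>b. b \<in> I \<Longrightarrow> W b \<subseteq> V"
    and "\<And>b b'. b \<in> I \<Longrightarrow> b' \<in> I \<Longrightarrow> b \<noteq> b' \<Longrightarrow> W b \<inter> W b' = {}"
    and "\<And>b x. b \<in> I \<Longrightarrow> x \<subseteq> V \<Longrightarrow> F b x = F b (x \<inter> W b)"
  shows "avg V (\<lambda>x. \<Prod>b\<in>I. F b x) = (\<Prod>b\<in>I. avg V (F b))"
  using assms(2-)
proof (induction I rule: finite_induct)
  case empty
  then show ?case using assms(1) by (simp add: avg_const)
next
  case (insert b I)
  have "avg V (\<lambda>x. F b x * (\<Prod>b\<in>I. F b x)) = avg V (F b) * avg V (\<lambda>x. \<Prod>b\<in>I. F b x)"
  proof (rule avg_mult_indep [OF assms(1), of "W b"])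
    fix x assume x: "x \<subseteq> V"
    show "F b x = F b (x \<inter> W b)" using insert.prems(3) x by simp
    show "(\<Prod>a\<in>I. F a x) = (\<Prod>a\<in>I. F a (x - W b))"
    proof (rule prod.cong [OF refl])
      fix a assume a: "a \<in> I"
      then have "a \<noteq> b" using insert.hyps by auto
      then have "W b \<inter> W a = {}" using insert.prems(2) [of b a] a by auto
      then have "(x - W b) \<inter> W a = x \<inter> W a" by auto
      moreover have "x - W b \<subseteq> V" using x by auto
      ultimately show "F a x = F a (x - W b)"
        using insert.prems(3) [of a x] insert.prems(3) [of a "x - W b"] a x by simp
    qed
  qed (use insert.prems in auto)
  also have "avg V (\<lambda>x. \<Prod>b\<in>I. F b x) = (\<Prod>b\<in>I. avg V (F b))"
    using insert.prems by (intro insert.IH) auto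
  finally show ?case using insert.hyps by simp
qed

section \<open>Random colour classes of a spread family\<close>

lemma sum_Pow_power:
  fixes x :: real
  assumes "finite C"
  shows "(\<Sum>Z\<in>Pow C. x ^ card Z) = (1 + x) ^ card C"
  using assms
proof (induction C rule: finite_induct)
  case (insert a C)
  have "(\<Sum>Z\<in>Pow (insert a C). x ^ card Z) = (\<Sum>Z\<in>Pow C. x ^ card Z) + (\<Sum>Z\<in>insert a ` Pow C. x ^ card Z)"
    unfolding Pow_insert using insert.hyps by (intro sum.union_disjoint) auto
  also have "(\<Sum>Z\<in>insert a ` Pow C. x ^ card Z) = (\<Sum>Z\<in>Pow C. x ^ card (insert a Z))"
    using insert.hyps by (subst sum.reindex) (auto simp: inj_on_def)
  also have "\<dots> = (\<Sum>Z\<in>Pow C. x * x ^ card Z)"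
    using insert.hyps finite_subset [OF _ insert.hyps(1)]
    by (intro sum.cong refl) (subst card_insert_disjoint, auto)
  finally show ?case
    using insert by (simp add: sum_distrib_left [symmetric] algebra_simps)
qed simp

text \<open>The probability that all of \<open>W\<close> receives the colour \<open>b\<close> is 1 /
  t to the power \<open>card W\<close>, here multiplied out over the natural numbers.\<close>

lemma card_monochromatic:
  assumes "finite V" "W \<subseteq> V" "b < t"
  shows "card {c \<in> V \<rightarrow>\<^sub>E {..<t}. \<forall>v\<in>W. c v = b} * t ^ card W = t ^ card V"
proof -
  have "{c \<in> V \<rightarrow>\<^sub>E {..<t}. \<forall>v\<in>W. c v = b} = PiE V (\<lambda>v. if v \<in> W then {b} else {..<t})"
  proof (rule Set.set_eqI)
    fix c
    have "(\<forall>v\<in>V. c v < t) \<and> (\<forall>v\<in>W. c v = b) \<longleftrightarrow> (\<forall>v\<in>V. c v \<in> (if v \<in> W then {b} else {..<t}))"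
      using assms(2,3) by (auto split: if_splits)
    then show "c \<in> {c \<in> V \<rightarrow>\<^sub>E {..<t}. \<forall>v\<in>W. c v = b} \<longleftrightarrow> c \<in> PiE V (\<lambda>v. if v \<in> W then {b} else {..<t})"
      unfolding PiE_iff mem_Collect_eq lessThan_iff by metis
  qed
  then have "card {c \<in> V \<rightarrow>\<^sub>E {..<t}. \<forall>v\<in>W. c v = b} = (\<Prod>v\<in>V. if v \<in> W then 1 else t)"
    using assms(1) by (simp add: card_PiE if_distrib [of card] cong: if_cong)
  also have "\<dots> = (\<Prod>v\<in>W. 1) * (\<Prod>v\<in>V - W. t)"
    using assms by (subst prod.If_cases) (auto simp: Int_absorb1 Diff_eq)
  finally have "card {c \<in> V \<rightarrow>\<^sub>E {..<t}. \<forall>v\<in>W. c v = b} = t ^ card (V - W)"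
    by simp
  then show ?thesis
    using assms finite_subset [OF assms(2,1)]
    by (simp add: power_add [symmetric] card_Diff_subset card_mono)
qed

text \<open>The intended \<open>G\<close> is a subfamily through a common core, with the core
  removed from its terms and one member deleted.\<close>

locale term_family =
  fixes V :: "'a set" and G :: "('a \<times> bool) set set" and j :: nat
  assumes finV: "finite V" and finG: "finite G" and G_nonempty: "G \<noteq> {}"
    and finC: "C \<in> G \<Longrightarrow> finite C" and card_C: "C \<in> G \<Longrightarrow> card C = j"
    and inj_C: "C \<in> G \<Longrightarrow> inj_on fst C" and vars_C: "C \<in> G \<Longrightarrow> fst ` C \<subseteq> V"
begin

definition mean :: "nat \<Rightarrow> (('a \<Rightarrow> nat) \<Rightarrow> 'a set \<Rightarrow> real) \<Rightarrow> real" where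
  "mean t f = (\<Sum>c\<in>V \<rightarrow>\<^sub>E {..<t}. avg V (f c)) / real t ^ card V"

definition hit :: "nat \<Rightarrow> ('a \<times> bool) set \<Rightarrow> ('a \<Rightarrow> nat) \<Rightarrow> 'a set \<Rightarrow> real" where
  "hit b C c x = of_bool ((\<forall>v\<in>fst ` C. c v = b) \<and> satisfies x C)"

definition count :: "nat \<Rightarrow> ('a \<Rightarrow> nat) \<Rightarrow> 'a set \<Rightarrow> real" where
  "count b c x = (\<Sum>C\<in>G. hit b C c x)"

lemma finite_colorings: "finite (V \<rightarrow>\<^sub>E {..<t::nat})"
  using finV by (intro finite_PiE) auto

lemma mean_sum: "mean t (\<lambda>c x. \<Sum>i\<in>I. f i c x) = (\<Sum>i\<in>I. mean t (f i))"
  unfolding mean_def avg_sum by (subst sum.swap) (simp add: sum_divide_distrib)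

lemma mean_cmult: "mean t (\<lambda>c x. a * f c x) = a * mean t f"
  by (simp add: mean_def avg_cmult sum_distrib_left)

lemma mean_add: "mean t (\<lambda>c x. f c x + g c x) = mean t f + mean t g"
  by (simp add: mean_def avg_add sum.distrib add_divide_distrib)

lemma mean_const: "1 \<le> t \<Longrightarrow> mean t (\<lambda>_ _. a) = a"
  using finV by (simp add: mean_def avg_const card_PiE)

lemma mean_mono: "(\<And>c x. f c x \<le> g c x) \<Longrightarrow> mean t f \<le> mean t g"
  unfolding mean_def by (intro divide_right_mono sum_mono avg_mono) auto

text \<open>Each literal costs a factor 1 / t for its colour and 1/2 for its value. The inequality
  covers contradictory unions of terms as well.\<close>

lemma mean_hit:
  assumes "finite C" "fst ` C \<subseteq> V" "b < t"
  shows "mean t (hit b C) \<le> (1 / (2 * real t)) ^ card C"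
    and "inj_on fst C \<Longrightarrow> mean t (hit b C) = (1 / (2 * real t)) ^ card C"
proof -
  let ?q = "avg V (\<lambda>x. of_bool (satisfies x C))"
  have "mean t (hit b C) = (\<Sum>c\<in>V \<rightarrow>\<^sub>E {..<t}. of_bool (\<forall>v\<in>fst ` C. c v = b) * ?q) / real t ^ card V"
    unfolding mean_def hit_def avg_cmult [symmetric] by (simp add: of_bool_conj)
  also have "\<dots> = real (card {c \<in> V \<rightarrow>\<^sub>E {..<t}. \<forall>v\<in>fst ` C. c v = b}) / real t ^ card V * ?q"
    using finite_colorings
    by (simp add: sum_distrib_right [symmetric] Int_def)
  also have "\<dots> = (1 / real t) ^ card (fst ` C) * ?q"
  proof -
    have "real (card {c \<in> V \<rightarrow>\<^sub>E {..<t}. \<forall>v\<in>fst ` C. c v = b}) * real t ^ card (fst ` C) = real t ^ card V"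
      using card_monochromatic [OF finV assms(2,3)] by (simp flip: of_nat_mult of_nat_power)
    then show ?thesis
      using assms(3) by (simp add: field_simps)
  qed
  finally have *: "mean t (hit b C) = (1 / real t) ^ card (fst ` C) * ?q" .
  show eq: "mean t (hit b C) = (1 / (2 * real t)) ^ card C" if "inj_on fst C"
    using assms that finV
    by (simp add: * avg_satisfies card_image power_mult_distrib [symmetric] mult.commute)
  show "mean t (hit b C) \<le> (1 / (2 * real t)) ^ card C"
  proof (cases "inj_on fst C")
    case False
    then show ?thesis by (simp add: * avg_satisfies_inconsistent)
  qed (simp add: eq)
qed

lemma mean_count: "b < t \<Longrightarrow> mean t (count b) = card G * (1 / (2 * real t)) ^ j"
  unfolding count_def mean_sum by (simp add: mean_hit(2) finC vars_C inj_C card_C)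

text \<open>With p = 1 / (2 t), a pair \<open>C\<close>, \<open>D\<close> is hit with probability at
  most p^(2 j) (1 / p)^|C \<inter> D|, so pairs with a large intersection are the danger. Spreadness
  limits how many \<open>D\<close> contain a given part of \<open>C\<close>.\<close>

lemma mean_count_square:
  assumes "b < t" "0 < \<kappa>"
    and spread: "\<And>Z. finite Z \<Longrightarrow> real (card {C \<in> G. Z \<subseteq> C}) * \<kappa> ^ card Z \<le> real (card G)"
  shows "mean t (\<lambda>c x. (count b c x)\<^sup>2)
    \<le> (card G * (1 / (2 * real t)) ^ j)\<^sup>2 * (1 + 2 * real t / \<kappa>) ^ j"
proof -
  define p where "p = 1 / (2 * real t)"
  have p: "0 < p" "2 * real t = 1 / p" using assms by (auto simp: p_def)
  have "mean t (\<lambda>c x. (count b c x)\<^sup>2) = (\<Sum>C\<in>G. \<Sum>D\<in>G. mean t (hit b (C \<union> D)))"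
  proof -
    have "(count b c x)\<^sup>2 = (\<Sum>C\<in>G. \<Sum>D\<in>G. hit b (C \<union> D) c x)" for c x
      unfolding count_def power2_eq_square sum_product
      by (intro sum.cong refl) (auto simp: hit_def satisfies_Un)
    then show ?thesis by (simp add: mean_sum)
  qed
  also have "\<dots> \<le> (\<Sum>C\<in>G. \<Sum>D\<in>G. p ^ (2 * j) * (1 / p) ^ card (C \<inter> D))"
  proof (intro sum_mono)
    fix C D assume CD: "C \<in> G" "D \<in> G"
    have "card (C \<union> D) + card (C \<inter> D) = 2 * j"
      using card_Un_Int [of C D] CD by (simp add: finC card_C)
    then have "p ^ card (C \<union> D) = p ^ (2 * j) * (1 / p) ^ card (C \<inter> D)"
      using p by (simp add: power_one_over field_simps flip: power_add)
    moreover have "mean t (hit b (C \<union> D)) \<le> p ^ card (C \<union> D)"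
      unfolding p_def using CD assms vars_C by (intro mean_hit(1)) (auto simp: finC)
    ultimately show "mean t (hit b (C \<union> D)) \<le> p ^ (2 * j) * (1 / p) ^ card (C \<inter> D)" by simp
  qed
  also have "\<dots> = (\<Sum>C\<in>G. p ^ (2 * j) * (\<Sum>D\<in>G. (1 / p) ^ card (C \<inter> D)))"
    by (simp add: sum_distrib_left)
  also have "\<dots> \<le> (\<Sum>C\<in>G. p ^ (2 * j) * (card G * (1 + (1 / p) / \<kappa>) ^ j))"
  proof (intro sum_mono mult_left_mono)
    fix C assume C: "C \<in> G"
    \<comment> \<open>The single set \<open>Z = C \<inter> D\<close> is replaced by the sum over all
      common subsets \<open>Z\<close>; this allows counting by containment.\<close>
    have "(\<Sum>D\<in>G. (1 / p) ^ card (C \<inter> D)) \<le> (\<Sum>D\<in>G. \<Sum>Z\<in>Pow C. if Z \<subseteq> D then (1 / p) ^ card Z else 0)"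
    proof (intro sum_mono)
      fix D
      have "(1 / p) ^ card (C \<inter> D) = (if C \<inter> D \<subseteq> D then (1 / p) ^ card (C \<inter> D) else 0)" by simp
      also have "\<dots> \<le> (\<Sum>Z\<in>Pow C. if Z \<subseteq> D then (1 / p) ^ card Z else 0)"
        using p finC [OF C] by (intro member_le_sum) auto
      finally show "(1 / p) ^ card (C \<inter> D) \<le> (\<Sum>Z\<in>Pow C. if Z \<subseteq> D then (1 / p) ^ card Z else 0)" .
    qed
    also have "\<dots> = (\<Sum>Z\<in>Pow C. real (card {D \<in> G. Z \<subseteq> D}) * (1 / p) ^ card Z)"
      by (subst sum.swap) (simp add: sum.If_cases finG Int_def)
    also have "\<dots> \<le> (\<Sum>Z\<in>Pow C. card G * ((1 / p) / \<kappa>) ^ card Z)"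
    proof (intro sum_mono)
      fix Z assume "Z \<in> Pow C"
      then have "finite Z" using finC [OF C] finite_subset by auto
      from spread [OF this] have "real (card {D \<in> G. Z \<subseteq> D}) \<le> card G / \<kappa> ^ card Z"
        using assms(2) by (simp add: field_simps)
      then have "real (card {D \<in> G. Z \<subseteq> D}) * (1 / p) ^ card Z \<le> card G / \<kappa> ^ card Z * (1 / p) ^ card Z"
        using p by (intro mult_right_mono) auto
      then show "real (card {D \<in> G. Z \<subseteq> D}) * (1 / p) ^ card Z \<le> card G * ((1 / p) / \<kappa>) ^ card Z"
        by (simp add: power_divide power_mult_distrib mult.commute)
    qed
    also have "\<dots> = card G * (1 + (1 / p) / \<kappa>) ^ j"
      using finC [OF C] card_C [OF C] by (simp only: sum_distrib_left [symmetric] sum_Pow_power)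
    finally show "(\<Sum>D\<in>G. (1 / p) ^ card (C \<inter> D)) \<le> card G * (1 + (1 / p) / \<kappa>) ^ j" .
  qed (use p in simp)
  also have "\<dots> = (card G * p ^ j)\<^sup>2 * (1 + (1 / p) / \<kappa>) ^ j"
    by (simp add: power_mult_distrib power2_eq_square power_mult [symmetric] mult_2 power_add)
  finally show ?thesis
    unfolding p(2) [symmetric] by (simp add: p_def)
qed

text \<open>Used with x = 2 t / \<kappa>, for which
  \<open>8 * real t * real j \<le> \<kappa>\<close> gives j x \<le> 1/4. The bound 3/2 leaves a
  relative variance of at most 1/2.\<close>

lemma one_plus_power_le:
  assumes "0 \<le> x" "real j * x \<le> 1 / 4"
  shows "(1 + x) ^ j \<le> 3 / 2"
proof -
  have "(1 + x) ^ j \<le> exp x ^ j"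
    using assms by (intro power_mono exp_ge_add_one_self) auto
  also have "\<dots> = exp (real j * x)" by (simp add: exp_of_nat_mult)
  also have "\<dots> \<le> 1 + real j * x + (real j * x)\<^sup>2"
    using assms by (intro exp_bound) auto
  also have "(real j * x)\<^sup>2 \<le> (1 / 4)\<^sup>2"
    using assms by (intro power_mono) auto
  finally show ?thesis using assms by (simp add: power2_eq_square)
qed

text \<open>Chebyshev's inequality: where the count is 0 it deviates from its mean \<mu> by \<mu>,
  and the variance is at most \<mu>^2 / 2.\<close>

lemma mean_count_zero:
  assumes "b < t" "0 < \<kappa>" "8 * real t * real j \<le> \<kappa>"
    and spread: "\<And>Z. finite Z \<Longrightarrow> real (card {C \<in> G. Z \<subseteq> C}) * \<kappa> ^ card Z \<le> real (card G)"
  shows "mean t (\<lambda>c x. of_bool (count b c x = 0)) \<le> 1 / 2"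
proof -
  define \<mu> where "\<mu> = card G * (1 / (2 * real t)) ^ j"
  have \<mu>: "0 < \<mu>"
    unfolding \<mu>_def using assms finG G_nonempty by (simp add: card_gt_0_iff)
  have "\<mu>\<^sup>2 * mean t (\<lambda>c x. of_bool (count b c x = 0)) = mean t (\<lambda>c x. \<mu>\<^sup>2 * of_bool (count b c x = 0))"
    by (simp add: mean_cmult)
  also have "\<dots> \<le> mean t (\<lambda>c x. (count b c x)\<^sup>2 + ((- 2 * \<mu>) * count b c x + \<mu>\<^sup>2))"
  proof (rule mean_mono)
    fix c x
    have "(count b c x)\<^sup>2 + ((- 2 * \<mu>) * count b c x + \<mu>\<^sup>2) = (count b c x - \<mu>)\<^sup>2"
      by (simp add: power2_eq_square algebra_simps)
    then show "\<mu>\<^sup>2 * of_bool (count b c x = 0) \<le> (count b c x)\<^sup>2 + ((- 2 * \<mu>) * count b c x + \<mu>\<^sup>2)"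
      by (auto simp: of_bool_def)
  qed
  also have "\<dots> = mean t (\<lambda>c x. (count b c x)\<^sup>2) - \<mu>\<^sup>2"
    using assms mean_count [OF assms(1)]
    by (simp only: mean_add mean_cmult) (simp add: mean_const \<mu>_def power2_eq_square)
  also have "\<dots> \<le> \<mu>\<^sup>2 * (1 + 2 * real t / \<kappa>) ^ j - \<mu>\<^sup>2"
    using mean_count_square [OF assms(1,2) spread] by (simp add: \<mu>_def)
  also have "\<dots> \<le> \<mu>\<^sup>2 * (3 / 2) - \<mu>\<^sup>2"
    using assms by (intro diff_right_mono mult_left_mono one_plus_power_le) (auto simp: field_simps)
  finally have "\<mu>\<^sup>2 * mean t (\<lambda>c x. of_bool (count b c x = 0)) \<le> \<mu>\<^sup>2 * (1 / 2)" by simp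
  then show ?thesis using \<mu> by simp
qed

text \<open>
  The variables are coloured with \<open>t\<close> colours. By Chebyshev's inequality a random colour class fails
  to contain a satisfied term with probability at most one half; for a fixed colouring the classes
  are independent.
\<close>

lemma spread_unsatisfied:
  assumes "1 \<le> t" "0 < \<kappa>" "8 * real t * real j \<le> \<kappa>"
    and spread: "\<And>Z. finite Z \<Longrightarrow> real (card {C \<in> G. Z \<subseteq> C}) * \<kappa> ^ card Z \<le> real (card G)"
  shows "avg V (\<lambda>x. of_bool (\<forall>C\<in>G. \<not> satisfies x C)) \<le> exp (- real t / 2)"
proof -
  define q where "q b c = avg V (\<lambda>x. of_bool (count b c x = 0))" for b c
  define Col where "Col = V \<rightarrow>\<^sub>E {..<t}"
  have fin: "finite Col" and cardCol: "real (card Col) = real t ^ card V"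
    using finite_colorings finV by (auto simp: Col_def card_PiE)
  have "(\<Sum>b<t. mean t (\<lambda>c x. of_bool (count b c x = 0))) \<le> (\<Sum>b<t. 1 / 2)"
    using mean_count_zero [OF _ assms(2,3) spread] by (intro sum_mono) auto
  also have "(\<Sum>b<t. mean t (\<lambda>c x. of_bool (count b c x = 0))) = (\<Sum>c\<in>Col. \<Sum>b<t. q b c) / real t ^ card V"
    unfolding mean_def q_def Col_def sum_divide_distrib [symmetric] by (subst sum.swap) simp
  finally have le: "(\<Sum>c\<in>Col. \<Sum>b<t. q b c) \<le> card Col * (real t / 2)"
    using assms by (simp add: cardCol field_simps)
  \<comment> \<open>Averaging over colourings fixes one for which the failure probabilities of the
    \<open>t\<close> classes sum to at most t / 2; from here on only the point is random.\<close>
  have "\<exists>c\<in>Col. (\<Sum>b<t. q b c) \<le> real t / 2"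
  proof (rule ccontr)
    assume "\<not> ?thesis"
    then have "(\<Sum>c\<in>Col. real t / 2) < (\<Sum>c\<in>Col. \<Sum>b<t. q b c)"
    proof (intro sum_strict_mono fin)
      have "card Col \<noteq> 0" using assms(1) finV by (simp add: Col_def card_PiE)
      then show "Col \<noteq> {}" by auto
    qed auto
    with le show False by simp
  qed
  then obtain c where c: "(\<Sum>b<t. q b c) \<le> real t / 2" by blast
  define W where "W b = {v \<in> V. c v = b}" for b
  have count0: "count b c x = 0 \<longleftrightarrow> (\<forall>C\<in>G. \<not> ((\<forall>v\<in>fst ` C. c v = b) \<and> satisfies x C))" for b x
    unfolding count_def using finG by (subst sum_nonneg_eq_0_iff) (auto simp: hit_def)
  have "avg V (\<lambda>x. of_bool (\<forall>C\<in>G. \<not> satisfies x C)) \<le> avg V (\<lambda>x. \<Prod>b<t. of_bool (count b c x = 0))"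
  proof (rule avg_mono)
    fix x assume "x \<subseteq> V"
    show "(of_bool (\<forall>C\<in>G. \<not> satisfies x C) :: real) \<le> (\<Prod>b<t. of_bool (count b c x = 0))"
    proof (cases "\<forall>C\<in>G. \<not> satisfies x C")
      case True
      then have "count b c x = 0" for b by (simp add: count0)
      then show ?thesis by simp
    next
      case False
      then show ?thesis by (simp only: of_bool_eq(1)) (simp add: prod_nonneg)
    qed
  qed
  also have "\<dots> = (\<Prod>b<t. q b c)"
    unfolding q_def
  proof (rule avg_prod_indep [OF finV, where W=W])
    fix b x assume "b \<in> {..<t}" "x \<subseteq> V"
    have "satisfies (x \<inter> W b) C \<longleftrightarrow> satisfies x C" if "C \<in> G" "\<forall>v\<in>fst ` C. c v = b" for C
      using that vars_C by (intro satisfies_Int) (auto simp: W_def)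
    then show "(of_bool (count b c x = 0) :: real) = of_bool (count b c (x \<inter> W b) = 0)"
      unfolding count0 by (intro arg_cong [where f=of_bool]) blast
  qed (auto simp: W_def)
  \<comment> \<open>Individual classes may fail with probability near 1; passing to exponentials
    uses just the sum of the probabilities.\<close>
  also have "\<dots> \<le> (\<Prod>b<t. exp (q b c - 1))"
  proof (rule prod_mono)
    fix b
    have "0 \<le> q b c" unfolding q_def by (rule avg_nonneg) simp
    then show "0 \<le> q b c \<and> q b c \<le> exp (q b c - 1)"
      using exp_ge_add_one_self [of "q b c - 1"] by simp
  qed
  also have "\<dots> = exp ((\<Sum>b<t. q b c) - real t)"
    by (simp add: exp_sum [symmetric] sum_subtractf)
  also have "\<dots> \<le> exp (- real t / 2)"
    using c by simp
  finally show ?thesis .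
qed

end

section \<open>Sparsification\<close>

definition any_sat :: "('a \<times> bool) set set \<Rightarrow> 'a set \<Rightarrow> real" where
  "any_sat F A = of_bool (\<exists>C\<in>F. satisfies A C)"

definition terms_on :: "'a set \<Rightarrow> nat \<Rightarrow> ('a \<times> bool) set set \<Rightarrow> bool" where
  "terms_on V w F \<longleftrightarrow> finite F \<and> (\<forall>C\<in>F. finite C \<and> card C \<le> w \<and> inj_on fst C \<and> fst ` C \<subseteq> V)"

text \<open>Among all \<open>K\<close> contained in more than \<open>\<kappa> ^ (j - card K)\<close>
  members, one of greatest size is chosen. Any proper extension then violates that inequality, which
  is the spreadness of the family around \<open>K\<close>.\<close>

lemma exists_spread_core:
  assumes "finite F" "\<And>C. C \<in> F \<Longrightarrow> finite C \<and> card C = j" "\<kappa> ^ j < card F"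
  shows "\<exists>K. \<kappa> ^ (j - card K) < card {C \<in> F. K \<subseteq> C} \<and>
    (\<forall>Z. finite Z \<longrightarrow> Z \<noteq> {} \<longrightarrow> Z \<inter> K = {} \<longrightarrow>
      card {C \<in> F. K \<union> Z \<subseteq> C} \<le> \<kappa> ^ (j - card (K \<union> Z)))"
proof -
  define P where "P K \<longleftrightarrow> \<kappa> ^ (j - card K) < card {C \<in> F. K \<subseteq> C}" for K
  have sub: "\<exists>C\<in>F. K \<subseteq> C" if "P K" for K
  proof (rule ccontr)
    assume "\<not> ?thesis"
    then have "{C \<in> F. K \<subseteq> C} = {}" by auto
    then have "card {C \<in> F. K \<subseteq> C} = 0" by (simp only: card.empty)
    with that show False by (simp add: P_def)
  qed
  have "P {}" using assms(3) by (simp add: P_def)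
  moreover have "\<forall>K. P K \<longrightarrow> card K < Suc j"
  proof (intro allI impI)
    fix K assume "P K"
    from sub [OF this] obtain C where "C \<in> F" "K \<subseteq> C" by blast
    then show "card K < Suc j" using card_mono [of C K] assms(2) by (simp add: less_Suc_eq_le)
  qed
  ultimately have "\<exists>K. P K \<and> (\<forall>L. P L \<longrightarrow> card L \<le> card K)"
    by (rule ex_has_greatest_nat)
  then obtain K where K: "P K" "\<And>L. P L \<Longrightarrow> card L \<le> card K" by blast
  have "finite K" using sub [OF K(1)] assms(2) finite_subset by blast
  have "\<not> P (K \<union> Z)" if "finite Z" "Z \<noteq> {}" "Z \<inter> K = {}" for Z
  proof
    assume "P (K \<union> Z)"
    then have "card (K \<union> Z) \<le> card K" by (rule K)
    moreover have "card (K \<union> Z) = card K + card Z"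
      using that \<open>finite K\<close> by (intro card_Un_disjoint) auto
    ultimately show False using that by auto
  qed
  with K(1) show ?thesis
    unfolding P_def not_less by blast
qed

text \<open>The spread bound is applied to the members through the core \<open>K\<close> with one of
  them, \<open>C0\<close>, deleted. The same event thus bounds the error of dropping
  \<open>C0\<close> and that of replacing all of \<open>H\<close> by \<open>K\<close>.\<close>

lemma exists_quasi_sunflower:
  assumes "terms_on V w F" "finite V" "\<And>C. C \<in> F \<Longrightarrow> card C = j" "\<kappa> ^ j < card F"
    and "1 \<le> t" "8 * t * j \<le> \<kappa>" "1 \<le> \<kappa>"
  shows "\<exists>K H C0. H \<subseteq> F \<and> C0 \<in> H \<and> 2 \<le> card H \<and> (\<forall>C\<in>H. K \<subseteq> C) \<and>
    avg V (\<lambda>A. of_bool (satisfies A K \<and> (\<forall>C\<in>H - {C0}. \<not> satisfies A C))) \<le> exp (- real t / 2)"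
proof -
  have F: "finite F" "\<And>C. C \<in> F \<Longrightarrow> finite C \<and> inj_on fst C \<and> fst ` C \<subseteq> V"
    using assms(1) by (auto simp: terms_on_def)
  obtain K where K: "\<kappa> ^ (j - card K) < card {C \<in> F. K \<subseteq> C}"
    and max: "\<And>Z. finite Z \<Longrightarrow> Z \<noteq> {} \<Longrightarrow> Z \<inter> K = {} \<Longrightarrow>
      card {C \<in> F. K \<union> Z \<subseteq> C} \<le> \<kappa> ^ (j - card (K \<union> Z))"
  proof -
    have "finite C \<and> card C = j" if "C \<in> F" for C using F(2) assms(3) that by simp
    from exists_spread_core [OF F(1) this assms(4)] that show ?thesis by blast
  qed
  define H where "H = {C \<in> F. K \<subseteq> C}"
  have finH: "finite H" using F by (simp add: H_def)
  have "1 \<le> \<kappa> ^ (j - card K)" using assms(7) by simp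
  with K have H2: "2 \<le> card H" unfolding H_def [symmetric] by linarith
  then have "H \<noteq> {}" by auto
  then obtain C0 where C0: "C0 \<in> H" by blast
  have finK: "finite K" using C0 F(2) finite_subset unfolding H_def by blast
  define G where "G = (\<lambda>C. C - K) ` (H - {C0})"
  have inj: "inj_on (\<lambda>C. C - K) (H - {C0})"
    by (rule inj_on_inverseI [where g="\<lambda>C. C \<union> K"]) (auto simp: H_def)
  have cardG: "card G = card H - 1"
    using C0 finH by (simp add: G_def card_image [OF inj])
  \<comment> \<open>The strict inequality for the core pays for the deletion of \<open>C0\<close>,
    so the rest of the family is still large enough to be spread.\<close>
  have Gge: "\<kappa> ^ (j - card K) \<le> card G"
    using K cardG by (simp add: H_def)
  interpret term_family V G "j - card K"
  proof
    show "finite V" by fact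
    show "finite G" using finH by (simp add: G_def)
    show "G \<noteq> {}" using cardG H2 by auto
    fix C assume "C \<in> G"
    then obtain D where D: "D \<in> F" "K \<subseteq> D" "C = D - K" by (auto simp: G_def H_def)
    show "finite C" using D F by auto
    show "card C = j - card K" using D F assms(3) finK by (simp add: card_Diff_subset)
    show "inj_on fst C" using D F by (auto intro: inj_on_subset)
    show "fst ` C \<subseteq> V" using D F by auto
  qed
  have "avg V (\<lambda>x. of_bool (\<forall>C\<in>G. \<not> satisfies x C)) \<le> exp (- real t / 2)"
  proof (rule spread_unsatisfied [where \<kappa>="real \<kappa>"])
    have "8 * t * (j - card K) \<le> 8 * t * j" by simp
    with assms(6) have "8 * t * (j - card K) \<le> \<kappa>" by linarith
    then have "real (8 * t * (j - card K)) \<le> real \<kappa>" by (rule of_nat_mono)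
    then show "8 * real t * real (j - card K) \<le> real \<kappa>" by simp
    fix Z :: "('a \<times> bool) set" assume Z: "finite Z"
    have "card {C \<in> G. Z \<subseteq> C} * \<kappa> ^ card Z \<le> card G"
    proof (cases "Z = {}")
      case False
      show ?thesis
      proof (cases "\<exists>C\<in>G. Z \<subseteq> C")
        case False
        then have "{C \<in> G. Z \<subseteq> C} = {}" by auto
        then show ?thesis by (simp only: card.empty)
      next
        case True
        then obtain C where C: "C \<in> G" "Z \<subseteq> C" by blast
        then have disj: "Z \<inter> K = {}" by (auto simp: G_def)
        have Zle: "card Z \<le> j - card K" using card_mono [OF finC C(2)] card_C C by metis
        have "{C \<in> G. Z \<subseteq> C} \<subseteq> (\<lambda>C. C - K) ` {C \<in> F. K \<union> Z \<subseteq> C}"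
          by (auto simp: G_def H_def)
        then have "card {C \<in> G. Z \<subseteq> C} \<le> card {C \<in> F. K \<union> Z \<subseteq> C}"
          using F(1) by (intro surj_card_le) auto
        also have "\<dots> \<le> \<kappa> ^ (j - card (K \<union> Z))"
          by (rule max) (use Z \<open>Z \<noteq> {}\<close> disj in auto)
        also have "card (K \<union> Z) = card K + card Z"
          using Z finK disj by (intro card_Un_disjoint) auto
        finally have "card {C \<in> G. Z \<subseteq> C} * \<kappa> ^ card Z \<le> \<kappa> ^ (j - (card K + card Z)) * \<kappa> ^ card Z"
          by simp
        also have "\<dots> = \<kappa> ^ (j - card K)"
        proof -
          have "j - (card K + card Z) + card Z = j - card K" using Zle by simp
          then show ?thesis by (simp only: power_add [symmetric])
        qed
        finally show ?thesis using Gge by linarith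
      qed
    qed simp
    then have "real (card {C \<in> G. Z \<subseteq> C} * \<kappa> ^ card Z) \<le> real (card G)" by (rule of_nat_mono)
    then show "real (card {C \<in> G. Z \<subseteq> C}) * real \<kappa> ^ card Z \<le> real (card G)" by simp
  qed (use assms in auto)
  moreover have "avg V (\<lambda>A. of_bool (satisfies A K \<and> (\<forall>C\<in>H - {C0}. \<not> satisfies A C)))
      \<le> avg V (\<lambda>x. of_bool (\<forall>C\<in>G. \<not> satisfies x C))"
  proof (rule avg_mono)
    fix A
    have "\<not> satisfies A (C - K)" if "satisfies A K" "\<not> satisfies A C" "C \<in> H" for C
      using that satisfies_Un [of A "C - K" K] by (auto simp: H_def Un_absorb2)
    then show "(of_bool (satisfies A K \<and> (\<forall>C\<in>H - {C0}. \<not> satisfies A C)) :: real)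
        \<le> of_bool (\<forall>C\<in>G. \<not> satisfies A C)"
      by (auto simp: G_def)
  qed
  ultimately show ?thesis
    using C0 H2 by (intro exI [of _ K] exI [of _ H] exI [of _ C0]) (auto simp: H_def)
qed

text \<open>By pigeonhole over the term sizes, some size \<open>j\<close> has more than
  \<open>\<kappa> ^ j\<close> terms. Both \<open>L = F - {C0}\<close> and
  \<open>U = insert K (F - H)\<close> are wrong only where \<open>K\<close> holds but no other
  member of \<open>H\<close> does; \<open>2 \<le> card H\<close> makes \<open>U\<close> smaller than
  \<open>F\<close>.\<close>

lemma any_sat_step:
  assumes "terms_on V w F" "finite V" "(w + 1) * \<kappa> ^ w < card F"
    and "1 \<le> t" "8 * t * w \<le> \<kappa>" "1 \<le> \<kappa>"
  shows "\<exists>L U. terms_on V w L \<and> terms_on V w U \<and> card L < card F \<and> card U < card F \<and>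
    (\<forall>A. any_sat L A \<le> any_sat F A \<and> any_sat F A \<le> any_sat U A) \<and>
    avg V (\<lambda>A. any_sat F A - any_sat L A) \<le> exp (- real t / 2) \<and>
    avg V (\<lambda>A. any_sat U A - any_sat F A) \<le> exp (- real t / 2)"
proof -
  have finF: "finite F" using assms(1) by (simp add: terms_on_def)
  have "\<exists>j\<le>w. \<kappa> ^ j < card {C \<in> F. card C = j}"
  proof (rule ccontr)
    assume none: "\<not> (\<exists>j\<le>w. \<kappa> ^ j < card {C \<in> F. card C = j})"
    have *: "card {C \<in> F. card C = j} \<le> \<kappa> ^ w" if "j \<le> w" for j
    proof -
      have "card {C \<in> F. card C = j} \<le> \<kappa> ^ j" using none that by (simp add: not_less)
      also have "\<dots> \<le> \<kappa> ^ w" using that assms(6) by (intro power_increasing)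
      finally show ?thesis .
    qed
    have "card F = (\<Sum>j\<le>w. card {C \<in> F. card C = j})"
    proof -
      have "(\<Sum>j\<le>w. \<Sum>C\<in>{C \<in> F. card C = j}. 1) = (\<Sum>C\<in>F. 1 :: nat)"
        using assms(1) finF by (intro sum.group) (auto simp: terms_on_def)
      then show ?thesis by simp
    qed
    also have "\<dots> \<le> (\<Sum>j\<le>w. \<kappa> ^ w)" using * by (intro sum_mono) auto
    finally show False using assms(3) by simp
  qed
  then obtain j where j: "j \<le> w" "\<kappa> ^ j < card {C \<in> F. card C = j}" by blast
  have "terms_on V w {C \<in> F. card C = j}" using assms(1) by (auto simp: terms_on_def)
  moreover have "8 * t * j \<le> \<kappa>" using j(1) assms(5) mult_le_mono2 [of j w "8 * t"] by linarith
  ultimately have "\<exists>K H C0. H \<subseteq> {C \<in> F. card C = j} \<and> C0 \<in> H \<and> 2 \<le> card H \<and> (\<forall>C\<in>H. K \<subseteq> C) \<and>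
      avg V (\<lambda>A. of_bool (satisfies A K \<and> (\<forall>C\<in>H - {C0}. \<not> satisfies A C))) \<le> exp (- real t / 2)"
    using assms(2,4,6) j(2) by (intro exists_quasi_sunflower [where \<kappa>=\<kappa> and w=w]) auto
  then obtain K H C0 where H: "H \<subseteq> {C \<in> F. card C = j}" "C0 \<in> H" "2 \<le> card H" "\<forall>C\<in>H. K \<subseteq> C"
    and err: "avg V (\<lambda>A. of_bool (satisfies A K \<and> (\<forall>C\<in>H - {C0}. \<not> satisfies A C))) \<le> exp (- real t / 2)"
    by (elim exE conjE)
  have HF: "H \<subseteq> F" using H(1) by blast
  then have finH: "finite H" using finF finite_subset by blast
  define L where "L = F - {C0}"
  define U where "U = insert K (F - H)"
  have "terms_on V w L" using assms(1) by (auto simp: terms_on_def L_def)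
  moreover have "terms_on V w U"
  proof -
    have C0: "finite C0 \<and> card C0 \<le> w \<and> inj_on fst C0 \<and> fst ` C0 \<subseteq> V" "K \<subseteq> C0"
      using assms(1) H HF unfolding terms_on_def by blast+
    then have "finite K \<and> card K \<le> w \<and> inj_on fst K \<and> fst ` K \<subseteq> V"
      using card_mono [of C0 K] by (auto intro: finite_subset inj_on_subset)
    then show ?thesis using assms(1) by (auto simp: terms_on_def U_def)
  qed
  moreover have "card L < card F"
    unfolding L_def using H(2) HF finF by (intro psubset_card_mono) blast+
  moreover have "card U < card F"
  proof -
    have "card U \<le> Suc (card (F - H))" unfolding U_def by (rule card_insert_le_m1) simp_all
    moreover have "card (F - H) = card F - card H" "card H \<le> card F"
      using HF finF finH by (simp_all add: card_Diff_subset card_mono)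
    ultimately show ?thesis using H(3) by linarith
  qed
  moreover have "any_sat L A \<le> any_sat F A" "any_sat F A \<le> any_sat U A" for A
  proof -
    show "any_sat L A \<le> any_sat F A" by (auto simp: any_sat_def L_def)
    have "satisfies A K" if "satisfies A C" "C \<in> H" for C
      using that H(4) satisfies_subset by blast
    then show "any_sat F A \<le> any_sat U A" by (auto simp: any_sat_def U_def)
  qed
  moreover have "avg V (\<lambda>A. any_sat F A - any_sat L A) \<le> exp (- real t / 2)"
  proof (rule order_trans [OF avg_mono err])
    fix A
    have "satisfies A K" if "satisfies A C0"
      using that H satisfies_subset by blast
    then show "any_sat F A - any_sat L A \<le> of_bool (satisfies A K \<and> (\<forall>C\<in>H - {C0}. \<not> satisfies A C))"
      using HF by (auto simp: any_sat_def L_def of_bool_def)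
  qed
  moreover have "avg V (\<lambda>A. any_sat U A - any_sat F A) \<le> exp (- real t / 2)"
  proof (rule order_trans [OF avg_mono err])
    fix A
    show "any_sat U A - any_sat F A \<le> of_bool (satisfies A K \<and> (\<forall>C\<in>H - {C0}. \<not> satisfies A C))"
      using HF by (auto simp: any_sat_def U_def of_bool_def)
  qed
  ultimately show ?thesis by blast
qed

text \<open>The error allowed at size \<open>s\<close> is \<open>\<delta> / (s (s + 1))\<close>, so that the total telescopes to
  \<open>\<delta> (1 - 1 / (s + 1))\<close>.\<close>

lemma any_sat_sparsify:
  assumes "finite V" "0 \<le> \<delta>"
    and step: "\<And>s. s0 < s \<Longrightarrow> \<exists>\<kappa> t. (w + 1) * \<kappa> ^ w < s \<and> 1 \<le> t \<and> 8 * t * w \<le> \<kappa> \<and> 1 \<le> \<kappa> \<and>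
      exp (- real t / 2) \<le> \<delta> / (real s * (real s + 1))"
    and "terms_on V w F"
  shows "\<exists>L U. terms_on V w L \<and> terms_on V w U \<and> card L \<le> s0 \<and> card U \<le> s0 \<and>
    (\<forall>A. any_sat L A \<le> any_sat F A \<and> any_sat F A \<le> any_sat U A) \<and>
    avg V (\<lambda>A. any_sat F A - any_sat L A) \<le> \<delta> * (1 - 1 / (real (card F) + 1)) \<and>
    avg V (\<lambda>A. any_sat U A - any_sat F A) \<le> \<delta> * (1 - 1 / (real (card F) + 1))"
  using assms(4)
proof (induction "card F" arbitrary: F rule: less_induct)
  case less
  let ?e = "\<lambda>s. \<delta> * (1 - 1 / (real s + 1))"
  show ?case
  proof (cases "s0 < card F")
    case False
    have "avg V (\<lambda>A. any_sat F A - any_sat F A) = 0" using assms(1) by (simp add: avg_const)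
    moreover have "0 \<le> ?e (card F)" using assms(2) by simp
    ultimately show ?thesis using False less.prems by (intro exI [of _ F]) auto
  next
    case True
    from step [OF True] obtain \<kappa> t where *: "(w + 1) * \<kappa> ^ w < card F" "1 \<le> t" "8 * t * w \<le> \<kappa>" "1 \<le> \<kappa>"
      and small: "exp (- real t / 2) \<le> \<delta> / (real (card F) * (real (card F) + 1))" by blast
    obtain L U where LU: "terms_on V w L" "terms_on V w U" "card L < card F" "card U < card F"
      "\<And>A. any_sat L A \<le> any_sat F A" "\<And>A. any_sat F A \<le> any_sat U A"
      "avg V (\<lambda>A. any_sat F A - any_sat L A) \<le> exp (- real t / 2)"
      "avg V (\<lambda>A. any_sat U A - any_sat F A) \<le> exp (- real t / 2)"
      using any_sat_step [OF less.prems assms(1) *] by blast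
    have total: "?e s + exp (- real t / 2) \<le> ?e (card F)" if "s < card F" for s
    proof -
      have "1 / (real (card F)) \<le> 1 / (real s + 1)"
        using that by (intro divide_left_mono) auto
      then have "\<delta> * (1 - 1 / (real s + 1)) \<le> \<delta> * (1 - 1 / real (card F))"
        using assms(2) by (intro mult_left_mono) auto
      moreover have "\<delta> * (1 - 1 / real (card F)) + \<delta> / (real (card F) * (real (card F) + 1))
          = \<delta> * (1 - 1 / (real (card F) + 1))"
      proof -
        have "0 < real (card F)" using that by simp
        then have "1 - 1 / real (card F) + 1 / (real (card F) * (real (card F) + 1)) = 1 - 1 / (real (card F) + 1)"
          by (simp add: divide_simps) (simp add: algebra_simps)
        then show ?thesis by (simp add: distrib_left [symmetric] divide_inverse)
      qed
      ultimately show ?thesis using small by linarith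
    qed
    from less.hyps [OF LU(3,1)] obtain L' where L': "terms_on V w L'" "card L' \<le> s0"
      "\<And>A. any_sat L' A \<le> any_sat L A" "avg V (\<lambda>A. any_sat L A - any_sat L' A) \<le> ?e (card L)" by blast
    from less.hyps [OF LU(4,2)] obtain U' where U': "terms_on V w U'" "card U' \<le> s0"
      "\<And>A. any_sat U A \<le> any_sat U' A" "avg V (\<lambda>A. any_sat U' A - any_sat U A) \<le> ?e (card U)" by blast
    have "avg V (\<lambda>A. any_sat F A - any_sat L' A) \<le> ?e (card F)"
      using LU(7) L'(4) total [OF LU(3)] unfolding avg_diff by linarith
    moreover have "avg V (\<lambda>A. any_sat U' A - any_sat F A) \<le> ?e (card F)"
      using LU(8) U'(4) total [OF LU(4)] unfolding avg_diff by linarith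
    moreover have "any_sat L' A \<le> any_sat F A \<and> any_sat F A \<le> any_sat U' A" for A
      using LU(5,6) L'(3) U'(3) order_trans by blast
    ultimately show ?thesis using L'(1,2) U'(1,2) by blast
  qed
qed

section \<open>A small-bias generator\<close>

text \<open>Vectors over the field with two elements are functions \<open>nat \<Rightarrow> nat\<close> with values 0 and 1, of which
  the entries below \<open>N\<close> matter; \<open>cyc_mult N\<close> is the multiplication of \<open>GF(2)[t] / (t\<^sup>N - 1)\<close>.\<close>

definition cyc_mult :: "nat \<Rightarrow> (nat \<Rightarrow> nat) \<Rightarrow> (nat \<Rightarrow> nat) \<Rightarrow> nat \<Rightarrow> nat" where
  "cyc_mult N a b k = (\<Sum>i<N. \<Sum>j<N. if (i + j) mod N = k then a i * b j else 0) mod 2"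

text \<open>Horner's rule for the polynomial of the binary digits of \<open>i\<close>, evaluated at
  \<open>x\<close>: one multiplication leads from the node of \<open>i div 2\<close> to that of
  \<open>i\<close>.\<close>

fun node_vec :: "nat \<Rightarrow> (nat \<Rightarrow> nat) \<Rightarrow> nat \<Rightarrow> nat \<Rightarrow> nat" where
  "node_vec N x i k = (if i = 0 then 0 else
    (cyc_mult N (node_vec N x (i div 2)) x k + (if k = 0 then i mod 2 else 0)) mod 2)"

declare node_vec.simps [simp del]

text \<open>Horner's rule for 1 + g + ... + g^(m - 1), which spares separate powers of
  \<open>g\<close>.\<close>

fun geom :: "nat \<Rightarrow> (nat \<Rightarrow> nat) \<Rightarrow> nat \<Rightarrow> nat \<Rightarrow> nat" where
  "geom N g 0 k = 0"
| "geom N g (Suc m) k = (cyc_mult N (geom N g m) g k + (if k = 0 then 1 else 0)) mod 2"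

text \<open>Row \<open>i\<close> of a random generator matrix; \<open>seed_bit\<close> multiplies it
  by the vector \<open>u\<close>. A parity of outputs is biased only through those \<open>x\<close>,
  \<open>z\<close> for which the corresponding rows sum to zero modulo 2.\<close>

definition node_row :: "nat \<Rightarrow> (nat \<Rightarrow> nat) \<Rightarrow> (nat \<Rightarrow> nat) \<Rightarrow> nat \<Rightarrow> nat \<Rightarrow> nat" where
  "node_row N x z i = geom N (cyc_mult N (node_vec N x i) z) N"

definition seed_bit :: "nat \<Rightarrow> (nat \<Rightarrow> nat) \<Rightarrow> (nat \<Rightarrow> nat) \<Rightarrow> (nat \<Rightarrow> nat) \<Rightarrow> nat \<Rightarrow> nat" where
  "seed_bit N x z u i = (\<Sum>k<N. u k * node_row N x z i k) mod 2"

definition bits_of :: "nat set \<Rightarrow> nat \<Rightarrow> nat" where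
  "bits_of Xs k = of_bool (k \<in> Xs)"

definition out_set :: "nat \<Rightarrow> nat \<Rightarrow> nat set \<Rightarrow> nat set \<Rightarrow> nat set \<Rightarrow> nat set" where
  "out_set n N Xs Zs Us = {i. i < n \<and> seed_bit N (bits_of Xs) (bits_of Zs) (bits_of Us) i = 1}"

definition seed_sum :: "nat \<Rightarrow> nat \<Rightarrow> nat set \<Rightarrow> real" where
  "seed_sum n N S = (\<Sum>Xs\<in>Pow {..<N}. \<Sum>Zs\<in>Pow {..<N}. \<Sum>Us\<in>Pow {..<N}. chi S (out_set n N Xs Zs Us))"

section \<open>Evaluation of the ring at a root of unity\<close>

lemma power_mod_root:
  fixes \<zeta> :: "'f :: field"
  assumes "\<zeta> ^ N = 1"
  shows "\<zeta> ^ (i mod N) = \<zeta> ^ i"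
proof -
  have "\<zeta> ^ i = \<zeta> ^ (N * (i div N) + i mod N)" by simp
  also have "\<dots> = (\<zeta> ^ N) ^ (i div N) * \<zeta> ^ (i mod N)" unfolding power_add power_mult ..
  finally show ?thesis using assms by simp
qed

lemma of_nat_mod_2:
  assumes "(2 :: 'f :: comm_ring_1) = 0"
  shows "of_nat (a mod 2) = (of_nat a :: 'f)"
proof -
  have "(of_nat a :: 'f) = of_nat (2 * (a div 2) + a mod 2)" by simp
  also have "\<dots> = of_nat (a mod 2)" using assms by (simp only: of_nat_add of_nat_mult) simp
  finally show ?thesis by simp
qed

text \<open>To be instantiated with the algebraic closure of GF(2), which is infinite; all counting
  takes place in the finite image \<open>K\<close> of the ring.\<close>

locale cyclic_eval =
  fixes \<zeta> :: "'f :: field" and N :: nat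
  assumes char2: "(2 :: 'f) = 0" and root: "\<zeta> ^ N = 1" and N_pos: "1 \<le> N"
begin

definition ev :: "(nat \<Rightarrow> nat) \<Rightarrow> 'f" where
  "ev a = (\<Sum>k<N. of_nat (a k) * \<zeta> ^ k)"

lemma uminus_eq: "- a = (a :: 'f)"
proof -
  have "a + a = 2 * a" by (simp only: mult_2)
  then show ?thesis using char2 by (simp add: add_eq_0_iff)
qed

text \<open>Reducing exponents modulo \<open>N\<close> is harmless as
  \<open>\<zeta> ^ N = 1\<close>, and reducing coefficients modulo 2 is harmless as 2 = 0 in the
  field.\<close>

lemma ev_cyc_mult: "ev (cyc_mult N a b) = ev a * ev b"
proof -
  have "ev (cyc_mult N a b)
      = (\<Sum>k<N. \<Sum>i<N. \<Sum>j<N. if (i + j) mod N = k then of_nat (a i) * of_nat (b j) * \<zeta> ^ k else 0)"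
    unfolding ev_def cyc_mult_def of_nat_mod_2 [OF char2] of_nat_sum sum_distrib_right
    by (intro sum.cong refl) simp
  also have "\<dots> = (\<Sum>i<N. \<Sum>k<N. \<Sum>j<N. if (i + j) mod N = k then of_nat (a i) * of_nat (b j) * \<zeta> ^ k else 0)"
    by (rule sum.swap)
  also have "\<dots> = (\<Sum>i<N. \<Sum>j<N. \<Sum>k<N. if (i + j) mod N = k then of_nat (a i) * of_nat (b j) * \<zeta> ^ k else 0)"
    by (intro sum.cong refl sum.swap)
  also have "\<dots> = (\<Sum>i<N. \<Sum>j<N. of_nat (a i) * of_nat (b j) * \<zeta> ^ (i + j))"
  proof (intro sum.cong refl)
    fix i j
    have "(i + j) mod N < N" using N_pos by simp
    then show "(\<Sum>k<N. if (i + j) mod N = k then of_nat (a i) * of_nat (b j) * \<zeta> ^ k else 0)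
        = of_nat (a i) * of_nat (b j) * \<zeta> ^ (i + j)"
      by (subst sum.delta') (simp_all add: power_mod_root [OF root])
  qed
  also have "\<dots> = ev a * ev b"
    unfolding ev_def sum_product by (intro sum.cong refl) (simp add: power_add)
  finally show ?thesis .
qed

lemma ev_add_at_0: "ev (\<lambda>k. (a k + (if k = 0 then c else 0)) mod 2) = ev a + of_nat c"
proof -
  have "ev (\<lambda>k. (a k + (if k = 0 then c else 0)) mod 2)
      = (\<Sum>k<N. of_nat (a k) * \<zeta> ^ k + (if k = 0 then of_nat c else 0))"
    unfolding ev_def of_nat_mod_2 [OF char2] by (intro sum.cong refl) (simp add: distrib_right)
  also have "\<dots> = ev a + of_nat c"
    using N_pos by (simp add: sum.distrib ev_def)
  finally show ?thesis .
qed

fun node_poly :: "nat \<Rightarrow> 'f poly" where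
  "node_poly i = (if i = 0 then 0 else pCons (of_nat (i mod 2)) (node_poly (i div 2)))"

declare node_poly.simps [simp del]

lemma ev_node_vec: "ev (node_vec N x i) = poly (node_poly i) (ev x)"
proof (induction i rule: less_induct)
  case (less i)
  show ?case
  proof (cases "i = 0")
    case True
    then show ?thesis by (simp add: ev_def node_vec.simps [of N x 0] node_poly.simps [of 0])
  next
    case False
    have "ev (node_vec N x i) = ev (\<lambda>k. (cyc_mult N (node_vec N x (i div 2)) x k + (if k = 0 then i mod 2 else 0)) mod 2)"
    proof (rule arg_cong [where f=ev], rule ext)
      show "node_vec N x i k = (cyc_mult N (node_vec N x (i div 2)) x k + (if k = 0 then i mod 2 else 0)) mod 2" for k
        using False by (subst node_vec.simps) simp
    qed
    also have "\<dots> = ev (node_vec N x (i div 2)) * ev x + of_nat (i mod 2)"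
      by (simp only: ev_add_at_0 ev_cyc_mult)
    also have "\<dots> = poly (node_poly i) (ev x)"
      using False less [of "i div 2"] by (simp add: node_poly.simps [of i])
    finally show ?thesis .
  qed
qed

text \<open>The binary digits can be read off the coefficients, as 0 and 1 differ in the field. Two
  indices therefore share their node only at the roots of a non-zero polynomial.\<close>

lemma node_poly_inject: "node_poly i = node_poly j \<Longrightarrow> i = j"
proof (induction i arbitrary: j rule: less_induct)
  case (less i)
  have nz: "node_poly i = 0 \<Longrightarrow> i = 0" for i
  proof (induction i rule: less_induct)
    case (less i)
    show ?case
    proof (rule ccontr)
      assume "i \<noteq> 0"
      with less.prems have "of_nat (i mod 2) = (0 :: 'f)" "node_poly (i div 2) = 0"
        by (simp_all add: node_poly.simps [of i])
      moreover from this have "i div 2 = 0" using less.IH [of "i div 2"] \<open>i \<noteq> 0\<close> by simp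
      then have "i = 1" using \<open>i \<noteq> 0\<close> by presburger
      ultimately show False by simp
    qed
  qed
  show ?case
  proof (cases "i = 0 \<or> j = 0")
    case True
    have "node_poly 0 = 0" by (simp add: node_poly.simps [of 0])
    with True less.prems nz [of i] nz [of j] show ?thesis by auto
  next
    case False
    with less.prems have eq: "of_nat (i mod 2) = (of_nat (j mod 2) :: 'f)" "node_poly (i div 2) = node_poly (j div 2)"
      by (simp_all add: node_poly.simps [of i] node_poly.simps [of j])
    have "i div 2 = j div 2" using less.IH [OF _ eq(2)] False by simp
    moreover have "i mod 2 = j mod 2"
    proof -
      have "i mod 2 = 0 \<or> i mod 2 = 1" "j mod 2 = 0 \<or> j mod 2 = 1" by auto
      then show ?thesis using eq(1) by auto
    qed
    ultimately show ?thesis by (metis div_mult_mod_eq)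
  qed
qed

lemma degree_node_poly: "i < 2 ^ D \<Longrightarrow> Polynomial.degree (node_poly i) \<le> D"
proof (induction D arbitrary: i)
  case 0
  then show ?case by (simp add: node_poly.simps [of 0])
next
  case (Suc D)
  show ?case
  proof (cases "i = 0")
    case False
    have "Polynomial.degree (node_poly (i div 2)) \<le> D" using Suc by simp
    then show ?thesis
      using False degree_pCons_le [of "of_nat (i mod 2) :: 'f" "node_poly (i div 2)"]
      by (simp add: node_poly.simps [of i])
  qed (simp add: node_poly.simps [of 0])
qed

lemma ev_geom: "ev (geom N g m) = (\<Sum>j<m. ev g ^ j)"
proof (induction m)
  case 0
  then show ?case by (simp add: ev_def)
next
  case (Suc m)
  have "ev (geom N g (Suc m)) = ev (\<lambda>k. (cyc_mult N (geom N g m) g k + (if k = 0 then 1 else 0)) mod 2)"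
    by (rule arg_cong [where f=ev], rule ext) simp
  also have "\<dots> = ev g * (\<Sum>j<m. ev g ^ j) + 1"
    by (simp only: ev_add_at_0 ev_cyc_mult Suc) (simp add: mult.commute)
  also have "\<dots> = (\<Sum>j<Suc m. ev g ^ j)"
    unfolding sum.lessThan_Suc_shift by (simp add: sum_distrib_left)
  finally show ?case .
qed

lemma ev_node_row: "ev (node_row N x z i) = (\<Sum>j<N. (poly (node_poly i) (ev x) * ev z) ^ j)"
  unfolding node_row_def ev_geom ev_cyc_mult ev_node_vec ..

text \<open>The image of the ring. The arguments use that it is a finite additive group that
  contains 1 and is closed under multiplication by \<zeta>.\<close>

definition K :: "'f set" where "K = (\<lambda>Xs. ev (bits_of Xs)) ` Pow {..<N}"

lemma ev_sym_diff: "ev (bits_of (sym_diff Xs Y)) = ev (bits_of Xs) + ev (bits_of Y)"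
  unfolding ev_def sum.distrib [symmetric]
proof (intro sum.cong refl)
  fix k
  have "(1 :: 'f) + 1 = 0" using char2 by simp
  then show "of_nat (bits_of (sym_diff Xs Y) k) * \<zeta> ^ k = of_nat (bits_of Xs k) * \<zeta> ^ k + of_nat (bits_of Y k) * \<zeta> ^ k"
    by (auto simp: bits_of_def distrib_right [symmetric])
qed

lemma finite_K: "finite K" by (simp add: K_def)

definition fiber :: "'f \<Rightarrow> nat set set" where
  "fiber v = {Xs \<in> Pow {..<N}. ev (bits_of Xs) = v}"

lemma card_fiber:
  assumes "v \<in> K"
  shows "card (fiber v) = card (fiber 0)"
proof -
  obtain Y where Y: "Y \<subseteq> {..<N}" "v = ev (bits_of Y)" using assms by (auto simp: K_def)
  have "v + v = 0" using uminus_eq [of v] by (metis add.right_inverse)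
  then have "bij_betw (\<lambda>Xs. sym_diff Xs Y) (fiber v) (fiber 0)"
    by (intro bij_betw_byWitness [where f'="\<lambda>Xs. sym_diff Xs Y"])
      (use Y in \<open>auto simp: fiber_def ev_sym_diff simp del: Un_iff Diff_iff\<close>)
  then show ?thesis by (rule bij_betw_same_card)
qed

text \<open>All fibres of the evaluation are translates of its kernel \<open>fiber 0\<close>, so a
  uniform seed has a uniform image in \<open>K\<close>.\<close>

lemma card_K_mult: "card K * card (fiber 0) = 2 ^ N"
proof -
  have "2 ^ N = card (Pow {..<N})" by (simp add: card_Pow)
  also have "\<dots> = (\<Sum>v\<in>K. card (fiber v))"
  proof -
    have "(\<Sum>v\<in>K. \<Sum>Xs\<in>{Xs \<in> Pow {..<N}. ev (bits_of Xs) = v}. 1) = (\<Sum>Xs\<in>Pow {..<N}. 1 :: nat)"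
      by (rule sum.group) (auto simp: K_def)
    then show ?thesis by (simp add: fiber_def)
  qed
  also have "\<dots> = card K * card (fiber 0)" by (simp add: card_fiber)
  finally show ?thesis by simp
qed

lemma zero_in_K: "0 \<in> K"
  unfolding K_def by (rule image_eqI [of _ _ "{}"]) (auto simp: ev_def bits_of_def)

lemma one_in_K: "1 \<in> K"
proof -
  have "ev (bits_of {0}) = (\<Sum>k<N. if k = 0 then 1 else 0)"
    unfolding ev_def bits_of_def by (intro sum.cong refl) simp
  also have "\<dots> = 1" using N_pos by simp
  finally show ?thesis
    unfolding K_def using N_pos by (intro image_eqI [of _ _ "{0}"]) auto
qed

text \<open>Multiplication by \<zeta> corresponds to the cyclic shift of coefficients, because
  \<open>\<zeta> ^ N = 1\<close>.\<close>

lemma zeta_mult_K: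
  assumes "v \<in> K"
  shows "\<zeta> * v \<in> K"
proof -
  obtain Xs where Xs: "Xs \<subseteq> {..<N}" "v = ev (bits_of Xs)" using assms by (auto simp: K_def)
  have *: "ev (bits_of Xs) = (\<Sum>k\<in>Xs. \<zeta> ^ k)" if "Xs \<subseteq> {..<N}" for Xs
  proof -
    have "ev (bits_of Xs) = (\<Sum>k<N. if k \<in> Xs then \<zeta> ^ k else 0)"
      unfolding ev_def bits_of_def by (intro sum.cong refl) simp
    also have "\<dots> = (\<Sum>k\<in>{..<N} \<inter> Xs. \<zeta> ^ k)" by (simp add: sum.inter_restrict)
    also have "{..<N} \<inter> Xs = Xs" using that by blast
    finally show ?thesis .
  qed
  define s where "s k = Suc k mod N" for k
  have inj: "inj_on s Xs"
  proof (rule inj_onI)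
    fix i j assume ij: "i \<in> Xs" "j \<in> Xs" "s i = s j"
    then have "i < N" "j < N" using Xs by auto
    then show "i = j" using ij(3) by (auto simp: s_def mod_Suc split: if_splits)
  qed
  have "s ` Xs \<subseteq> {..<N}" using N_pos by (auto simp: s_def)
  then have "ev (bits_of (s ` Xs)) = (\<Sum>k\<in>Xs. \<zeta> ^ s k)"
    by (simp add: * sum.reindex [OF inj])
  also have "\<dots> = (\<Sum>k\<in>Xs. \<zeta> * \<zeta> ^ k)"
    unfolding s_def power_mod_root [OF root] by simp
  also have "\<dots> = \<zeta> * v" using Xs by (simp add: * sum_distrib_left)
  finally show ?thesis
    using \<open>s ` Xs \<subseteq> {..<N}\<close> unfolding K_def by (metis PowI image_eqI)
qed

text \<open>As in Fermat's little theorem: multiplication by \<open>\<zeta>\<close> permutes the non-zero elements of \<open>K\<close>.\<close>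

lemma zeta_power_card_K: "\<zeta> ^ (card K - 1) = 1"
proof -
  have "\<zeta> \<noteq> 0" using root N_pos by (auto simp: power_0_left)
  then have inj: "inj_on ((*) \<zeta>) (K - {0})" by (simp add: inj_on_def)
  have sub: "(*) \<zeta> ` (K - {0}) \<subseteq> K - {0}"
    using zeta_mult_K \<open>\<zeta> \<noteq> 0\<close> by auto
  have "(*) \<zeta> ` (K - {0}) = K - {0}"
    using finite_K inj sub by (intro card_subset_eq) (auto simp: card_image)
  then have "(\<Prod>v\<in>K - {0}. v) = (\<Prod>v\<in>K - {0}. \<zeta> * v)"
    using prod.reindex [OF inj, of "\<lambda>v. v"] by simp
  also have "\<dots> = \<zeta> ^ card (K - {0}) * (\<Prod>v\<in>K - {0}. v)"
    by (simp add: prod.distrib)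
  finally have "\<zeta> ^ card (K - {0}) = 1"
    using finite_K by auto
  then show ?thesis using zero_in_K finite_K by simp
qed

lemma card_K_power: "\<exists>e\<ge>1. card K = 2 ^ e"
proof -
  have "card K dvd 2 ^ N" using card_K_mult by (metis dvd_triv_left)
  then obtain e where e: "card K = 2 ^ e" using divides_primepow_nat [of 2 "card K" N] by auto
  have "card {0 :: 'f, 1} \<le> card K"
    using zero_in_K one_in_K finite_K by (intro card_mono) auto
  then have "2 \<le> card K" by simp
  with e have "e \<noteq> 0" by (intro notI) simp
  with e show ?thesis by (intro exI [of _ e]) auto
qed

lemma power_gcd_root:
  assumes "\<zeta> ^ a = 1" "\<zeta> ^ b = 1" "a \<noteq> 0"
  shows "\<zeta> ^ gcd a b = 1"
proof -
  obtain x y where "a * x = b * y + gcd a b" using bezout_nat [OF assms(3), of b] by blast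
  then have "\<zeta> ^ (a * x) = \<zeta> ^ (b * y) * \<zeta> ^ gcd a b" by (simp add: power_add)
  then show ?thesis using assms by (simp add: power_mult)
qed

text \<open>The collisions of the nodes come first; if there are none, the Vandermonde determinant makes the
  sum of the geometric series a non-zero polynomial in \<open>\<eta>\<close>.\<close>

lemma card_bad_seeds:
  assumes S: "finite S" "S \<noteq> {}" "card S \<le> N" "\<And>i. i \<in> S \<Longrightarrow> i < 2 ^ D"
  defines "bad \<equiv> {(\<xi>, \<eta>). \<xi> \<in> K \<and> \<eta> \<in> K \<and> (\<Sum>i\<in>S. \<Sum>j<N. (poly (node_poly i) \<xi> * \<eta>) ^ j) = 0}"
  shows "card bad \<le> (N\<^sup>2 * D + N) * card K"
proof -
  define coll where "coll = {\<xi> \<in> K. \<exists>i\<in>S. \<exists>j\<in>S. i \<noteq> j \<and> poly (node_poly i) \<xi> = poly (node_poly j) \<xi>}"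
  \<comment> \<open>For fixed \<xi> this is the sum of the geometric series as a polynomial in
    \<eta>; its coefficients are the power sums of the nodes.\<close>
  define q where "q \<xi> = (\<Sum>i\<in>S. \<Sum>j<N. Polynomial.monom (poly (node_poly i) \<xi> ^ j) j)" for \<xi>
  have qpoly: "poly (q \<xi>) \<eta> = (\<Sum>i\<in>S. \<Sum>j<N. (poly (node_poly i) \<xi> * \<eta>) ^ j)" for \<xi> \<eta>
    by (simp add: q_def poly_sum poly_monom power_mult_distrib)
  have coeffq: "Polynomial.coeff (q \<xi>) j = (\<Sum>i\<in>S. poly (node_poly i) \<xi> ^ j)" if "j < N" for j \<xi>
    using that by (simp add: q_def coeff_sum)
  have degq: "Polynomial.degree (q \<xi>) \<le> N" for \<xi>
    unfolding q_def by (intro degree_sum_le) (auto intro!: degree_sum_le order_trans [OF degree_monom_le] S)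
  have q_nonzero: "q \<xi> \<noteq> 0" if "\<xi> \<in> K - coll" for \<xi>
  proof
    assume q0: "q \<xi> = 0"
    obtain s where s: "s \<in> S" using S by auto
    define a where "a i = poly (node_poly i) \<xi>" for i
    \<comment> \<open>Instead of a determinant: \<open>P\<close> vanishes at all nodes but that of
      \<open>s\<close>. If all power sums of order below \<open>N\<close> vanish, then so does the
      sum of \<open>P\<close> over the nodes, which is the non-zero value of \<open>P\<close> at the
      node of \<open>s\<close>.\<close>
    define P where "P = (\<Prod>i\<in>S - {s}. [:- a i, 1:])"
    have "Polynomial.degree P \<le> (\<Sum>i\<in>S - {s}. Polynomial.degree [:- a i, 1:])"
      unfolding P_def using degree_prod_sum_le [of "S - {s}" "\<lambda>i. [:- a i, 1:]"] S by (simp add: o_def)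
    also have "\<dots> = card (S - {s})" by simp
    also have "\<dots> < card S" using S s by (meson card_Diff1_less)
    finally have degP: "Polynomial.degree P < N" using S by simp
    have "(\<Sum>i\<in>S. poly P (a i)) = (\<Sum>i\<in>S. \<Sum>j\<le>Polynomial.degree P. Polynomial.coeff P j * a i ^ j)"
      by (simp add: poly_altdef)
    also have "\<dots> = (\<Sum>j\<le>Polynomial.degree P. Polynomial.coeff P j * Polynomial.coeff (q \<xi>) j)"
      using degP by (subst sum.swap) (simp add: coeffq a_def sum_distrib_left)
    finally have "(\<Sum>i\<in>S. poly P (a i)) = 0" by (simp add: q0)
    moreover have "(\<Sum>i\<in>S. poly P (a i)) = poly P (a s)"
    proof -
      have "poly P (a i) = 0" if "i \<in> S - {s}" for i
        unfolding P_def poly_prod using that S by (intro prod_zero) auto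
      then show ?thesis using S s by (simp add: sum.remove)
    qed
    moreover have "poly P (a s) \<noteq> 0"
      unfolding P_def poly_prod using that s S by (auto simp: coll_def a_def)
    ultimately show False by simp
  qed
  \<comment> \<open>A collision is a root of the difference of two digit polynomials, of degree at
    most \<open>D\<close>; there are at most N^2 pairs of indices.\<close>
  have cardcoll: "card coll \<le> N\<^sup>2 * D"
  proof -
    define R where "R = (\<lambda>(i, j). {\<xi>. poly (node_poly i - node_poly j) \<xi> = 0})"
    define I where "I = {(i, j) \<in> S \<times> S. i \<noteq> j}"
    have finI: "finite I" using S(1) by (auto simp: I_def intro: finite_subset [of _ "S \<times> S"])
    have R: "finite (R p) \<and> card (R p) \<le> D" if p: "p \<in> I" for p
    proof -
      obtain i j where ij: "p = (i, j)" "i \<in> S" "j \<in> S" "i \<noteq> j" using p by (auto simp: I_def)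
      then have nz: "node_poly i - node_poly j \<noteq> 0" using node_poly_inject by auto
      have "Polynomial.degree (node_poly i - node_poly j) \<le> D"
        using ij S(4) by (intro degree_diff_le degree_node_poly) auto
      then show ?thesis
        using poly_roots_finite [OF nz] card_poly_roots_bound [OF nz] by (simp add: R_def ij)
    qed
    have "coll \<subseteq> (\<Union>p\<in>I. R p)" by (auto simp: coll_def R_def I_def)
    then have "card coll \<le> card (\<Union>p\<in>I. R p)"
      using finI R by (intro card_mono) auto
    also have "\<dots> \<le> (\<Sum>p\<in>I. card (R p))" by (rule card_UN_le [OF finI])
    also have "\<dots> \<le> (\<Sum>p\<in>I. D)" using R by (intro sum_mono) auto
    also have "\<dots> \<le> N\<^sup>2 * D"
    proof -
      have "card I \<le> card (S \<times> S)" unfolding I_def using S(1) by (intro card_mono) auto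
      also have "\<dots> \<le> N * N" using S(3) by (simp add: card_cartesian_product mult_le_mono)
      finally show ?thesis by (simp add: power2_eq_square)
    qed
    finally show ?thesis .
  qed
  have "bad \<subseteq> coll \<times> K \<union> (SIGMA \<xi>:K - coll. {\<eta>. poly (q \<xi>) \<eta> = 0})"
    by (auto simp: bad_def qpoly)
  moreover have finroots: "finite {\<eta>. poly (q \<xi>) \<eta> = 0}" "card {\<eta>. poly (q \<xi>) \<eta> = 0} \<le> N" if "\<xi> \<in> K - coll" for \<xi>
    using poly_roots_finite [OF q_nonzero [OF that]] card_poly_roots_bound [OF q_nonzero [OF that]] degq [of \<xi>] by auto
  moreover have fincoll: "finite coll" using finite_K by (simp add: coll_def)
  ultimately have "card bad \<le> card (coll \<times> K \<union> (SIGMA \<xi>:K - coll. {\<eta>. poly (q \<xi>) \<eta> = 0}))"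
    using finite_K by (intro card_mono) (auto intro!: finite_SigmaI)
  also have "\<dots> \<le> card (coll \<times> K) + card (SIGMA \<xi>:K - coll. {\<eta>. poly (q \<xi>) \<eta> = 0})"
    by (rule card_Un_le)
  also have "card (SIGMA \<xi>:K - coll. {\<eta>. poly (q \<xi>) \<eta> = 0}) = (\<Sum>\<xi>\<in>K - coll. card {\<eta>. poly (q \<xi>) \<eta> = 0})"
    using finite_K finroots by (subst card_SigmaI) auto
  also have "\<dots> \<le> (\<Sum>\<xi>\<in>K - coll. N)"
    using finroots by (intro sum_mono) auto
  also have "\<dots> \<le> N * card K"
    using finite_K by (simp add: card_mono mult.commute)
  also have "card (coll \<times> K) \<le> N\<^sup>2 * D * card K"
    using cardcoll by (simp add: card_cartesian_product)
  finally show ?thesis by (simp add: add_mult_distrib)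
qed

text \<open>For fixed \<open>x\<close> and \<open>z\<close> the parity is a character in
  \<open>u\<close>, given by the sum of the rows modulo 2, and averages to zero unless that sum is
  zero. In this case the images of \<open>x\<close> and \<open>z\<close> form one of the pairs
  counted by \<open>card_bad_seeds\<close>, and every such pair has
  \<open>(card (fiber 0))\<^sup>2\<close> preimages.\<close>

lemma sum_seeds_chi:
  assumes S: "S \<subseteq> {..<n}" "S \<noteq> {}" "card S \<le> N" "n \<le> 2 ^ D"
  shows "\<bar>seed_sum n N S\<bar>
    \<le> real ((N\<^sup>2 * D + N) * card K * (card (fiber 0))\<^sup>2 * 2 ^ N)"
proof -
  define B where "B Xs Zs k = (\<Sum>i\<in>S. node_row N (bits_of Xs) (bits_of Zs) i k)" for Xs Zs k
  have finS: "finite S" using S finite_subset by blast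
  have chi: "chi S (out_set n N Xs Zs Us) = chi {k. k < N \<and> odd (B Xs Zs k)} Us" if Us: "Us \<subseteq> {..<N}" for Xs Zs Us
  proof -
    let ?o = "\<lambda>i. seed_bit N (bits_of Xs) (bits_of Zs) (bits_of Us) i"
    have "S \<inter> out_set n N Xs Zs Us = {i \<in> S. ?o i = 1}" using S(1) by (auto simp: out_set_def)
    then have "card (S \<inter> out_set n N Xs Zs Us) = (\<Sum>i\<in>S. ?o i)"
    proof -
      have "(\<Sum>i\<in>S. ?o i) = (\<Sum>i\<in>S. if ?o i = 1 then 1 else 0)"
        by (intro sum.cong refl) (auto simp: seed_bit_def)
      with \<open>S \<inter> _ = _\<close> show ?thesis using finS by (simp add: sum.inter_filter [symmetric])
    qed
    then have "even (card (S \<inter> out_set n N Xs Zs Us)) \<longleftrightarrow> even (\<Sum>i\<in>S. \<Sum>k<N. bits_of Us k * node_row N (bits_of Xs) (bits_of Zs) i k)"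
      using finS by (simp add: seed_bit_def even_sum_iff)
    also have "(\<Sum>i\<in>S. \<Sum>k<N. bits_of Us k * node_row N (bits_of Xs) (bits_of Zs) i k) = (\<Sum>k<N. bits_of Us k * B Xs Zs k)"
      by (subst sum.swap) (simp add: B_def sum_distrib_left)
    also have "even \<dots> \<longleftrightarrow> even (card {k \<in> {..<N}. odd (bits_of Us k * B Xs Zs k)})"
      by (subst even_sum_iff) auto
    also have "{k \<in> {..<N}. odd (bits_of Us k * B Xs Zs k)} = {k. k < N \<and> odd (B Xs Zs k)} \<inter> Us"
      by (auto simp: bits_of_def)
    finally show ?thesis by (simp add: chi_def minus_one_power_iff)
  qed
  define Bad where "Bad = {(Xs, Zs) \<in> Pow {..<N} \<times> Pow {..<N}. \<forall>k<N. even (B Xs Zs k)}"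
  have "(\<Sum>Us\<in>Pow {..<N}. chi S (out_set n N Xs Zs Us)) = of_bool ((Xs, Zs) \<in> Bad) * 2 ^ N"
    if "Xs \<in> Pow {..<N}" "Zs \<in> Pow {..<N}" for Xs Zs
  proof -
    have "(\<Sum>Us\<in>Pow {..<N}. chi S (out_set n N Xs Zs Us)) = (\<Sum>Us\<in>Pow {..<N}. chi {k. k < N \<and> odd (B Xs Zs k)} Us)"
      by (intro sum.cong refl chi) auto
    also have "\<dots> = (if {k. k < N \<and> odd (B Xs Zs k)} = {} then 2 ^ card {..<N} else 0)"
      by (rule sum_chi) auto
    also have "{k. k < N \<and> odd (B Xs Zs k)} = {} \<longleftrightarrow> (Xs, Zs) \<in> Bad"
      using that by (auto simp: Bad_def)
    finally show ?thesis by simp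
  qed
  then have "seed_sum n N S
      = (\<Sum>Xs\<in>Pow {..<N}. \<Sum>Zs\<in>Pow {..<N}. of_bool ((Xs, Zs) \<in> Bad) * 2 ^ N)"
    unfolding seed_sum_def by (intro sum.cong refl)
  also have "\<dots> = (\<Sum>p\<in>Pow {..<N} \<times> Pow {..<N}. of_bool (p \<in> Bad) * 2 ^ N)"
    unfolding sum.cartesian_product by (intro sum.cong refl) auto
  also have "\<dots> = real (card Bad) * 2 ^ N"
  proof -
    have "Pow {..<N} \<times> Pow {..<N} \<inter> Bad = Bad" by (auto simp: Bad_def)
    then show ?thesis by (simp add: sum_distrib_right [symmetric])
  qed
  finally have total: "seed_sum n N S
      = real (card Bad) * 2 ^ N" .
  define bad where "bad = {(\<xi>, \<eta>). \<xi> \<in> K \<and> \<eta> \<in> K \<and> (\<Sum>i\<in>S. \<Sum>j<N. (poly (node_poly i) \<xi> * \<eta>) ^ j) = 0}"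
  have finbad: "finite bad"
    using finite_K by (auto simp: bad_def intro: finite_subset [of _ "K \<times> K"])
  have "card Bad \<le> card (\<Union>(\<xi>, \<eta>)\<in>bad. fiber \<xi> \<times> fiber \<eta>)"
  proof (rule card_mono)
    show "finite (\<Union>(\<xi>, \<eta>)\<in>bad. fiber \<xi> \<times> fiber \<eta>)"
      using finbad by (auto simp: fiber_def)
    show "Bad \<subseteq> (\<Union>(\<xi>, \<eta>)\<in>bad. fiber \<xi> \<times> fiber \<eta>)"
    proof clarify
      fix Xs Zs assume "(Xs, Zs) \<in> Bad"
      then have XZ: "Xs \<subseteq> {..<N}" "Zs \<subseteq> {..<N}" "\<And>k. k < N \<Longrightarrow> even (B Xs Zs k)" by (auto simp: Bad_def)
      have "(\<Sum>i\<in>S. ev (node_row N (bits_of Xs) (bits_of Zs) i)) = (\<Sum>k<N. of_nat (B Xs Zs k) * \<zeta> ^ k)"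
        unfolding ev_def by (subst sum.swap) (simp add: B_def sum_distrib_right)
      also have "\<dots> = 0"
      proof (intro sum.neutral ballI)
        fix k assume "k \<in> {..<N}"
        then have "B Xs Zs k mod 2 = 0" using XZ(3) by auto
        then have "(of_nat (B Xs Zs k) :: 'f) = 0" using of_nat_mod_2 [OF char2, of "B Xs Zs k"] by simp
        then show "of_nat (B Xs Zs k) * \<zeta> ^ k = 0" by simp
      qed
      finally have "(ev (bits_of Xs), ev (bits_of Zs)) \<in> bad"
        using XZ by (simp add: bad_def K_def ev_node_row)
      then show "(Xs, Zs) \<in> (\<Union>(\<xi>, \<eta>)\<in>bad. fiber \<xi> \<times> fiber \<eta>)"
        using XZ by (intro UN_I [of "(ev (bits_of Xs), ev (bits_of Zs))"]) (auto simp: fiber_def)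
    qed
  qed
  also have "\<dots> \<le> (\<Sum>(\<xi>, \<eta>)\<in>bad. card (fiber \<xi> \<times> fiber \<eta>))"
    using card_UN_le [OF finbad, of "\<lambda>(\<xi>, \<eta>). fiber \<xi> \<times> fiber \<eta>"] by (simp add: case_prod_unfold)
  also have "\<dots> = (\<Sum>(\<xi>, \<eta>)\<in>bad. (card (fiber 0))\<^sup>2)"
    by (intro sum.cong refl) (auto simp: bad_def card_cartesian_product card_fiber power2_eq_square)
  also have "\<dots> = card bad * (card (fiber 0))\<^sup>2" by simp
  also have "\<dots> \<le> (N\<^sup>2 * D + N) * card K * (card (fiber 0))\<^sup>2"
    unfolding bad_def using S finS by (intro mult_right_mono card_bad_seeds) auto
  finally have "card Bad * 2 ^ N \<le> (N\<^sup>2 * D + N) * card K * (card (fiber 0))\<^sup>2 * 2 ^ N"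
    by simp
  then have "real (card Bad * 2 ^ N) \<le> real ((N\<^sup>2 * D + N) * card K * (card (fiber 0))\<^sup>2 * 2 ^ N)"
    by (rule of_nat_mono)
  then show ?thesis unfolding total by simp
qed

text \<open>Since \<open>card K * card (fiber 0) = 2 ^ N\<close>, the normalised count is the number
  of bad pairs divided by \<open>(card K)\<^sup>2\<close>.\<close>

lemma avg_seeds_chi:
  assumes S: "S \<subseteq> {..<n}" "S \<noteq> {}" "card S \<le> N" "n \<le> 2 ^ D" and "2 ^ m \<le> card K"
  shows "\<bar>seed_sum n N S / 2 ^ (3 * N)\<bar>
    \<le> real (N\<^sup>2 * D + N) / 2 ^ m"
proof -
  have pos: "0 < real (card K)" using card_K_power by auto
  have KF: "real (card K) * real (card (fiber 0)) = 2 ^ N"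
    using card_K_mult by (metis of_nat_mult of_nat_numeral of_nat_power)
  have "real ((N\<^sup>2 * D + N) * card K * (card (fiber 0))\<^sup>2 * 2 ^ N) * real (card K)
      = real (N\<^sup>2 * D + N) * (real (card K) * real (card (fiber 0)))\<^sup>2 * 2 ^ N"
    by (simp only: of_nat_mult of_nat_power power2_eq_square) (simp add: mult_ac)
  also have "\<dots> = real (N\<^sup>2 * D + N) * 2 ^ (3 * N)"
    unfolding KF by (simp add: power_mult [symmetric] power_add [symmetric] mult.commute)
  finally have "real ((N\<^sup>2 * D + N) * card K * (card (fiber 0))\<^sup>2 * 2 ^ N) / 2 ^ (3 * N)
      = real (N\<^sup>2 * D + N) / card K"
    using pos by (simp add: field_simps)
  moreover have "real (N\<^sup>2 * D + N) / card K \<le> real (N\<^sup>2 * D + N) / 2 ^ m"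
  proof (intro divide_left_mono)
    show "2 ^ m \<le> real (card K)" using assms(5) by (metis of_nat_le_iff of_nat_numeral of_nat_power)
  qed (use pos in auto)
  moreover have "\<bar>seed_sum n N S / 2 ^ (3 * N)\<bar>
      \<le> real ((N\<^sup>2 * D + N) * card K * (card (fiber 0))\<^sup>2 * 2 ^ N) / 2 ^ (3 * N)"
    using sum_seeds_chi [OF S] by (simp only: abs_divide) (simp add: divide_right_mono)
  ultimately show ?thesis by simp
qed

end

section \<open>The order of 2 modulo powers of 3\<close>

lemma three_power_dvd:
  assumes "3 ^ l dvd (2 ^ e - 1 :: nat)" "1 \<le> l" "1 \<le> e"
  shows "2 * 3 ^ (l - 1) \<le> e"
proof -
  have "Pocklington.ord 3 (2 :: nat) = 2"
  proof -
    have "Pocklington.ord 3 (2 :: nat) dvd 2" by (subst ord_divides [symmetric]) (simp add: cong_def)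
    then have "Pocklington.ord 3 (2 :: nat) \<le> 2" by (rule dvd_imp_le) simp
    moreover have "Pocklington.ord 3 (2 :: nat) \<noteq> 0" by (simp add: ord_eq_0)
    moreover have "\<not> Pocklington.ord 3 (2 :: nat) dvd 1" by (subst ord_divides [symmetric]) (simp add: cong_def)
    then have "Pocklington.ord 3 (2 :: nat) \<noteq> 1" by auto
    ultimately show ?thesis by linarith
  qed
  then have "residue_primroot 3 (2 :: nat)"
    by (simp add: residue_primroot_def totient_prime)
  \<comment> \<open>The lifting criterion: a primitive root modulo 3 whose square is not 1 modulo 9
    is primitive modulo every power of 3.\<close>
  moreover have "[(2 :: nat) ^ (3 - 1) \<noteq> 1] (mod 3\<^sup>2)" by (simp add: cong_def)
  ultimately have "residue_primroot (3 ^ l) (2 :: nat)"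
    using residue_primroot_prime_lift_iff [of 3 2] assms(2) by auto
  then have "Pocklington.ord (3 ^ l) (2 :: nat) = 2 * 3 ^ (l - 1)"
    using assms(2) by (simp add: residue_primroot_def totient_prime_power)
  moreover have "[(2 :: nat) ^ e = 1] (mod 3 ^ l)"
  proof -
    have "[(2 :: nat) ^ e - 1 + 1 = 0 + 1] (mod 3 ^ l)"
      using assms(1) by (intro cong_add) (simp_all add: cong_0_iff)
    then show ?thesis by simp
  qed
  ultimately have "2 * 3 ^ (l - 1) dvd e" by (metis ord_divides)
  then show ?thesis using assms(3) by (intro dvd_imp_le) auto
qed

lemma char_2_alg_closure: "(2 :: bit alg_closure) = 0"
proof -
  have "(2 :: bit alg_closure) = to_ac (2 :: bit)" by (simp only: to_ac_numeral)
  then show ?thesis by (simp only: bit_2_eq_0 to_ac_0)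
qed

text \<open>With m = 3^(l - 1), a root of 1 + X^m + X^(2 m) is taken. This divides X^(3 m) - 1, and
  X^m = 1 would give 1 + 1 + 1 = 0, impossible in characteristic 2.\<close>

lemma exists_root_of_unity:
  fixes l :: nat
  assumes "1 \<le> l"
  shows "\<exists>\<zeta> :: bit alg_closure. \<zeta> ^ (3 ^ l) = 1 \<and> \<zeta> ^ (3 ^ (l - 1)) \<noteq> 1"
proof -
  define m :: nat where "m = 3 ^ (l - 1)"
  have m: "0 < m" "3 ^ l = 3 * m"
    using assms by (auto simp: m_def power_Suc [symmetric] simp del: power_Suc)
  define f :: "nat \<Rightarrow> bit alg_closure" where "f k = (if k = 0 \<or> k = m \<or> k = 2 * m then 1 else 0)" for k
  have "\<exists>\<zeta>. (\<Sum>k\<le>2 * m. f k * \<zeta> ^ k) = 0"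
    using m by (intro alg_closed) (auto simp: f_def)
  then obtain \<zeta> where "(\<Sum>k\<le>2 * m. f k * \<zeta> ^ k) = 0" ..
  moreover have "(\<Sum>k\<le>2 * m. f k * \<zeta> ^ k) = (\<Sum>k\<in>{0, m, 2 * m}. f k * \<zeta> ^ k)"
    by (rule sum.mono_neutral_right) (auto simp: f_def)
  ultimately have \<zeta>: "1 + \<zeta> ^ m + \<zeta> ^ (2 * m) = 0"
    using m by (simp add: f_def add.assoc)
  have sq: "\<zeta> ^ (2 * m) = \<zeta> ^ m * \<zeta> ^ m" by (simp add: mult_2 power_add)
  have "\<zeta> ^ (3 * m) - 1 = (\<zeta> ^ m - 1) * (1 + \<zeta> ^ m + \<zeta> ^ (2 * m))"
  proof -
    have "3 * m = m + m + m" by simp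
    then have "\<zeta> ^ (3 * m) = \<zeta> ^ m * \<zeta> ^ m * \<zeta> ^ m" by (simp only: power_add)
    then show ?thesis by (simp only: sq) (simp add: algebra_simps)
  qed
  then have "\<zeta> ^ (3 * m) = 1" using \<zeta> by simp
  moreover have "\<zeta> ^ m \<noteq> 1"
  proof
    assume "\<zeta> ^ m = 1"
    have "0 = 1 + 1 + 1 * (1 :: bit alg_closure)" using \<zeta> unfolding sq \<open>\<zeta> ^ m = 1\<close> by (rule sym)
    also have "\<dots> = 1" by (simp only: one_add_one char_2_alg_closure add_0_left mult_1_left)
    finally show False by simp
  qed
  ultimately show ?thesis unfolding m(2) m_def [symmetric] by blast
qed

text \<open>By the choice of \<zeta> and \<open>zeta_power_card_K\<close>, 3^l divides card K - 1:
  otherwise the gcd of the two would divide 3^(l - 1), and \<zeta> would already be a root of unity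
  of that order. As card K is a power of 2, the order of 2 modulo 3^l bounds its exponent from
  below.\<close>

theorem generator_small_bias:
  assumes "1 \<le> l" and N: "N = 3 ^ l"
    and S: "S \<subseteq> {..<n}" "S \<noteq> {}" "card S \<le> N" "n \<le> 2 ^ D"
  shows "\<bar>seed_sum n N S / 2 ^ (3 * N)\<bar>
    \<le> real (N\<^sup>2 * D + N) / 2 ^ (2 * 3 ^ (l - 1))"
proof -
  obtain \<zeta> :: "bit alg_closure" where \<zeta>: "\<zeta> ^ (3 ^ l) = 1" "\<zeta> ^ (3 ^ (l - 1)) \<noteq> 1"
    using exists_root_of_unity [OF assms(1)] by blast
  interpret cyclic_eval \<zeta> N
  proof
    show "(2 :: bit alg_closure) = 0" by (rule char_2_alg_closure)
  qed (use \<zeta> N in auto)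
  obtain e where e: "1 \<le> e" "card K = 2 ^ e" using card_K_power by auto
  have "3 ^ l dvd (2 ^ e - 1 :: nat)"
  proof (rule ccontr)
    assume ndvd: "\<not> 3 ^ l dvd (2 ^ e - 1 :: nat)"
    define g where "g = gcd (3 ^ l) (2 ^ e - 1 :: nat)"
    have "\<zeta> ^ g = 1"
      unfolding g_def using \<zeta>(1) zeta_power_card_K e by (intro power_gcd_root) auto
    have "g dvd 3 ^ l" by (simp add: g_def)
    then obtain i where i: "i \<le> l" "g = 3 ^ i" using divides_primepow_nat [of 3 g l] by auto
    have "i \<noteq> l" using ndvd i(2) unfolding g_def by (metis gcd_dvd2)
    then have "i \<le> l - 1" using i(1) by simp
    then have "g dvd 3 ^ (l - 1)" using i(2) by (simp add: le_imp_power_dvd)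
    then have "\<zeta> ^ (3 ^ (l - 1)) = 1" using \<open>\<zeta> ^ g = 1\<close> by (auto simp: power_mult elim!: dvdE)
    with \<zeta>(2) show False by simp
  qed
  then have "2 * 3 ^ (l - 1) \<le> e" using three_power_dvd assms(1) e(1) by blast
  then have "2 ^ (2 * 3 ^ (l - 1)) \<le> card K" using e(2) by (simp add: power_increasing)
  with S show ?thesis by (rule avg_seeds_chi)
qed

section \<open>Programs\<close>

definition runs :: "com \<Rightarrow> store \<Rightarrow> nat \<Rightarrow> (store \<Rightarrow> bool) \<Rightarrow> bool" where
  "runs c s B Q \<longleftrightarrow> (\<exists>k s'. exec c s k s' \<and> k \<le> B \<and> Q s')"

text \<open>A frame condition: \<open>W\<close> lists the arrays that may have been written
  to.\<close>

definition agree :: "string set \<Rightarrow> store \<Rightarrow> store \<Rightarrow> bool" where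
  "agree W s s' \<longleftrightarrow> (\<forall>a. a \<notin> W \<longrightarrow> s' a = s a)"

abbreviation Val :: "string \<Rightarrow> aexp" where "Val v \<equiv> Read v (Const 0)"
abbreviation Put :: "string \<Rightarrow> aexp \<Rightarrow> com" where "Put v e \<equiv> Write v (Const 0) e"

definition For :: "string \<Rightarrow> aexp \<Rightarrow> com \<Rightarrow> com" where
  "For v hi c = Seq (Put v (Const 0)) (WhileLess (Val v) hi (Seq c (Put v (Plus (Val v) (Const 1)))))"

lemma agree_refl [simp]: "agree W s s"
  by (simp add: agree_def)

lemma agreeD: "agree W s s' \<Longrightarrow> a \<notin> W \<Longrightarrow> s' a = s a"
  by (simp add: agree_def)

lemma agree_upd: "agree W s s' \<Longrightarrow> a \<in> W \<Longrightarrow> agree W s (s'(a := f))"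
  by (auto simp: agree_def)

section \<open>Rules for total correctness with step counts\<close>

lemma runs_Skip: "Q s \<Longrightarrow> 1 \<le> B \<Longrightarrow> runs Skip s B Q"
  unfolding runs_def using exec.Skip by blast

lemma runs_Write: "Q (s(a := (s a)(aval i s := aval e s))) \<Longrightarrow> 1 \<le> B \<Longrightarrow> runs (Write a i e) s B Q"
  unfolding runs_def using exec.Write by blast

lemma runs_Seq:
  assumes "runs c1 s B1 R" "\<And>s'. R s' \<Longrightarrow> runs c2 s' B2 Q"
  shows "runs (Seq c1 c2) s (B1 + B2) Q"
proof -
  obtain k1 s1 where 1: "exec c1 s k1 s1" "k1 \<le> B1" "R s1" using assms(1) by (auto simp: runs_def)
  obtain k2 s2 where 2: "exec c2 s1 k2 s2" "k2 \<le> B2" "Q s2" using assms(2) [OF 1(3)] by (auto simp: runs_def)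
  show ?thesis unfolding runs_def using exec.Seq [OF 1(1) 2(1)] 1(2) 2(2,3) by (meson add_mono)
qed

lemma runs_If:
  assumes "aval e1 s < aval e2 s \<Longrightarrow> runs c1 s B Q" "\<not> aval e1 s < aval e2 s \<Longrightarrow> runs c2 s B Q"
  shows "runs (IfLess e1 e2 c1 c2) s (1 + B) Q"
proof (cases "aval e1 s < aval e2 s")
  case True
  then obtain k s' where "exec c1 s k s'" "k \<le> B" "Q s'" using assms(1) by (auto simp: runs_def)
  with exec.IfTrue [OF True this(1)] show ?thesis unfolding runs_def by (meson add_le_mono1 add_left_mono)
next
  case False
  then obtain k s' where "exec c2 s k s'" "k \<le> B" "Q s'" using assms(2) by (auto simp: runs_def)
  with exec.IfFalse [OF False this(1)] show ?thesis unfolding runs_def by (meson add_le_mono1 add_left_mono)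
qed

lemma runs_mono: "runs c s B Q \<Longrightarrow> B \<le> B' \<Longrightarrow> (\<And>s'. Q s' \<Longrightarrow> Q' s') \<Longrightarrow> runs c s B' Q'"
  unfolding runs_def by (meson order_trans)

lemma runs_While:
  assumes step: "\<And>m s. m < M \<Longrightarrow> I m s \<Longrightarrow> aval e1 s < aval e2 s \<and> runs c s B (I (Suc m))"
    and exit: "\<And>s. I M s \<Longrightarrow> \<not> aval e1 s < aval e2 s"
    and "I m s" "m \<le> M"
  shows "runs (WhileLess e1 e2 c) s (1 + (M - m) * (B + 1)) (I M)"
  using assms(3,4)
proof (induction "M - m" arbitrary: m s)
  case 0
  then have "m = M" by simp
  with 0 exit show ?case unfolding runs_def using exec.WhileFalse by fastforce
next
  case (Suc d)
  then have "m < M" by simp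
  from step [OF this Suc.prems(1)] obtain k s1
    where 1: "aval e1 s < aval e2 s" "exec c s k s1" "k \<le> B" "I (Suc m) s1" by (auto simp: runs_def)
  have "runs (WhileLess e1 e2 c) s1 (1 + (M - Suc m) * (B + 1)) (I M)"
    using Suc.hyps \<open>m < M\<close> 1(4) by (intro Suc.hyps(1)) auto
  then obtain k' s2 where 2: "exec (WhileLess e1 e2 c) s1 k' s2" "k' \<le> 1 + (M - Suc m) * (B + 1)" "I M s2"
    by (auto simp: runs_def)
  have "M - m = Suc (M - Suc m)" using \<open>m < M\<close> by simp
  then have "1 + k + k' \<le> 1 + (M - m) * (B + 1)" using 1(3) 2(2) by simp
  then show ?case
    unfolding runs_def using exec.WhileTrue [OF 1(1,2) 2(1)] 2(3) by blast
qed

text \<open>The 2 outside the product is the initial assignment and the last test, the 2 inside is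
  the test and the increment of each round. The invariant at \<open>Suc m\<close> is demanded of the
  state after the increment, because it may mention the counter.\<close>

lemma runs_For:
  assumes init: "I 0 (s(v := (s v)(0 := 0)))"
    and bound: "\<And>m s. I m s \<Longrightarrow> aval hi s = M"
    and step: "\<And>m s. m < M \<Longrightarrow> I m s \<Longrightarrow> s v 0 = m \<Longrightarrow>
      runs c s B (\<lambda>s'. s' v 0 = m \<and> I (Suc m) (s'(v := (s' v)(0 := Suc m))))"
  shows "runs (For v hi c) s (2 + M * (B + 2)) (I M)"
proof -
  define J where "J m s \<longleftrightarrow> I m s \<and> s v 0 = m" for m s
  have "runs (Put v (Const 0)) s 1 (J 0)"
    using init by (intro runs_Write) (simp_all add: J_def)
  moreover have "runs (WhileLess (Val v) hi (Seq c (Put v (Plus (Val v) (Const 1))))) s' (1 + (M - 0) * (B + 1 + 1)) (J M)"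
    if "J 0 s'" for s'
  proof (rule runs_While [where I=J, OF _ _ that])
    fix m s assume m: "m < M" "J m s"
    then have "runs (Seq c (Put v (Plus (Val v) (Const 1)))) s (B + 1) (J (Suc m))"
    proof (intro runs_Seq [OF step [of m]])
      fix s1 assume "s1 v 0 = m \<and> I (Suc m) (s1(v := (s1 v)(0 := Suc m)))"
      then show "runs (Put v (Plus (Val v) (Const 1))) s1 1 (J (Suc m))"
        by (intro runs_Write) (simp_all add: J_def)
    qed (auto simp: J_def)
    moreover have "aval hi s = M" using m by (intro bound [of m]) (simp add: J_def)
    ultimately show "aval (Val v) s < aval hi s \<and> runs (Seq c (Put v (Plus (Val v) (Const 1)))) s (B + 1) (J (Suc m))"
      using m by (simp add: J_def)
  next
    fix s assume J: "J M s"
    then have "aval hi s = M" by (intro bound [of M]) (simp add: J_def)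
    with J show "\<not> aval (Val v) s < aval hi s" by (simp add: J_def)
  qed simp
  ultimately have "runs (For v hi c) s (1 + (1 + (M - 0) * (B + 1 + 1))) (J M)"
    unfolding For_def by (rule runs_Seq)
  then show ?thesis by (rule runs_mono) (auto simp: J_def)
qed

section \<open>Copying and multiplying vectors\<close>

definition Fill :: "string \<Rightarrow> aexp \<Rightarrow> aexp \<Rightarrow> com" where
  "Fill a base src = For ''k'' (Val ''N'') (Write a (Plus base (Val ''k'')) src)"

lemma runs_Fill:
  assumes "a \<noteq> ''k''" "a \<noteq> ''N''" "s ''N'' 0 = N"
    and base: "\<And>s'. agree {a, ''k''} s s' \<Longrightarrow> aval base s' = b"
    and src: "\<And>s'. agree {a, ''k''} s s' \<Longrightarrow> s' ''k'' 0 < N \<Longrightarrow> aval src s' = f (s' ''k'' 0)"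
  shows "runs (Fill a base src) s (2 + N * 3)
    (\<lambda>s'. agree {a, ''k''} s s' \<and> s' a = (\<lambda>q. if b \<le> q \<and> q < b + N then f (q - b) else s a q))"
proof -
  define I where "I m s' \<longleftrightarrow> agree {a, ''k''} s s' \<and>
    s' a = (\<lambda>q. if b \<le> q \<and> q < b + m then f (q - b) else s a q)" for m s'
  have "runs (Fill a base src) s (2 + N * (1 + 2)) (I N)"
    unfolding Fill_def
  proof (rule runs_For)
    show "I 0 (s(''k'' := (s ''k'')(0 := 0)))"
      using assms(1) by (auto simp: I_def agree_def)
    fix m s' assume I: "I m s'"
    show "aval (Val ''N'') s' = N"
      using I assms(2,3) agreeD [of "{a, ''k''}" s s' "''N''"] by (auto simp: I_def)
    assume m: "m < N" "s' ''k'' 0 = m"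
    have ag: "agree {a, ''k''} s s'" using I by (simp add: I_def)
    have "aval (Plus base (Val ''k'')) s' = b + m" "aval src s' = f m"
      using base [OF ag] src [OF ag] m by simp_all
    moreover have "I (Suc m) ((s'(a := (s' a)(b + m := f m)))(''k'' := (s' ''k'')(0 := Suc m)))"
      using I assms(1) by (auto simp: I_def agree_def fun_eq_iff)
    ultimately show "runs (Write a (Plus base (Val ''k'')) src) s' 1
        (\<lambda>s'. s' ''k'' 0 = m \<and> I (Suc m) (s'(''k'' := (s' ''k'')(0 := Suc m))))"
      using m assms(1) by (intro runs_Write) simp_all
  qed
  then show ?thesis by (rule runs_mono) (auto simp: I_def)
qed

text \<open>Schoolbook multiplication on a machine without products: two nested tests form the
  product of bits, \<open>1 - c\<close> adds modulo 2. The operands are expressions in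
  \<open>i\<close> and \<open>j\<close>, so segments of the table or the seed are used in
  place.\<close>

definition Mul :: "aexp \<Rightarrow> aexp \<Rightarrow> com" where
  "Mul ea eb = Seq (Fill ''c'' (Const 0) (Const 0))
    (For ''i'' (Val ''N'') (For ''j'' (Val ''N'')
      (IfLess (Const 0) ea (IfLess (Const 0) eb
        (Seq (Put ''k'' (Plus (Val ''i'') (Val ''j'')))
          (Seq (IfLess (Val ''k'') (Val ''N'') Skip (Put ''k'' (Minus (Val ''k'') (Val ''N''))))
            (Write ''c'' (Val ''k'') (Minus (Const 1) (Read ''c'' (Val ''k''))))))
        Skip) Skip)))"

definition mul_time :: "nat \<Rightarrow> nat" where
  "mul_time N = 4 + 3 * N + N * (4 + N * 8)"

lemma runs_Mul:
  assumes N: "s ''N'' 0 = N"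
    and ea: "\<And>s'. agree {''i'', ''j'', ''k'', ''c''} s s' \<Longrightarrow> s' ''i'' 0 < N \<Longrightarrow> aval ea s' = fa (s' ''i'' 0)"
    and eb: "\<And>s'. agree {''i'', ''j'', ''k'', ''c''} s s' \<Longrightarrow> s' ''j'' 0 < N \<Longrightarrow> aval eb s' = fb (s' ''j'' 0)"
    and fa: "\<And>i. i < N \<Longrightarrow> fa i \<le> 1" and fb: "\<And>j. j < N \<Longrightarrow> fb j \<le> 1"
  shows "runs (Mul ea eb) s (mul_time N)
    (\<lambda>s'. agree {''i'', ''j'', ''k'', ''c''} s s' \<and> (\<forall>k<N. s' ''c'' k = cyc_mult N fa fb k))"
proof -
  let ?W = "{''i'', ''j'', ''k'', ''c''}"
  define t where "t i j k = (if (i + j) mod N = k then fa i * fb j else 0)" for i j k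
  define J where "J m l s' \<longleftrightarrow> agree ?W s s' \<and>
    (\<forall>k<N. s' ''c'' k = ((\<Sum>i<m. \<Sum>j<N. t i j k) + (\<Sum>j<l. t m j k)) mod 2)" for m l s'
  define I where "I m s' \<longleftrightarrow> agree ?W s s' \<and>
    (\<forall>k<N. s' ''c'' k = (\<Sum>i<m. \<Sum>j<N. t i j k) mod 2)" for m s'
  let ?toggle = "Seq (Put ''k'' (Plus (Val ''i'') (Val ''j'')))
    (Seq (IfLess (Val ''k'') (Val ''N'') Skip (Put ''k'' (Minus (Val ''k'') (Val ''N''))))
      (Write ''c'' (Val ''k'') (Minus (Const 1) (Read ''c'' (Val ''k'')))))"
  let ?body = "IfLess (Const 0) ea (IfLess (Const 0) eb ?toggle Skip) Skip"
  let ?P = "\<lambda>m l s''. s'' ''i'' 0 = m \<and> s'' ''j'' 0 = l \<and> J m (Suc l) (s''(''j'' := (s'' ''j'')(0 := Suc l)))"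
  have agN: "s' ''N'' 0 = N" if "agree ?W s s'" for s'
    using agreeD [OF that, of "''N''"] N by simp
  have body: "runs ?body s' 6 (?P m l)"
    if J: "J m l s'" and ml: "s' ''i'' 0 = m" "s' ''j'' 0 = l" "m < N" "l < N" for m l s'
  proof -
    have ag: "agree ?W s s'" using J by (simp add: J_def)
    have ea': "aval ea s' = fa m" and eb': "aval eb s' = fb l"
      using ea [OF ag] eb [OF ag] ml by simp_all
    have triv: "J m (Suc l) (s'(''j'' := (s' ''j'')(0 := Suc l)))" if "fa m * fb l = 0"
    proof -
      have "t m l k = 0" for k using that by (simp add: t_def)
      then show ?thesis using J by (auto simp: J_def agree_def)
    qed
    \<comment> \<open>Both indices are below \<open>N\<close>, so one conditional subtraction
      reduces their sum modulo \<open>N\<close>.\<close>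
    define k0 where "k0 = (m + l) mod N"
    have k0: "k0 < N" "k0 = (if m + l < N then m + l else m + l - N)"
      using ml by (simp_all add: k0_def mod_if)
    have flip: "J m (Suc l) ((s'(''k'' := (s' ''k'')(0 := k0), ''c'' := (s' ''c'')(k0 := 1 - s' ''c'' k0)))(''j'' := (s' ''j'')(0 := Suc l)))"
      if "fa m = 1" "fb l = 1"
    proof -
      have t: "t m l k = (if k = k0 then 1 else 0)" for k using that by (auto simp: t_def k0_def)
      define S where "S k = (\<Sum>i<m. \<Sum>j<N. t i j k) + (\<Sum>j<l. t m j k)" for k
      have c: "s' ''c'' k = S k mod 2" if "k < N" for k
        using J that by (simp add: J_def S_def)
      have flip2: "1 - a mod 2 = (a + 1) mod 2" for a :: nat by presburger
      have "((s' ''c'')(k0 := 1 - s' ''c'' k0)) k = ((\<Sum>i<m. \<Sum>j<N. t i j k) + (\<Sum>j<Suc l. t m j k)) mod 2"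
        if "k < N" for k
      proof -
        have "(\<Sum>i<m. \<Sum>j<N. t i j k) + (\<Sum>j<Suc l. t m j k) = S k + (if k = k0 then 1 else 0)"
          by (simp add: S_def t)
        then show ?thesis
          using c [OF that] c [OF k0(1)] by (cases "k = k0") (simp_all add: flip2 del: One_nat_def)
      qed
      moreover have "agree ?W s ((s'(''k'' := (s' ''k'')(0 := k0), ''c'' := (s' ''c'')(k0 := 1 - s' ''c'' k0)))(''j'' := (s' ''j'')(0 := Suc l)))"
        using J unfolding J_def by (intro agree_upd) auto
      ultimately show ?thesis
        unfolding J_def by simp
    qed
    show ?thesis
    proof (cases "fa m = 1 \<and> fb l = 1")
      case True
      have "runs ?body s' (1 + (1 + (1 + ((1 + 1) + 1)))) (?P m l)"
      proof (rule runs_If)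
        show "runs (IfLess (Const 0) eb ?toggle Skip) s' (1 + (1 + ((1 + 1) + 1))) (?P m l)"
        proof (rule runs_If)
          show "runs ?toggle s' (1 + ((1 + 1) + 1)) (?P m l)"
          proof (rule runs_Seq [where R="\<lambda>s1. s1 = s'(''k'' := (s' ''k'')(0 := m + l))"], goal_cases)
            case 1
            show ?case using ml by (intro runs_Write) simp_all
          next
            case (2 s1)
            show ?case
            proof (rule runs_Seq [where R="\<lambda>s2. s2 = s'(''k'' := (s' ''k'')(0 := k0))"], goal_cases)
              case 1
              show ?case
                using 2 agN [OF ag] k0 by (intro runs_If runs_Skip runs_Write) auto
            next
              case (2 s2)
              then show ?case
                using flip True ml by (intro runs_Write) (simp_all add: fun_upd_twist)
            qed
          qed
        qed (use True eb' in simp)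
      qed (use True ea' in simp)
      then show ?thesis by (rule runs_mono) simp_all
    next
      case False
      have "runs ?body s' (1 + (1 + 1)) (?P m l)"
      proof (cases "fa m = 0")
        case True
        then show ?thesis
          using ea' triv ml by (intro runs_If runs_Skip) auto
      next
        case f: False
        then have "fb l = 0" using False fa [OF ml(3)] fb [OF ml(4)] by auto
        then show ?thesis
          using eb' triv ml by (intro runs_If runs_Skip) auto
      qed
      then show ?thesis by (rule runs_mono) auto
    qed
  qed
  have inner: "runs (For ''j'' (Val ''N'') ?body) s' (2 + N * (6 + 2)) (\<lambda>s''. s'' ''i'' 0 = m \<and> I (Suc m) (s''(''i'' := (s'' ''i'')(0 := Suc m))))"
    if I: "I m s'" "s' ''i'' 0 = m" "m < N" for m s'
  proof -
    have "runs (For ''j'' (Val ''N'') ?body) s' (2 + N * (6 + 2)) (\<lambda>s''. s'' ''i'' 0 = m \<and> J m N s'')"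
    proof (rule runs_For)
      show "(s'(''j'' := (s' ''j'')(0 := 0))) ''i'' 0 = m \<and> J m 0 (s'(''j'' := (s' ''j'')(0 := 0)))"
        using I by (auto simp: I_def J_def agree_def)
      fix l s1 assume J: "s1 ''i'' 0 = m \<and> J m l s1"
      then show "aval (Val ''N'') s1 = N" using agN by (simp add: J_def)
      assume "l < N" "s1 ''j'' 0 = l"
      with J I(3) show "runs ?body s1 6 (\<lambda>s'. s' ''j'' 0 = l \<and> (s'(''j'' := (s' ''j'')(0 := Suc l))) ''i'' 0 = m \<and>
          J m (Suc l) (s'(''j'' := (s' ''j'')(0 := Suc l))))"
        by (intro runs_mono [OF body [of m l]]) auto
    qed
    then show ?thesis
      by (rule runs_mono) (auto simp: I_def J_def agree_def)
  qed
  have "runs (Mul ea eb) s ((2 + N * 3) + (2 + N * ((2 + N * (6 + 2)) + 2))) (I N)"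
    unfolding Mul_def
  proof (rule runs_Seq)
    show "runs (Fill ''c'' (Const 0) (Const 0)) s (2 + N * 3)
      (\<lambda>s'. agree {''c'', ''k''} s s' \<and> s' ''c'' = (\<lambda>q. if 0 \<le> q \<and> q < 0 + N then 0 else s ''c'' q))"
      using N by (intro runs_Fill [where f="\<lambda>_. 0"]) auto
    fix s1 assume s1: "agree {''c'', ''k''} s s1 \<and> s1 ''c'' = (\<lambda>q. if 0 \<le> q \<and> q < 0 + N then 0 else s ''c'' q)"
    show "runs (For ''i'' (Val ''N'') (For ''j'' (Val ''N'') ?body)) s1 (2 + N * ((2 + N * (6 + 2)) + 2)) (I N)"
    proof (rule runs_For)
      show "I 0 (s1(''i'' := (s1 ''i'')(0 := 0)))"
        using s1 by (auto simp: I_def agree_def)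
      fix m s' assume I: "I m s'"
      then show "aval (Val ''N'') s' = N" using agN by (simp add: I_def)
      assume "m < N" "s' ''i'' 0 = m"
      with I show "runs (For ''j'' (Val ''N'') ?body) s' (2 + N * (6 + 2)) (\<lambda>s''. s'' ''i'' 0 = m \<and> I (Suc m) (s''(''i'' := (s'' ''i'')(0 := Suc m))))"
        by (intro inner)
    qed
  qed
  then show ?thesis
    by (rule runs_mono) (auto simp: mul_time_def I_def cyc_mult_def t_def algebra_simps)
qed

section \<open>Computing the generator\<close>

lemma mod_2_le: "a mod 2 \<le> Suc 0"
  by presburger

lemma cyc_mult_le [simp]: "cyc_mult N a b k \<le> Suc 0"
  unfolding cyc_mult_def by (rule mod_2_le)

lemma node_vec_le [simp]: "node_vec N x i k \<le> Suc 0"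
  by (subst node_vec.simps) (simp only: mod_2_le split: if_split, simp)

lemma geom_le [simp]: "geom N g m k \<le> Suc 0"
  by (cases m) (simp_all only: geom.simps mod_2_le zero_le)

text \<open>The recurrence also holds at index 0, where \<open>0 div 2 = 0\<close> and the node is
  zero. The program can thus treat all indices alike.\<close>

lemma node_vec_rec:
  "node_vec N x i k = (cyc_mult N (node_vec N x (i div 2)) x k + (if k = 0 then i mod 2 else 0)) mod 2"
proof (cases "i = 0")
  case True
  have "node_vec N x 0 = (\<lambda>_. 0)" by (rule ext) (simp add: node_vec.simps)
  with True show ?thesis by (simp add: cyc_mult_def cong: if_cong)
next
  case False
  then show ?thesis by (subst node_vec.simps) simp
qed

text \<open>The pointers \<open>p\<close> and \<open>h\<close> to the rows of the index and of its
  half, and the parity \<open>b\<close>, are kept up to date by additions, in place of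
  multiplication and division.\<close>

definition Node :: com where
  "Node = Seq (Mul (Read ''T'' (Plus (Val ''h'') (Val ''i''))) (Read ''seed'' (Val ''j'')))
    (Seq (Fill ''T'' (Val ''p'') (Read ''c'' (Val ''k'')))
      (IfLess (Const 0) (Val ''b'') (Write ''T'' (Val ''p'') (Minus (Const 1) (Read ''T'' (Val ''p'')))) Skip))"

lemma runs_Node:
  assumes N: "s ''N'' 0 = N" "1 \<le> N" and ptr: "s ''p'' 0 = m * N" "s ''h'' 0 = m div 2 * N" "s ''b'' 0 = m mod 2"
    and T: "\<And>k. k < N \<Longrightarrow> s ''T'' (m div 2 * N + k) = node_vec N x (m div 2) k"
    and x: "\<And>k. k < N \<Longrightarrow> s ''seed'' k = x k" "\<And>k. k < N \<Longrightarrow> x k \<le> 1"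
  shows "runs Node s (mul_time N + ((2 + N * 3) + (1 + 1)))
    (\<lambda>s'. agree {''i'', ''j'', ''k'', ''c'', ''T''} s s' \<and>
      (\<forall>k<N. s' ''T'' (m * N + k) = node_vec N x m k) \<and> (\<forall>q<m * N. s' ''T'' q = s ''T'' q))"
  unfolding Node_def
proof (rule runs_Seq)
  show "runs (Mul (Read ''T'' (Plus (Val ''h'') (Val ''i''))) (Read ''seed'' (Val ''j''))) s (mul_time N)
    (\<lambda>s'. agree {''i'', ''j'', ''k'', ''c''} s s' \<and> (\<forall>k<N. s' ''c'' k = cyc_mult N (node_vec N x (m div 2)) x k))"
    using assms by (intro runs_Mul) (auto simp: agree_def)
  fix s1 assume s1: "agree {''i'', ''j'', ''k'', ''c''} s s1 \<and> (\<forall>k<N. s1 ''c'' k = cyc_mult N (node_vec N x (m div 2)) x k)"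
  have same: "s1 ''N'' 0 = N" "s1 ''p'' 0 = m * N" "s1 ''b'' 0 = m mod 2" "s1 ''T'' = s ''T''"
    using s1 N ptr by (auto simp: agree_def)
  show "runs (Seq (Fill ''T'' (Val ''p'') (Read ''c'' (Val ''k'')))
      (IfLess (Const 0) (Val ''b'') (Write ''T'' (Val ''p'') (Minus (Const 1) (Read ''T'' (Val ''p'')))) Skip)) s1 ((2 + N * 3) + (1 + 1))
    (\<lambda>s'. agree {''i'', ''j'', ''k'', ''c'', ''T''} s s' \<and>
      (\<forall>k<N. s' ''T'' (m * N + k) = node_vec N x m k) \<and> (\<forall>q<m * N. s' ''T'' q = s ''T'' q))"
  proof (rule runs_Seq)
    show "runs (Fill ''T'' (Val ''p'') (Read ''c'' (Val ''k''))) s1 (2 + N * 3)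
      (\<lambda>s'. agree {''T'', ''k''} s1 s' \<and>
        s' ''T'' = (\<lambda>q. if m * N \<le> q \<and> q < m * N + N then s1 ''c'' (q - m * N) else s1 ''T'' q))"
      using same by (intro runs_Fill) (auto simp: agree_def)
    fix s2 assume s2: "agree {''T'', ''k''} s1 s2 \<and>
        s2 ''T'' = (\<lambda>q. if m * N \<le> q \<and> q < m * N + N then s1 ''c'' (q - m * N) else s1 ''T'' q)"
    have ag: "agree {''i'', ''j'', ''k'', ''c'', ''T''} s s2"
      using s1 s2 by (auto simp: agree_def)
    have same2: "s2 ''p'' 0 = m * N" "s2 ''b'' 0 = m mod 2" using s2 same by (auto simp: agree_def)
    have T2: "s2 ''T'' (m * N + k) = cyc_mult N (node_vec N x (m div 2)) x k" if "k < N" for k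
      using s1 s2 that by simp
    have T2': "s2 ''T'' q = s ''T'' q" if "q < m * N" for q
      using s2 same(4) that by simp
    have flip: "1 - a = (a + 1) mod 2" if "a \<le> Suc 0" for a :: nat using that by presburger
    show "runs (IfLess (Const 0) (Val ''b'') (Write ''T'' (Val ''p'') (Minus (Const 1) (Read ''T'' (Val ''p'')))) Skip) s2 (1 + 1)
      (\<lambda>s'. agree {''i'', ''j'', ''k'', ''c'', ''T''} s s' \<and>
        (\<forall>k<N. s' ''T'' (m * N + k) = node_vec N x m k) \<and> (\<forall>q<m * N. s' ''T'' q = s ''T'' q))"
    proof (cases "m mod 2 = 0")
      case True
      have "cyc_mult N (node_vec N x (m div 2)) x k mod 2 = cyc_mult N (node_vec N x (m div 2)) x k" for k
        by (simp add: cyc_mult_def)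
      then have "s2 ''T'' (m * N + k) = node_vec N x m k" if "k < N" for k
        using T2 [OF that] True by (subst node_vec_rec) simp
      then show ?thesis
        using True same2 ag T2' by (intro runs_If runs_Skip) simp_all
    next
      case False
      define s3 where "s3 = s2(''T'' := (s2 ''T'')(m * N := 1 - s2 ''T'' (m * N)))"
      have m1: "m mod 2 = 1" using False by simp
      have "s3 ''T'' (m * N + k) = node_vec N x m k" if "k < N" for k
      proof (cases "k = 0")
        case True
        have "s3 ''T'' (m * N + 0) = 1 - cyc_mult N (node_vec N x (m div 2)) x 0"
          using T2 [of 0] N(2) by (simp add: s3_def)
        also have "\<dots> = node_vec N x m 0"
          by (subst node_vec_rec) (simp only: flip [OF cyc_mult_le] m1 refl if_True)
        finally show ?thesis using True by simp
      next
        case False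
        have "cyc_mult N (node_vec N x (m div 2)) x k mod 2 = cyc_mult N (node_vec N x (m div 2)) x k"
          by (simp add: cyc_mult_def)
        then show ?thesis
          using False T2 [OF that] by (subst node_vec_rec) (simp add: s3_def)
      qed
      moreover have "agree {''i'', ''j'', ''k'', ''c'', ''T''} s s3"
        unfolding s3_def by (rule agree_upd [OF ag]) simp
      moreover have "s3 ''T'' q = s ''T'' q" if "q < m * N" for q
        using T2' [OF that] that by (simp add: s3_def)
      ultimately show ?thesis
        using m1 same2 by (intro runs_If runs_Write) (simp_all add: s3_def)
    qed
  qed
qed

definition Geom :: com where
  "Geom = For ''m'' (Val ''N'') (Seq (Mul (Read ''e'' (Val ''i'')) (Read ''g'' (Val ''j'')))
    (Seq (Fill ''e'' (Const 0) (Read ''c'' (Val ''k'')))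
      (Write ''e'' (Const 0) (Minus (Const 1) (Read ''e'' (Const 0))))))"

lemma runs_Geom:
  assumes N: "s ''N'' 0 = N" "1 \<le> N" and g: "\<And>k. k < N \<Longrightarrow> s ''g'' k = g k" "\<And>k. k < N \<Longrightarrow> g k \<le> 1"
    and e: "\<And>k. k < N \<Longrightarrow> s ''e'' k = 0"
  shows "runs Geom s (2 + N * (mul_time N + ((2 + N * 3) + 1) + 2))
    (\<lambda>s'. agree {''m'', ''i'', ''j'', ''k'', ''c'', ''e''} s s' \<and> (\<forall>k<N. s' ''e'' k = geom N g N k))"
  unfolding Geom_def
proof (rule runs_For [where I="\<lambda>m s'. agree {''m'', ''i'', ''j'', ''k'', ''c'', ''e''} s s' \<and> (\<forall>k<N. s' ''e'' k = geom N g m k)"])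
  let ?I = "\<lambda>m s'. agree {''m'', ''i'', ''j'', ''k'', ''c'', ''e''} s s' \<and> (\<forall>k<N. s' ''e'' k = geom N g m k)"
  show "?I 0 (s(''m'' := (s ''m'')(0 := 0)))"
    using e by (auto simp: agree_def)
  fix m s' assume I: "?I m s'"
  then have same: "s' ''N'' 0 = N" "s' ''g'' = s ''g''" using N by (auto simp: agree_def)
  then show "aval (Val ''N'') s' = N" by simp
  assume m: "m < N" "s' ''m'' 0 = m"
  show "runs (Seq (Mul (Read ''e'' (Val ''i'')) (Read ''g'' (Val ''j'')))
    (Seq (Fill ''e'' (Const 0) (Read ''c'' (Val ''k'')))
      (Write ''e'' (Const 0) (Minus (Const 1) (Read ''e'' (Const 0)))))) s' (mul_time N + ((2 + N * 3) + 1))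
    (\<lambda>s'. s' ''m'' 0 = m \<and> ?I (Suc m) (s'(''m'' := (s' ''m'')(0 := Suc m))))"
  proof (rule runs_Seq)
    show "runs (Mul (Read ''e'' (Val ''i'')) (Read ''g'' (Val ''j''))) s' (mul_time N)
      (\<lambda>s''. agree {''i'', ''j'', ''k'', ''c''} s' s'' \<and> (\<forall>k<N. s'' ''c'' k = cyc_mult N (geom N g m) g k))"
      using same I g by (intro runs_Mul) (auto simp: agree_def)
    fix s1 assume s1: "agree {''i'', ''j'', ''k'', ''c''} s' s1 \<and> (\<forall>k<N. s1 ''c'' k = cyc_mult N (geom N g m) g k)"
    show "runs (Seq (Fill ''e'' (Const 0) (Read ''c'' (Val ''k'')))
      (Write ''e'' (Const 0) (Minus (Const 1) (Read ''e'' (Const 0))))) s1 ((2 + N * 3) + 1)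
      (\<lambda>s'. s' ''m'' 0 = m \<and> ?I (Suc m) (s'(''m'' := (s' ''m'')(0 := Suc m))))"
    proof (rule runs_Seq)
      show "runs (Fill ''e'' (Const 0) (Read ''c'' (Val ''k''))) s1 (2 + N * 3)
        (\<lambda>s''. agree {''e'', ''k''} s1 s'' \<and> s'' ''e'' = (\<lambda>q. if 0 \<le> q \<and> q < 0 + N then s1 ''c'' (q - 0) else s1 ''e'' q))"
        using s1 same by (intro runs_Fill) (auto simp: agree_def)
      fix s2 assume s2: "agree {''e'', ''k''} s1 s2 \<and> s2 ''e'' = (\<lambda>q. if 0 \<le> q \<and> q < 0 + N then s1 ''c'' (q - 0) else s1 ''e'' q)"
      define s3 where "s3 = s2(''e'' := (s2 ''e'')(0 := 1 - s2 ''e'' 0))"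
      have e2: "s2 ''e'' k = cyc_mult N (geom N g m) g k" if "k < N" for k using s1 s2 that by simp
      have flip: "1 - a = (a + 1) mod 2" if "a \<le> Suc 0" for a :: nat using that by presburger
      have "s3 ''e'' k = geom N g (Suc m) k" if "k < N" for k
      proof (cases "k = 0")
        case True
        have "s3 ''e'' 0 = 1 - cyc_mult N (geom N g m) g 0"
          using e2 [of 0] N(2) by (simp add: s3_def)
        also have "\<dots> = geom N g (Suc m) 0"
          by (simp only: flip [OF cyc_mult_le] geom.simps refl if_True)
        finally show ?thesis using True by simp
      next
        case False
        have "cyc_mult N (geom N g m) g k mod 2 = cyc_mult N (geom N g m) g k" by (simp add: cyc_mult_def)
        then show ?thesis using False e2 [OF that] by (simp add: s3_def)
      qed
      moreover have "agree {''m'', ''i'', ''j'', ''k'', ''c'', ''e''} s s3" "s3 ''m'' 0 = m"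
        using I s1 s2 m by (auto simp: agree_def s3_def)
      ultimately show "runs (Write ''e'' (Const 0) (Minus (Const 1) (Read ''e'' (Const 0)))) s2 1
          (\<lambda>s'. s' ''m'' 0 = m \<and> ?I (Suc m) (s'(''m'' := (s' ''m'')(0 := Suc m))))"
        by (intro runs_Write) (auto simp: s3_def agree_def simp del: geom.simps)
    qed
  qed
qed

definition Dot :: com where
  "Dot = Seq (Put ''o'' (Const 0)) (For ''k'' (Val ''N'')
    (IfLess (Const 0) (Read ''seed'' (Plus (Plus (Val ''N'') (Val ''N'')) (Val ''k'')))
      (IfLess (Const 0) (Read ''e'' (Val ''k'')) (Put ''o'' (Minus (Const 1) (Val ''o''))) Skip) Skip))"

lemma runs_Dot:
  assumes N: "s ''N'' 0 = N" and u: "\<And>k. k < N \<Longrightarrow> s ''seed'' (N + N + k) = u k" "\<And>k. k < N \<Longrightarrow> u k \<le> 1"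
    and e: "\<And>k. k < N \<Longrightarrow> s ''e'' k = e k" "\<And>k. k < N \<Longrightarrow> e k \<le> 1"
  shows "runs Dot s (1 + (2 + N * (3 + 2)))
    (\<lambda>s'. agree {''k'', ''o''} s s' \<and> s' ''o'' 0 = (\<Sum>k<N. u k * e k) mod 2)"
  unfolding Dot_def
proof (rule runs_Seq)
  let ?I = "\<lambda>m s'. agree {''k'', ''o''} s s' \<and> s' ''o'' 0 = (\<Sum>k<m. u k * e k) mod 2"
  show "runs (Put ''o'' (Const 0)) s 1 (?I 0)"
    by (intro runs_Write) (auto simp: agree_def)
  fix s1 assume s1: "?I 0 s1"
  let ?body = "IfLess (Const 0) (Read ''seed'' (Plus (Plus (Val ''N'') (Val ''N'')) (Val ''k'')))
      (IfLess (Const 0) (Read ''e'' (Val ''k'')) (Put ''o'' (Minus (Const 1) (Val ''o''))) Skip) Skip"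
  show "runs (For ''k'' (Val ''N'') ?body) s1 (2 + N * (3 + 2)) (?I N)"
  proof (rule runs_For [where I="?I"])
    show "?I 0 (s1(''k'' := (s1 ''k'')(0 := 0)))" using s1 by (auto simp: agree_def)
    fix m s' assume I: "?I m s'"
    then have same: "s' ''N'' 0 = N" "s' ''seed'' = s ''seed''" "s' ''e'' = s ''e''" using N by (auto simp: agree_def)
    then show "aval (Val ''N'') s' = N" by simp
    assume m: "m < N" "s' ''k'' 0 = m"
    have flip: "1 - a mod 2 = (a + 1) mod 2" for a :: nat by presburger
    have triv: "?I (Suc m) (s'(''k'' := (s' ''k'')(0 := Suc m)))" if "u m * e m = 0"
    proof
      show "agree {''k'', ''o''} s (s'(''k'' := (s' ''k'')(0 := Suc m)))"
        using I by (intro agree_upd) auto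
      show "(s'(''k'' := (s' ''k'')(0 := Suc m))) ''o'' 0 = (\<Sum>k<Suc m. u k * e k) mod 2"
      proof -
        have "(\<Sum>k<Suc m. u k * e k) = (\<Sum>k<m. u k * e k)" unfolding sum.lessThan_Suc that by simp
        then show ?thesis using I by (simp del: sum.lessThan_Suc)
      qed
    qed
    have one: "?I (Suc m) ((s'(''o'' := (s' ''o'')(0 := 1 - s' ''o'' 0)))(''k'' := (s' ''k'')(0 := Suc m)))"
      if "u m = 1" "e m = 1"
    proof
      show "agree {''k'', ''o''} s ((s'(''o'' := (s' ''o'')(0 := 1 - s' ''o'' 0)))(''k'' := (s' ''k'')(0 := Suc m)))"
        using I by (intro agree_upd) auto
      show "((s'(''o'' := (s' ''o'')(0 := 1 - s' ''o'' 0)))(''k'' := (s' ''k'')(0 := Suc m))) ''o'' 0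
          = (\<Sum>k<Suc m. u k * e k) mod 2"
        using I that flip [of "\<Sum>k<m. u k * e k"] by simp
    qed
    have vals: "aval (Read ''seed'' (Plus (Plus (Val ''N'') (Val ''N'')) (Val ''k''))) s' = u m"
      "aval (Read ''e'' (Val ''k'')) s' = e m"
      using same m u(1) e(1) by simp_all
    show "runs ?body s' 3 (\<lambda>s'. s' ''k'' 0 = m \<and> ?I (Suc m) (s'(''k'' := (s' ''k'')(0 := Suc m))))"
    proof (cases "u m = 1 \<and> e m = 1")
      case True
      have "runs ?body s' (1 + (1 + 1)) (\<lambda>s'. s' ''k'' 0 = m \<and> ?I (Suc m) (s'(''k'' := (s' ''k'')(0 := Suc m))))"
      proof (intro runs_If runs_Write)
        show "(s'(''o'' := (s' ''o'')(aval (Const 0) s' := aval (Minus (Const 1) (Val ''o'')) s'))) ''k'' 0 = m \<and>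
          ?I (Suc m) ((s'(''o'' := (s' ''o'')(aval (Const 0) s' := aval (Minus (Const 1) (Val ''o'')) s')))
            (''k'' := ((s'(''o'' := (s' ''o'')(aval (Const 0) s' := aval (Minus (Const 1) (Val ''o'')) s'))) ''k'')(0 := Suc m)))"
        proof -
          have k: "(s'(''o'' := f)) ''k'' = s' ''k''" for f by simp
          show ?thesis unfolding aval.simps k using one True m(2) by blast
        qed
      qed (use vals True in auto)
      then show ?thesis by (rule runs_mono) simp_all
    next
      case False
      then have "u m = 0 \<or> e m = 0" using u(2) [OF m(1)] e(2) [OF m(1)] by linarith
      then have *: "s' ''k'' 0 = m \<and> ?I (Suc m) (s'(''k'' := (s' ''k'')(0 := Suc m)))" using triv m by auto
      have "runs ?body s' (1 + (1 + 1)) (\<lambda>s'. s' ''k'' 0 = m \<and> ?I (Suc m) (s'(''k'' := (s' ''k'')(0 := Suc m))))"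
      proof (cases "u m = 0")
        case True
        then show ?thesis using vals * by (intro runs_If [of _ _ _ _ "1 + 1"] runs_Skip) simp_all
      next
        case False
        with \<open>u m = 0 \<or> e m = 0\<close> have "e m = 0" by simp
        then show ?thesis using vals * by (intro runs_If runs_Skip) simp_all
      qed
      then show ?thesis by (rule runs_mono) simp_all
    qed
  qed
qed

definition Body :: com where
  "Body = Seq Node (Seq (Mul (Read ''T'' (Plus (Val ''p'') (Val ''i''))) (Read ''seed'' (Plus (Val ''N'') (Val ''j''))))
    (Seq (Fill ''g'' (Const 0) (Read ''c'' (Val ''k''))) (Seq (Fill ''e'' (Const 0) (Const 0)) (Seq Geom (Seq Dot
    (Seq (Write ''out'' (Val ''r'') (Val ''o'')) (Seq (Put ''p'' (Plus (Val ''p'') (Val ''N'')))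
    (IfLess (Const 0) (Val ''b'') (Seq (Put ''b'' (Const 0)) (Put ''h'' (Plus (Val ''h'') (Val ''N'')))) (Put ''b'' (Const 1))))))))))"

text \<open>Bracketed like the nested sequence in \<open>Body\<close>, so that the sequence rule
  matches without arithmetic.\<close>

definition body_time :: "nat \<Rightarrow> nat" where
  "body_time N = (mul_time N + ((2 + N * 3) + (1 + 1))) + (mul_time N + ((2 + N * 3) + ((2 + N * 3) +
    ((2 + N * (mul_time N + ((2 + N * 3) + 1) + 2)) + ((1 + (2 + N * (3 + 2))) + (1 + (1 + (1 + (1 + 1)))))))))"

text \<open>The case \<open>q = 0\<close> is for the first round, which reads row 0 before writing
  it; the initial memory is zero, as is that node.\<close>

definition loop_inv :: "nat \<Rightarrow> (nat \<Rightarrow> nat) \<Rightarrow> nat \<Rightarrow> nat \<Rightarrow> store \<Rightarrow> bool" where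
  "loop_inv N sd n m s \<longleftrightarrow> s ''N'' 0 = N \<and> s ''n'' 0 = n \<and> s ''seed'' = sd \<and> s ''p'' 0 = m * N \<and>
    s ''h'' 0 = m div 2 * N \<and> s ''b'' 0 = m mod 2 \<and>
    (\<forall>q k. q < m \<or> q = 0 \<longrightarrow> k < N \<longrightarrow> s ''T'' (q * N + k) = node_vec N sd q k) \<and>
    (\<forall>q<m. s ''out'' q = seed_bit N sd (\<lambda>k. sd (N + k)) (\<lambda>k. sd (N + N + k)) q)"

lemma runs_Body:
  assumes "1 \<le> N" and sd: "\<And>k. sd k \<le> 1" and I: "loop_inv N sd n m s" and r: "s ''r'' 0 = m"
  shows "runs Body s (body_time N) (\<lambda>s'. s' ''r'' 0 = m \<and> loop_inv N sd n (Suc m) (s'(''r'' := (s' ''r'')(0 := Suc m))))"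
proof -
  define x where "x = sd"
  define z where "z k = sd (N + k)" for k
  define u where "u k = sd (N + N + k)" for k
  have le: "x k \<le> 1" "z k \<le> 1" "u k \<le> 1" for k using sd by (simp_all add: x_def z_def u_def)
  have s: "s ''N'' 0 = N" "s ''n'' 0 = n" "s ''seed'' = sd" "s ''p'' 0 = m * N"
    "s ''h'' 0 = m div 2 * N" "s ''b'' 0 = m mod 2"
    "\<And>q k. q < m \<or> q = 0 \<Longrightarrow> k < N \<Longrightarrow> s ''T'' (q * N + k) = node_vec N x q k"
    "\<And>q. q < m \<Longrightarrow> s ''out'' q = seed_bit N x z u q"
    using I unfolding loop_inv_def x_def z_def [abs_def] u_def [abs_def] by blast+
  have half: "m div 2 < m \<or> m div 2 = 0" by auto
  let ?Q = "\<lambda>s'. s' ''r'' 0 = m \<and> loop_inv N sd n (Suc m) (s'(''r'' := (s' ''r'')(0 := Suc m)))"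
  define R1 where "R1 s' \<longleftrightarrow> agree {''i'', ''j'', ''k'', ''c'', ''T''} s s' \<and>
      (\<forall>k<N. s' ''T'' (m * N + k) = node_vec N x m k) \<and> (\<forall>q<m * N. s' ''T'' q = s ''T'' q)" for s'
  have 1: "runs Node s (mul_time N + ((2 + N * 3) + (1 + 1))) R1"
    unfolding R1_def using s half le assms(1) by (intro runs_Node) (auto simp: x_def)
  have 2: "runs (Mul (Read ''T'' (Plus (Val ''p'') (Val ''i''))) (Read ''seed'' (Plus (Val ''N'') (Val ''j'')))) s1 (mul_time N)
      (\<lambda>s'. agree {''i'', ''j'', ''k'', ''c''} s1 s' \<and> (\<forall>k<N. s' ''c'' k = cyc_mult N (node_vec N x m) z k))"
    if "R1 s1" for s1
  proof -
    have frame: "s1 a = s a" if "a \<notin> {''i'', ''j'', ''k'', ''c'', ''T''}" for a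
    proof -
      have "agree {''i'', ''j'', ''k'', ''c'', ''T''} s s1" using \<open>R1 s1\<close> by (simp add: R1_def)
      then show ?thesis by (rule agreeD) (rule that)
    qed
    have "s1 ''N'' 0 = N" "s1 ''p'' 0 = m * N" "s1 ''seed'' = sd"
      using s by (simp_all add: frame)
    moreover have "\<forall>k<N. s1 ''T'' (m * N + k) = node_vec N x m k" using that by (simp add: R1_def)
    ultimately show ?thesis
      using le by (intro runs_Mul) (auto simp: agree_def z_def)
  qed
  define R2 where "R2 s' \<longleftrightarrow> agree {''i'', ''j'', ''k'', ''c'', ''T'', ''g'', ''e'', ''m'', ''o''} s s' \<and>
      (\<forall>k<N. s' ''T'' (m * N + k) = node_vec N x m k) \<and> (\<forall>q<m * N. s' ''T'' q = s ''T'' q)" for s'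
  have frame2: "s' a = s a" if "R2 s'" "a \<notin> {''i'', ''j'', ''k'', ''c'', ''T'', ''g'', ''e'', ''m'', ''o''}" for s' a
  proof -
    have "agree {''i'', ''j'', ''k'', ''c'', ''T'', ''g'', ''e'', ''m'', ''o''} s s'" using that(1) by (simp add: R2_def)
    then show ?thesis by (rule agreeD) (rule that(2))
  qed
  have 3: "runs (Fill ''g'' (Const 0) (Read ''c'' (Val ''k''))) s2 (2 + N * 3)
      (\<lambda>s'. R2 s' \<and> (\<forall>k<N. s' ''g'' k = cyc_mult N (node_vec N x m) z k))"
    if "R1 s1" "agree {''i'', ''j'', ''k'', ''c''} s1 s2 \<and> (\<forall>k<N. s2 ''c'' k = cyc_mult N (node_vec N x m) z k)" for s1 s2
  proof -
    have "runs (Fill ''g'' (Const 0) (Read ''c'' (Val ''k''))) s2 (2 + N * 3)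
      (\<lambda>s'. agree {''g'', ''k''} s2 s' \<and> s' ''g'' = (\<lambda>q. if 0 \<le> q \<and> q < 0 + N then s2 ''c'' (q - 0) else s2 ''g'' q))"
      using that s by (intro runs_Fill) (auto simp: R1_def agree_def)
    then show ?thesis
      by (rule runs_mono) (use that in \<open>auto simp: R1_def R2_def agree_def\<close>)
  qed
  have 4: "runs (Fill ''e'' (Const 0) (Const 0)) s3 (2 + N * 3)
      (\<lambda>s'. R2 s' \<and> (\<forall>k<N. s' ''g'' k = cyc_mult N (node_vec N x m) z k) \<and> (\<forall>k<N. s' ''e'' k = 0))"
    if "R2 s3 \<and> (\<forall>k<N. s3 ''g'' k = cyc_mult N (node_vec N x m) z k)" for s3
  proof -
    have "runs (Fill ''e'' (Const 0) (Const 0)) s3 (2 + N * 3)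
      (\<lambda>s'. agree {''e'', ''k''} s3 s' \<and> s' ''e'' = (\<lambda>q. if 0 \<le> q \<and> q < 0 + N then (\<lambda>_. 0) (q - 0) else s3 ''e'' q))"
      using that s by (intro runs_Fill) (auto simp: R2_def agree_def)
    then show ?thesis
      by (rule runs_mono) (use that in \<open>auto simp: R2_def agree_def\<close>)
  qed
  have 5: "runs Geom s4 (2 + N * (mul_time N + ((2 + N * 3) + 1) + 2)) (\<lambda>s'. R2 s' \<and> (\<forall>k<N. s' ''e'' k = node_row N x z m k))"
    if "R2 s4 \<and> (\<forall>k<N. s4 ''g'' k = cyc_mult N (node_vec N x m) z k) \<and> (\<forall>k<N. s4 ''e'' k = 0)" for s4
  proof -
    have "runs Geom s4 (2 + N * (mul_time N + ((2 + N * 3) + 1) + 2))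
      (\<lambda>s'. agree {''m'', ''i'', ''j'', ''k'', ''c'', ''e''} s4 s' \<and> (\<forall>k<N. s' ''e'' k = geom N (cyc_mult N (node_vec N x m) z) N k))"
    proof (rule runs_Geom [OF _ assms(1)])
      show "s4 ''N'' 0 = N" using that s(1) frame2 [of s4 "''N''"] by simp
    qed (use that in simp_all)
    then show ?thesis
      by (rule runs_mono) (use that in \<open>auto simp: R2_def agree_def node_row_def\<close>)
  qed
  have 6: "runs Dot s5 (1 + (2 + N * (3 + 2))) (\<lambda>s'. R2 s' \<and> s' ''o'' 0 = seed_bit N x z u m)"
    if "R2 s5 \<and> (\<forall>k<N. s5 ''e'' k = node_row N x z m k)" for s5
  proof -
    have "runs Dot s5 (1 + (2 + N * (3 + 2)))
      (\<lambda>s'. agree {''k'', ''o''} s5 s' \<and> s' ''o'' 0 = (\<Sum>k<N. u k * node_row N x z m k) mod 2)"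
    proof (rule runs_Dot)
      have "s5 ''N'' 0 = N" "s5 ''seed'' = sd" using that s frame2 [of s5 "''N''"] frame2 [of s5 "''seed''"] by simp_all
      then show "s5 ''N'' 0 = N" "\<And>k. s5 ''seed'' (N + N + k) = u k" by (simp_all add: u_def)
    qed (use that le in \<open>simp_all add: node_row_def\<close>)
    then show ?thesis
      by (rule runs_mono) (use that in \<open>auto simp: R2_def agree_def seed_bit_def\<close>)
  qed
  have 7: "?Q (s6(''out'' := (s6 ''out'')(m := seed_bit N x z u m), ''p'' := (s6 ''p'')(0 := Suc m * N),
      ''b'' := (s6 ''b'')(0 := Suc m mod 2), ''h'' := (s6 ''h'')(0 := Suc m div 2 * N)))"
    if "R2 s6" for s6
  proof -
    have same: "s6 ''r'' 0 = m" "s6 ''N'' 0 = N" "s6 ''n'' 0 = n" "s6 ''seed'' = sd" "s6 ''out'' = s ''out''"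
      using that s r by (auto simp: R2_def agree_def)
    have T: "s6 ''T'' (q * N + k) = node_vec N x q k" if q: "q < Suc m \<or> q = 0" "k < N" for q k
    proof (cases "q = m")
      case True
      then show ?thesis using \<open>R2 s6\<close> q by (simp add: R2_def)
    next
      case False
      then have "q < m" using q by auto
      then have "Suc q * N \<le> m * N" by (intro mult_right_mono) auto
      then have "q * N + k < m * N" using q(2) by simp
      then show ?thesis using \<open>R2 s6\<close> s(7) [of q k] \<open>q < m\<close> q(2) by (simp add: R2_def)
    qed
    have "\<forall>q<Suc m. ((s6 ''out'')(m := seed_bit N x z u m)) q = seed_bit N x z u q"
      using s(8) same(5) by (auto simp: less_Suc_eq)
    then show ?thesis
      using same T by (simp add: loop_inv_def x_def z_def [abs_def] u_def [abs_def])
  qed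
  have 8: "runs (Seq (Write ''out'' (Val ''r'') (Val ''o'')) (Seq (Put ''p'' (Plus (Val ''p'') (Val ''N'')))
    (IfLess (Const 0) (Val ''b'') (Seq (Put ''b'' (Const 0)) (Put ''h'' (Plus (Val ''h'') (Val ''N'')))) (Put ''b'' (Const 1))))) s6
      (1 + (1 + (1 + (1 + 1)))) ?Q"
    if R2: "R2 s6 \<and> s6 ''o'' 0 = seed_bit N x z u m" for s6
  proof -
    have same: "s6 ''r'' 0 = m" "s6 ''N'' 0 = N" "s6 ''p'' 0 = m * N" "s6 ''b'' 0 = m mod 2" "s6 ''h'' 0 = m div 2 * N"
      using R2 s r by (auto simp: R2_def agree_def)
    define s7 where "s7 = s6(''out'' := (s6 ''out'')(m := seed_bit N x z u m))"
    define s8 where "s8 = s7(''p'' := (s7 ''p'')(0 := Suc m * N))"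
    have s8: "s8 ''b'' 0 = m mod 2" "s8 ''h'' 0 = m div 2 * N" "s8 ''N'' 0 = N"
      using same by (simp_all add: s8_def s7_def)
    have final: "?Q (s8(''b'' := (s8 ''b'')(0 := Suc m mod 2), ''h'' := (s8 ''h'')(0 := Suc m div 2 * N)))"
      using 7 [of s6] R2 by (simp add: s8_def s7_def)
    show ?thesis
    proof (rule runs_Seq [where R="\<lambda>s'. s' = s7"], goal_cases)
      case 1
      show ?case using R2 same by (intro runs_Write) (simp_all add: s7_def)
    next
      case (2 s')
      show ?case
      proof (rule runs_Seq [where R="\<lambda>s'. s' = s8"], goal_cases)
        case 1
        show ?case using 2 same by (intro runs_Write) (simp_all add: s8_def s7_def add.commute)
      next
        case (2 s')
        show ?case
        proof (cases "m mod 2 = 0")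
          case True
          then have "Suc m mod 2 = 1" "Suc m div 2 = m div 2" by presburger+
          \<comment> \<open>For even \<open>m\<close> the pointer \<open>h\<close> stays where it
            is; rewriting its value brings the state into the form of \<open>final\<close>.\<close>
          moreover have "s8(''b'' := (s8 ''b'')(0 := 1), ''h'' := (s8 ''h'')(0 := m div 2 * N)) = s8(''b'' := (s8 ''b'')(0 := 1))"
            using s8(2) by (auto simp: fun_eq_iff)
          ultimately have "?Q (s8(''b'' := (s8 ''b'')(0 := 1)))"
            using final by (simp only:)
          then show ?thesis
            using 2 True s8 by (intro runs_If runs_Write runs_mono [OF runs_Write [where B=1]]) simp_all
        next
          case False
          then have "Suc m mod 2 = 0" "Suc m div 2 = Suc (m div 2)" "m mod 2 = 1" by presburger+
          moreover from this have "?Q (s8(''b'' := (s8 ''b'')(0 := 0), ''h'' := (s8 ''h'')(0 := m div 2 * N + N)))"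
            using final by (simp only: mult_Suc add.commute)
          moreover have "runs (Seq (Put ''b'' (Const 0)) (Put ''h'' (Plus (Val ''h'') (Val ''N'')))) s8 (1 + 1) ?Q"
            by (rule runs_Seq [where R="\<lambda>s'. s' = s8(''b'' := (s8 ''b'')(0 := 0))"])
              (use calculation s8 in \<open>auto intro!: runs_Write\<close>)
          ultimately show ?thesis
            using 2 s8 by (intro runs_If) simp_all
        qed
      qed
    qed
  qed
  show ?thesis
    unfolding Body_def body_time_def
    by (rule runs_Seq [OF 1], rule runs_Seq [OF 2], assumption, rule runs_Seq [OF 3], assumption, assumption,
        rule runs_Seq [OF 4], assumption, rule runs_Seq [OF 5], assumption, rule runs_Seq [OF 6], assumption,
        rule 8, assumption)
qed

text \<open>The first loop finds \<open>N\<close> by counting up until 3 N reaches the seed length,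
  so neither division nor logarithms are computed.\<close>

definition Prog :: com where
  "Prog = Seq (WhileLess (Plus (Val ''N'') (Plus (Val ''N'') (Val ''N''))) (Val ''seedlen'') (Put ''N'' (Plus (Val ''N'') (Const 1))))
    (For ''r'' (Val ''n'') Body)"

lemma runs_Prog:
  fixes n w :: nat and \<delta> :: real
  assumes "1 \<le> N" "length y = 3 * N"
  defines "sd \<equiv> input_store n w \<delta> y ''seed''"
  shows "runs Prog (input_store n w \<delta> y) ((1 + (N - 0) * (1 + 1)) + (2 + n * (body_time N + 2)))
    (\<lambda>s. \<forall>q<n. s ''out'' q = seed_bit N sd (\<lambda>k. sd (N + k)) (\<lambda>k. sd (N + N + k)) q)"
proof -
  define s0 where "s0 = input_store n w \<delta> y"
  define I where "I m s \<longleftrightarrow> agree {''N''} s0 s \<and> s ''N'' 0 = m" for m s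
  have s0: "s0 ''N'' 0 = 0" "s0 ''seedlen'' 0 = 3 * N" "s0 ''seed'' = sd" "s0 ''n'' 0 = n"
    "s0 ''T'' = (\<lambda>_. 0)" "s0 ''p'' = (\<lambda>_. 0)" "s0 ''h'' = (\<lambda>_. 0)" "s0 ''b'' = (\<lambda>_. 0)"
    using assms(2) by (simp_all add: s0_def input_store_def sd_def)
  have sd1: "sd k \<le> 1" for k by (simp add: sd_def input_store_def)
  have "runs (WhileLess (Plus (Val ''N'') (Plus (Val ''N'') (Val ''N''))) (Val ''seedlen'') (Put ''N'' (Plus (Val ''N'') (Const 1)))) s0
      (1 + (N - 0) * (1 + 1)) (I N)"
  proof (rule runs_While)
    fix m s assume m: "m < N" "I m s"
    have "s ''seedlen'' 0 = 3 * N" using m(2) s0 by (auto simp: I_def agree_def)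
    moreover have "I (Suc m) (s(''N'' := (s ''N'')(0 := Suc m)))" using m by (auto simp: I_def agree_def)
    ultimately show "aval (Plus (Val ''N'') (Plus (Val ''N'') (Val ''N''))) s < aval (Val ''seedlen'') s \<and>
        runs (Put ''N'' (Plus (Val ''N'') (Const 1))) s 1 (I (Suc m))"
      using m by (auto simp: I_def intro!: runs_Write)
  next
    fix s assume "I N s"
    then show "\<not> aval (Plus (Val ''N'') (Plus (Val ''N'') (Val ''N''))) s < aval (Val ''seedlen'') s"
      using s0 by (auto simp: I_def agree_def)
  qed (use s0 in \<open>auto simp: I_def\<close>)
  moreover have "runs (For ''r'' (Val ''n'') Body) s (2 + n * (body_time N + 2)) (loop_inv N sd n n)" if "I N s" for s
  proof (rule runs_For [where I="loop_inv N sd n"])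
    have "node_vec N sd 0 k = 0" for k by (simp add: node_vec.simps)
    then show "loop_inv N sd n 0 (s(''r'' := (s ''r'')(0 := 0)))"
      using that s0 by (auto simp: loop_inv_def I_def agree_def)
    fix m s assume "loop_inv N sd n m s"
    then show "aval (Val ''n'') s = n" by (simp add: loop_inv_def)
  qed (use runs_Body [OF assms(1) sd1] in auto)
  ultimately have "runs Prog s0 ((1 + (N - 0) * (1 + 1)) + (2 + n * (body_time N + 2))) (loop_inv N sd n n)"
    unfolding Prog_def by (rule runs_Seq)
  then show ?thesis
    unfolding s0_def by (rule runs_mono) (simp_all add: loop_inv_def)
qed

text \<open>Cubic because the geometric series takes \<open>N\<close> multiplications of quadratic
  cost.\<close>

lemma body_time_le: "1 \<le> N \<Longrightarrow> body_time N \<le> 200 * N ^ 3"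
proof -
  assume "1 \<le> N"
  then have le: "N \<le> N ^ 3" "N ^ 2 \<le> N ^ 3" "1 \<le> N ^ 3"
    using power_increasing [of 1 3 N] power_increasing [of 2 3 N] by simp_all
  have "body_time N = 8 * N ^ 3 + 26 * N ^ 2 + 37 * N + 26"
    by (simp add: body_time_def mul_time_def power2_eq_square power3_eq_cube algebra_simps)
  with le show ?thesis by linarith
qed

section \<open>Fooling DNF formulae of arbitrary size\<close>

text \<open>In logarithms: t / 2, with t about \<kappa> / (8 w), has to beat 2 w ln (4 \<kappa>) + q
  + 2, because s is at most (4 \<kappa>)^w and 1 / \<delta> at most 2^q.\<close>

lemma exp_dominates:
  fixes \<kappa> w q s :: nat
  assumes "1 \<le> w" "(16 * (w + q)) ^ 4 \<le> \<kappa>" "real s \<le> real (w + 1) * real (\<kappa> + 1) ^ w" "1 \<le> s" "(1 / 2) ^ q \<le> \<delta>"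
  shows "exp (- real (\<kappa> div (8 * w)) / 2) \<le> (\<delta> / 2) / (real s * (real s + 1))"
proof -
  define t where "t = \<kappa> div (8 * w)"
  define u where "u = real (w + q)"
  have wq: "1 \<le> u" "real w \<le> u" "real q + 3 \<le> 4 * u" using assms(1) by (auto simp: u_def)
  have "(16 * u) ^ 4 \<le> real \<kappa>"
    unfolding u_def using assms(2) by (metis of_nat_le_iff of_nat_mult of_nat_numeral of_nat_power)
  then have \<kappa>: "65536 * u ^ 4 \<le> real \<kappa>" by (simp add: power_mult_distrib)
  have "1 \<le> u ^ 4" using wq by (intro one_le_power) simp
  with \<kappa> have \<kappa>1: "1 \<le> real \<kappa>" by linarith
  \<comment> \<open>ln (4 \<kappa>) is at most 4 y, so 2 w ln (4 \<kappa>) is at most 8 w y, hence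
    at most \<kappa> / (32 w) once y is at least 256 w^2. This is why the threshold for \<kappa> is
    a fourth power: (16 (w + q))^4 is the square of 256 (w + q)^2.\<close>
  define y where "y = sqrt (real \<kappa>)"
  have y: "0 \<le> y" "y * y = real \<kappa>" by (simp_all add: y_def)
  have "256 * u ^ 2 \<le> y"
  proof -
    have "(256 * u ^ 2)\<^sup>2 = 65536 * u ^ 4" by (simp add: power_mult_distrib power_mult [symmetric])
    then show ?thesis unfolding y_def using \<kappa> by (intro real_le_rsqrt) simp
  qed
  moreover have "real w ^ 2 \<le> u ^ 2" using wq by (intro power_mono) auto
  ultimately have y1: "256 * real w ^ 2 \<le> y" by linarith
  have small: "32 * real w * (real q + 3) \<le> real \<kappa>"
  proof -
    have "32 * real w * (real q + 3) \<le> 32 * u * (4 * u)"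
      using wq by (intro mult_mono) auto
    also have "\<dots> \<le> 65536 * u ^ 2"
      using wq(1) by (simp add: power2_eq_square)
    also have "\<dots> \<le> 65536 * u ^ 4"
      using wq(1) by (intro mult_left_mono power_increasing) auto
    finally show ?thesis using \<kappa> by linarith
  qed
  have "ln (4 * real \<kappa>) \<le> 4 * y"
  proof -
    have "ln (2 * y) \<le> 2 * y - 1" using \<kappa>1 by (intro ln_le_minus_one) (simp add: y_def)
    moreover have "4 * real \<kappa> = (2 * y) ^ 2" using y by (simp add: power2_eq_square)
    moreover have "0 < 2 * y" using \<kappa>1 by (simp add: y_def)
    ultimately show ?thesis by (simp only: ln_realpow)
  qed
  then have "2 * real w * ln (4 * real \<kappa>) \<le> 2 * real w * (4 * y)" by (intro mult_left_mono) auto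
  also have "\<dots> \<le> real \<kappa> / (32 * real w)"
  proof -
    have "256 * real w ^ 2 * y \<le> real \<kappa>" using mult_right_mono [OF y1 y(1)] y(2) by simp
    then show ?thesis using assms(1) by (simp add: field_simps power2_eq_square)
  qed
  finally have ln4: "2 * real w * ln (4 * real \<kappa>) \<le> real \<kappa> / (32 * real w)" .
  have qle: "real q + 3 \<le> real \<kappa> / (32 * real w)"
    using small assms(1) by (simp add: field_simps)
  have t: "real \<kappa> / (8 * real w) - 1 \<le> real t"
  proof -
    have "\<kappa> < 8 * w * (t + 1)" 
      unfolding t_def using assms(1) dividend_less_times_div [of "8 * w" \<kappa>] by (simp only: distrib_left mult_1_right) linarith
    then have "real \<kappa> < real (8 * w * (t + 1))" by (simp only: of_nat_less_iff)
    then show ?thesis using assms(1) by (simp add: field_simps)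
  qed
  have half: "real \<kappa> / (16 * real w) = real \<kappa> / (32 * real w) + real \<kappa> / (32 * real w)"
    "real \<kappa> / (8 * real w) = 2 * (real \<kappa> / (16 * real w))"
    using assms(1) by (simp_all add: field_simps)
  \<comment> \<open>Of t / 2, about \<kappa> / (16 w), one half pays for the logarithm, the other
    for \<open>q + 3\<close>, which includes the loss by rounding \<open>t\<close> down.\<close>
  have main: "1 + 2 * real w * ln (4 * real \<kappa>) + (real q + 1) \<le> real t / 2"
    using t ln4 qle half by linarith
  have s2: "real s * (real s + 1) \<le> 2 * (4 * real \<kappa>) ^ (2 * w)"
  proof -
    have "real (w + 1) \<le> 2 ^ w" using of_nat_mono [OF Suc_leI [OF less_exp [of w]], where 'a=real] by simp
    moreover have "real (\<kappa> + 1) ^ w \<le> (2 * real \<kappa>) ^ w" using \<kappa>1 by (intro power_mono) auto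
    ultimately have "real (w + 1) * real (\<kappa> + 1) ^ w \<le> 2 ^ w * (2 * real \<kappa>) ^ w"
      by (intro mult_mono) auto
    also have "\<dots> = (4 * real \<kappa>) ^ w" unfolding power_mult_distrib [symmetric] by simp
    finally have le: "real s \<le> (4 * real \<kappa>) ^ w" using assms(3) by linarith
    have "real s * (real s + 1) \<le> real s * (2 * real s)" using assms(4) by (intro mult_left_mono) auto
    also have "\<dots> = 2 * (real s)\<^sup>2" by (simp add: power2_eq_square)
    also have "\<dots> \<le> 2 * ((4 * real \<kappa>) ^ w)\<^sup>2" using le by (intro mult_left_mono power_mono) auto
    also have "\<dots> = 2 * (4 * real \<kappa>) ^ (2 * w)" by (simp only: power_mult [symmetric] mult.commute)
    finally show ?thesis .
  qed
  have e2: "2 \<le> exp (1 :: real)" using exp_ge_add_one_self [of 1] by simp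
  have "2 * (4 * real \<kappa>) ^ (2 * w) * (2 * 2 ^ q) \<le> exp 1 * exp (2 * real w * ln (4 * real \<kappa>)) * (exp 1 * exp (real q))"
  proof (intro mult_mono)
    show "(4 * real \<kappa>) ^ (2 * w) \<le> exp (2 * real w * ln (4 * real \<kappa>))"
      using \<kappa>1 exp_of_nat_mult [of "2 * w" "ln (4 * real \<kappa>)"] by (simp add: mult.assoc)
    show "2 ^ q \<le> exp (real q)"
      using power_mono [OF e2, of q] exp_of_nat_mult [of q "1 :: real"] by simp
  qed (use e2 in auto)
  also have "\<dots> = exp (1 + 2 * real w * ln (4 * real \<kappa>) + (real q + 1))"
    by (simp only: exp_add mult_ac)
  also have "\<dots> \<le> exp (real t / 2)" using main by simp
  finally have big: "2 * (4 * real \<kappa>) ^ (2 * w) * (2 * 2 ^ q) \<le> exp (real t / 2)" .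
  have \<delta>: "1 \<le> \<delta> * 2 ^ q"
    using assms(5) by (simp add: power_one_over field_simps)
  have \<delta>0: "0 < \<delta>" using assms(5) less_le_trans [of 0 "(1 / 2 :: real) ^ q"] by simp
  have pos: "0 < real s * (real s + 1)" using assms(4) by simp
  have "real s * (real s + 1) * 2 \<le> (real s * (real s + 1) * 2) * (\<delta> * 2 ^ q)"
    using mult_left_mono [OF \<delta>, of "real s * (real s + 1) * 2"] pos by simp
  also have "\<dots> = \<delta> * (real s * (real s + 1) * (2 * 2 ^ q))" by simp
  also have "\<dots> \<le> \<delta> * (2 * (4 * real \<kappa>) ^ (2 * w) * (2 * 2 ^ q))"
    using s2 \<delta>0 by (intro mult_left_mono mult_right_mono) auto
  also have "\<dots> \<le> \<delta> * exp (real t / 2)" using big \<delta>0 by (intro mult_left_mono) auto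
  finally have "real s * (real s + 1) * 2 \<le> \<delta> * exp (real t / 2)" .
  then have "exp (- real t / 2) * (real s * (real s + 1)) \<le> \<delta> / 2"
    by (simp add: exp_minus field_simps)
  then show ?thesis
    unfolding t_def [symmetric] using pos by (simp add: field_simps)
qed

text \<open>The error allowed at size \<open>s\<close> shrinks with \<open>s\<close>, so \<kappa>
  has to grow with it, and the greatest admissible \<kappa> is taken. Its maximality also bounds
  \<open>s\<close> from above in terms of \<kappa>, as \<open>exp_dominates\<close>
  requires.\<close>

lemma sparsify_step_exists:
  fixes w q s :: nat
  assumes "1 \<le> w" "(w + 1) * ((16 * (w + q)) ^ 4) ^ w < s" "(1 / 2) ^ q \<le> \<delta>"
  shows "\<exists>\<kappa> t. (w + 1) * \<kappa> ^ w < s \<and> 1 \<le> t \<and> 8 * t * w \<le> \<kappa> \<and> 1 \<le> \<kappa> \<and>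
    exp (- real t / 2) \<le> (\<delta> / 2) / (real s * (real s + 1))"
proof -
  define \<kappa>0 where "\<kappa>0 = (16 * (w + q)) ^ 4"
  define P where "P \<kappa> \<longleftrightarrow> (w + 1) * \<kappa> ^ w < s" for \<kappa> :: nat
  have "P \<kappa>0" using assms(2) by (simp add: P_def \<kappa>0_def)
  moreover have "\<forall>\<kappa>. P \<kappa> \<longrightarrow> \<kappa> < Suc s"
  proof (intro allI impI)
    fix \<kappa> assume "P \<kappa>"
    have "\<kappa> \<le> \<kappa> ^ w" using assms(1) by (cases "\<kappa> = 0") (simp_all add: self_le_power)
    also have "\<dots> \<le> (w + 1) * \<kappa> ^ w" by simp
    finally show "\<kappa> < Suc s" using \<open>P \<kappa>\<close> by (simp add: P_def)
  qed
  ultimately have "\<exists>\<kappa>. P \<kappa> \<and> (\<forall>\<kappa>'. P \<kappa>' \<longrightarrow> \<kappa>' \<le> \<kappa>)"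
    by (rule ex_has_greatest_nat)
  then obtain \<kappa> where \<kappa>: "P \<kappa>" "\<And>\<kappa>'. P \<kappa>' \<Longrightarrow> \<kappa>' \<le> \<kappa>" by blast
  have ge: "\<kappa>0 \<le> \<kappa>" using \<kappa>(2) \<open>P \<kappa>0\<close> by blast
  have "\<not> P (\<kappa> + 1)" using \<kappa>(2) [of "\<kappa> + 1"] by auto
  then have "s \<le> (w + 1) * (\<kappa> + 1) ^ w" by (simp add: P_def)
  then have "real s \<le> real ((w + 1) * (\<kappa> + 1) ^ w)" by (rule of_nat_mono)
  then have s: "real s \<le> real (w + 1) * real (\<kappa> + 1) ^ w" by (simp only: of_nat_mult of_nat_power)
  have "8 * w \<le> 16 * (w + q)" by simp
  also have "\<dots> \<le> \<kappa>0" unfolding \<kappa>0_def using assms(1) by (intro self_le_power) auto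
  finally have w8: "8 * w \<le> \<kappa>" using ge by linarith
  have "1 \<le> s" using assms(2) by simp
  have "exp (- real (\<kappa> div (8 * w)) / 2) \<le> (\<delta> / 2) / (real s * (real s + 1))"
    by (rule exp_dominates [OF assms(1) _ s \<open>1 \<le> s\<close> assms(3)]) (use ge \<kappa>0_def in simp)
  moreover have "1 \<le> \<kappa> div (8 * w)" using w8 assms(1) by (simp add: Suc_le_eq div_greater_zero_iff)
  moreover have "8 * (\<kappa> div (8 * w)) * w \<le> \<kappa>"
    using div_times_less_eq_dividend [of \<kappa> "8 * w"] by (simp add: mult_ac)
  ultimately show ?thesis
    using \<kappa>(1) w8 assms(1) unfolding P_def by (intro exI [of _ \<kappa>] exI [of _ "\<kappa> div (8 * w)"]) auto
qed

lemma family_to_dnf: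
  assumes "terms_on V w F"
  shows "\<exists>\<psi>. length \<psi> = card F \<and> (\<forall>t\<in>set \<psi>. length t \<le> w) \<and> (\<forall>t\<in>set \<psi>. \<forall>(i, b)\<in>set t. i \<in> V) \<and>
    (\<forall>A. dnf_fun \<psi> A = any_sat F A)"
proof -
  have F: "finite F" "\<And>C. C \<in> F \<Longrightarrow> finite C \<and> card C \<le> w \<and> fst ` C \<subseteq> V"
    using assms by (auto simp: terms_on_def)
  obtain Cs where Cs: "set Cs = F" "distinct Cs" using finite_distinct_list [OF F(1)] by blast
  define L where "L C = (SOME t. set t = C \<and> distinct t)" for C :: "('a \<times> bool) set"
  have L: "set (L C) = C \<and> distinct (L C)" if "C \<in> F" for C
  proof -
    have "finite C" using F(2) [OF that] by blast
    then have "\<exists>t. set t = C \<and> distinct t" by (rule finite_distinct_list)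
    then show ?thesis unfolding L_def by (rule someI_ex)
  qed
  have sat: "sat_term A (L C) \<longleftrightarrow> satisfies A C" if "C \<in> F" for A C
    using L [OF that] by (simp add: sat_term_def satisfies_def)
  show ?thesis
  proof (intro exI [of _ "map L Cs"] conjI ballI allI)
    show "length (map L Cs) = card F" using Cs distinct_card by fastforce
    fix A show "dnf_fun (map L Cs) A = any_sat F A"
      using sat Cs by (auto simp: sat_dnf_def any_sat_def)
  next
    fix t assume "t \<in> set (map L Cs)"
    then obtain C where C: "C \<in> F" "t = L C" using Cs by auto
    show "length t \<le> w" using C L [OF C(1)] F(2) [OF C(1)] distinct_card [of t] by simp
    fix l assume "l \<in> set t"
    then show "case l of (i, b) \<Rightarrow> i \<in> V" using C L [OF C(1)] F(2) [OF C(1)] by force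
  qed
qed

lemma dnf_to_family:
  assumes "\<forall>t\<in>set \<phi>. length t \<le> w" "\<forall>t\<in>set \<phi>. \<forall>(i, b)\<in>set t. i \<in> V"
  shows "\<exists>F. terms_on V w F \<and> (\<forall>A. any_sat F A = dnf_fun \<phi> A)"
proof (intro exI conjI allI)
  define F where "F = {C \<in> set ` set \<phi>. inj_on fst C}"
  show "terms_on V w F"
    using assms card_length order_trans unfolding terms_on_def F_def by fastforce
  have incons: "\<not> satisfies A C" if "\<not> inj_on fst C" for A and C :: "('a \<times> bool) set"
  proof
    assume "satisfies A C"
    then have "snd p = (fst p \<in> A)" if "p \<in> C" for p
      using that by (auto simp: satisfies_def split_beta)
    then have "inj_on fst C" by (intro inj_onI prod_eqI) auto
    with that show False ..
  qed
  fix A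
  have "(\<exists>C\<in>F. satisfies A C) \<longleftrightarrow> (\<exists>t\<in>set \<phi>. satisfies A (set t))"
    using incons [of _ A] by (auto simp: F_def)
  then show "any_sat F A = dnf_fun \<phi> A"
    by (simp add: any_sat_def sat_dnf_def sat_term_def satisfies_def)
qed

text \<open>A second sandwich, now by DNFs with at most \<open>M\<close> terms. The sparsification
  error \<delta> / 2 is incurred under the uniform distribution only; under the generator the
  pointwise inequalities suffice.\<close>

lemma width_dnf_fooled:
  fixes g :: "'b \<Rightarrow> 'a set" and w q k a N :: nat
  assumes width: "\<forall>t\<in>set \<phi>. length t \<le> w" and vars: "\<forall>t\<in>set \<phi>. \<forall>(i, b)\<in>set t. i \<in> V"
    and "finite V" "1 \<le> w" "1 \<le> k" "(1 / 2) ^ q \<le> \<delta>"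
    and size: "(w + 1) * ((16 * (w + q)) ^ 4) ^ w \<le> M"
    and Y: "finite Y" "Y \<noteq> {}" "g ` Y \<subseteq> Pow V" "0 \<le> \<epsilon>" "3 * (w + 16 * w * k) \<le> N"
    and bias: "\<And>S. S \<subseteq> V \<Longrightarrow> S \<noteq> {} \<Longrightarrow> card S \<le> N \<Longrightarrow> \<bar>(\<Sum>y\<in>Y. chi S (g y)) / card Y\<bar> \<le> \<epsilon>"
  shows "\<bar>(\<Sum>y\<in>Y. dnf_fun \<phi> (g y)) / card Y - avg V (dnf_fun \<phi>)\<bar>
    \<le> \<delta> / 2 + (real M ^ 3 * (1 / 2) ^ k + \<epsilon> * (19 * real M ^ 3 * (8 * real w) ^ (32 * w * k)))"
proof -
  let ?E = "\<lambda>f. (\<Sum>y\<in>Y. f (g y)) / card Y"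
  let ?err = "real M ^ 3 * (1 / 2) ^ k + \<epsilon> * (19 * real M ^ 3 * (8 * real w) ^ (32 * w * k))"
  have \<delta>0: "0 \<le> \<delta>" using assms(6) order_trans [of 0 "(1 / 2 :: real) ^ q"] by simp
  have "1 * 1 \<le> (w + 1) * ((16 * (w + q)) ^ 4) ^ w" using assms(4) by (intro mult_le_mono one_le_power) auto
  with size have M1: "1 \<le> M" by linarith
  obtain F where F: "terms_on V w F" "\<And>A. any_sat F A = dnf_fun \<phi> A"
    using dnf_to_family [OF width vars] by blast
  obtain L U where LU: "terms_on V w L" "terms_on V w U" "card L \<le> M" "card U \<le> M"
    "\<And>A. any_sat L A \<le> any_sat F A" "\<And>A. any_sat F A \<le> any_sat U A"
    "avg V (\<lambda>A. any_sat F A - any_sat L A) \<le> \<delta> / 2 * (1 - 1 / (real (card F) + 1))"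
    "avg V (\<lambda>A. any_sat U A - any_sat F A) \<le> \<delta> / 2 * (1 - 1 / (real (card F) + 1))"
  proof -
    have "\<exists>\<kappa> t. (w + 1) * \<kappa> ^ w < s \<and> 1 \<le> t \<and> 8 * t * w \<le> \<kappa> \<and> 1 \<le> \<kappa> \<and>
        exp (- real t / 2) \<le> (\<delta> / 2) / (real s * (real s + 1))" if "M < s" for s
      using size that by (intro sparsify_step_exists [where q=q] assms) simp
    from any_sat_sparsify [where ?s0.0=M, OF assms(3) _ this F(1)] \<delta>0 that show ?thesis by auto
  qed
  have le: "\<delta> / 2 * (1 - 1 / (real (card F) + 1)) \<le> \<delta> / 2"
    using \<delta>0 by (intro mult_left_le) auto
  have fooled: "\<bar>?E (any_sat H) - avg V (any_sat H)\<bar> \<le> ?err" if H: "terms_on V w H" "card H \<le> M" for H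
  proof -
    obtain \<psi> where \<psi>: "length \<psi> = card H" "\<forall>t\<in>set \<psi>. length t \<le> w"
      "\<forall>t\<in>set \<psi>. \<forall>(i, b)\<in>set t. i \<in> V" "\<And>A. dnf_fun \<psi> A = any_sat H A"
      using family_to_dnf [OF H(1)] by blast
    have "\<bar>?E (dnf_fun \<psi>) - avg V (dnf_fun \<psi>)\<bar> \<le> ?err"
      using \<psi>(1) H(2) by (intro small_dnf_fooled [OF \<psi>(2,3) assms(3-5) _ M1 Y(1-5) bias]) auto
    then show ?thesis unfolding \<psi>(4) .
  qed
  have "?E (any_sat L) \<le> ?E (any_sat F)" "?E (any_sat F) \<le> ?E (any_sat U)"
    by (intro divide_right_mono sum_mono LU; simp)+
  with fooled [OF LU(1,3)] fooled [OF LU(2,4)] LU(7,8) le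
  have "\<bar>?E (any_sat F) - avg V (any_sat F)\<bar> \<le> \<delta> / 2 + ?err"
    unfolding avg_diff abs_le_iff by linarith
  then show ?thesis unfolding F(2) .
qed

section \<open>From sets of coordinates to bit strings\<close>

definition set_of :: "bool list \<Rightarrow> nat set" where
  "set_of x = {i. i < length x \<and> x ! i}"

lemma bij_betw_set_of: "bij_betw set_of (cube n) (Pow {..<n})"
proof (rule bij_betw_byWitness [where f'="\<lambda>A. map (\<lambda>i. i \<in> A) [0..<n]"])
  show "\<forall>x\<in>cube n. map (\<lambda>i. i \<in> set_of x) [0..<n] = x"
    by (auto simp: cube_def set_of_def intro!: nth_equalityI)
qed (auto simp: cube_def set_of_def)

lemma finite_cube [simp]: "finite (cube n)"
  using bij_betw_finite [OF bij_betw_set_of, of n] by simp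

lemma card_cube: "card (cube n) = 2 ^ n"
  using bij_betw_same_card [OF bij_betw_set_of, of n] by (simp add: card_Pow)

lemma cube_nonempty [simp]: "cube n \<noteq> {}"
  using card_cube [of n] by (intro notI) simp

lemma prob_cube: "measure_pmf.prob (pmf_of_set (cube n)) {x. P x} = (\<Sum>x\<in>cube n. of_bool (P x)) / card (cube n)"
  by (simp add: measure_pmf_of_set Int_def)

lemma Bias_eq_avg: "Bias n f = avg {..<n} (\<lambda>A. of_bool (f (map (\<lambda>i. i \<in> A) [0..<n])))"
proof -
  have "(\<Sum>x\<in>cube n. of_bool (f x)) = (\<Sum>x\<in>cube n. of_bool (f (map (\<lambda>i. i \<in> set_of x) [0..<n])) :: real)"
    by (intro sum.cong refl arg_cong [where f="\<lambda>x. of_bool (f x)"])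
      (auto simp: cube_def set_of_def intro!: nth_equalityI)
  also have "\<dots> = (\<Sum>A\<in>Pow {..<n}. of_bool (f (map (\<lambda>i. i \<in> A) [0..<n])))"
    by (rule sum.reindex_bij_betw [OF bij_betw_set_of])
  finally have "(\<Sum>x\<in>cube n. of_bool (f x)) = (\<Sum>A\<in>Pow {..<n}. of_bool (f (map (\<lambda>i. i \<in> A) [0..<n])) :: real)" .
  then show ?thesis
    by (simp add: Bias_def prob_cube card_cube avg_def)
qed

lemma eval_dnf_sat_dnf:
  assumes "dnf_on n \<phi>" "length x = n"
  shows "eval_dnf \<phi> x \<longleftrightarrow> sat_dnf (set_of x) \<phi>"
proof -
  have "(\<forall>(i, b)\<in>set t. x ! i = b) \<longleftrightarrow> sat_term (set_of x) t" if "t \<in> set \<phi>" for t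
    using assms that unfolding sat_term_def dnf_on_def set_of_def by (fastforce simp: split_beta)
  then show ?thesis by (auto simp: eval_dnf_def sat_dnf_def)
qed

definition seed_of :: "bool list \<Rightarrow> nat \<Rightarrow> nat" where
  "seed_of y i = (if i < length y then of_bool (y ! i) else 0)"

text \<open>\<open>w\<close> and \<delta> act only through the length of the seed, which determines
  \<open>N\<close>.\<close>

definition gen :: "nat \<Rightarrow> bool list \<Rightarrow> bool list" where
  "gen n y = (let N = length y div 3; sd = seed_of y
    in map (\<lambda>i. seed_bit N sd (\<lambda>k. sd (N + k)) (\<lambda>k. sd (N + N + k)) i = 1) [0..<n])"

lemma cyc_mult_cong:
  "(\<And>i. i < N \<Longrightarrow> a i = a' i) \<Longrightarrow> (\<And>i. i < N \<Longrightarrow> b i = b' i) \<Longrightarrow> cyc_mult N a b = cyc_mult N a' b'"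
  unfolding cyc_mult_def by (intro ext arg_cong [where f="\<lambda>u. u mod 2"] sum.cong) auto

lemma node_vec_cong:
  assumes "\<And>i. i < N \<Longrightarrow> x i = x' i"
  shows "node_vec N x i = node_vec N x' i"
proof (induction i rule: less_induct)
  case (less i)
  show ?case
  proof (cases "i = 0")
    case False
    then have "node_vec N x (i div 2) = node_vec N x' (i div 2)" by (intro less) simp
    then have "cyc_mult N (node_vec N x (i div 2)) x = cyc_mult N (node_vec N x' (i div 2)) x'"
      using assms by (intro cyc_mult_cong) auto
    then show ?thesis by (intro ext) (subst (1 2) node_vec.simps, simp)
  qed (intro ext, simp add: node_vec.simps)
qed

lemma seed_bit_cong:
  assumes "\<And>i. i < N \<Longrightarrow> x i = x' i" "\<And>i. i < N \<Longrightarrow> z i = z' i" "\<And>i. i < N \<Longrightarrow> u i = u' i"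
  shows "seed_bit N x z u i = seed_bit N x' z' u' i"
proof -
  have "node_vec N x i = node_vec N x' i" using assms(1) by (rule node_vec_cong)
  then have "cyc_mult N (node_vec N x i) z = cyc_mult N (node_vec N x' i) z'"
    using assms(2) by (intro cyc_mult_cong) auto
  then show ?thesis
    unfolding seed_bit_def node_row_def using assms(3) by (intro arg_cong [where f="\<lambda>u. u mod 2"] sum.cong) auto
qed

definition seed_part :: "nat \<Rightarrow> nat \<Rightarrow> bool list \<Rightarrow> nat set" where
  "seed_part N off y = {k. k < N \<and> y ! (off + k)}"

lemma length_gen [simp]: "length (gen n y) = n"
  by (simp add: gen_def Let_def)

lemma set_of_gen:
  assumes "length y = 3 * N"
  shows "set_of (gen n y) = out_set n N (seed_part N 0 y) (seed_part N N y) (seed_part N (N + N) y)"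
proof -
  have "seed_bit N (seed_of y) (\<lambda>k. seed_of y (N + k)) (\<lambda>k. seed_of y (N + N + k)) i
      = seed_bit N (bits_of (seed_part N 0 y)) (bits_of (seed_part N N y)) (bits_of (seed_part N (N + N) y)) i" for i
    using assms by (intro seed_bit_cong) (auto simp: seed_of_def bits_of_def seed_part_def)
  then show ?thesis
    using assms by (auto simp: set_of_def gen_def out_set_def Let_def)
qed

lemma sum_cube_seeds:
  fixes f :: "nat set \<Rightarrow> nat set \<Rightarrow> nat set \<Rightarrow> real"
  shows "(\<Sum>y\<in>cube (3 * N). f (seed_part N 0 y) (seed_part N N y) (seed_part N (N + N) y))
    = (\<Sum>A\<in>Pow {..<N}. \<Sum>B\<in>Pow {..<N}. \<Sum>C\<in>Pow {..<N}. f A B C)"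
proof -
  define enc where "enc = (\<lambda>(A, B, C). map (\<lambda>k. if k < N then k \<in> A else if k < N + N then k - N \<in> B else k - (N + N) \<in> C) [0..<3 * N])"
  have nth: "enc (A, B, C) ! k = (if k < N then k \<in> A else if k < N + N then k - N \<in> B else k - (N + N) \<in> C)"
    if "k < 3 * N" for A B C k
    using that by (simp add: enc_def)
  have "(\<Sum>y\<in>cube (3 * N). f (seed_part N 0 y) (seed_part N N y) (seed_part N (N + N) y))
      = (\<Sum>(A, B, C)\<in>Pow {..<N} \<times> Pow {..<N} \<times> Pow {..<N}. f A B C)"
  proof (rule sum.reindex_bij_witness [where i=enc and j="\<lambda>y. (seed_part N 0 y, seed_part N N y, seed_part N (N + N) y)"])
    fix y assume "y \<in> cube (3 * N)"
    then have len: "length y = 3 * N" by (simp add: cube_def)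
    show "enc (seed_part N 0 y, seed_part N N y, seed_part N (N + N) y) = y"
    proof (rule nth_equalityI)
      show "length (enc (seed_part N 0 y, seed_part N N y, seed_part N (N + N) y)) = length y"
        by (simp add: enc_def len)
      fix k assume "k < length (enc (seed_part N 0 y, seed_part N N y, seed_part N (N + N) y))"
      then have "k < 3 * N" by (simp add: enc_def)
      then show "enc (seed_part N 0 y, seed_part N N y, seed_part N (N + N) y) ! k = y ! k"
        by (auto simp: nth seed_part_def)
    qed
    show "(seed_part N 0 y, seed_part N N y, seed_part N (N + N) y) \<in> Pow {..<N} \<times> Pow {..<N} \<times> Pow {..<N}"
      by (auto simp: seed_part_def)
  next
    fix p assume "p \<in> Pow {..<N} \<times> Pow {..<N} \<times> Pow {..<N}"
    then obtain A B C where p: "p = (A, B, C)" "A \<subseteq> {..<N}" "B \<subseteq> {..<N}" "C \<subseteq> {..<N}" by auto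
    show "enc p \<in> cube (3 * N)" by (simp add: enc_def cube_def p)
    show "(seed_part N 0 (enc p), seed_part N N (enc p), seed_part N (N + N) (enc p)) = p"
      using p(2-4) by (auto simp: p(1) seed_part_def nth)
  qed auto
  also have "\<dots> = (\<Sum>A\<in>Pow {..<N}. \<Sum>B\<in>Pow {..<N}. \<Sum>C\<in>Pow {..<N}. f A B C)"
    by (simp add: sum.cartesian_product)
  finally show ?thesis .
qed

text \<open>Error budget: \<delta> / 2 for sparsification, \<delta> / 4 for the gap of the sandwich,
  \<delta> / 4 for bias times coefficient norm.\<close>

lemma gen_fools:
  fixes q k M D l w :: nat
  assumes "1 \<le> l" and N: "N = 3 ^ l" and n: "n \<le> 2 ^ D" and "1 \<le> w" "1 \<le> k" "(1 / 2) ^ q \<le> \<delta>"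
    and "(w + 1) * ((16 * (w + q)) ^ 4) ^ w \<le> M" "3 * (w + 16 * w * k) \<le> N"
    and small: "real M ^ 3 * (1 / 2) ^ k \<le> \<delta> / 4"
      "real (N\<^sup>2 * D + N) / 2 ^ (2 * 3 ^ (l - 1)) * (19 * real M ^ 3 * (8 * real w) ^ (32 * w * k)) \<le> \<delta> / 4"
  shows "fools \<delta> (3 * N) n (gen n) (width_dnfs n w)"
  unfolding fools_def
proof
  fix f assume "f \<in> width_dnfs n w"
  then obtain \<phi> where \<phi>: "f = eval_dnf \<phi>" "dnf_on n \<phi>" "dnf_width_le w \<phi>" by (auto simp: width_dnfs_def)
  define \<epsilon> where "\<epsilon> = real (N\<^sup>2 * D + N) / 2 ^ (2 * 3 ^ (l - 1))"
  have card: "real (card (cube (3 * N))) = 2 ^ (3 * N)" by (simp add: card_cube)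
  have bias: "\<bar>(\<Sum>y\<in>cube (3 * N). chi S (set_of (gen n y))) / card (cube (3 * N))\<bar> \<le> \<epsilon>"
    if "S \<subseteq> {..<n}" "S \<noteq> {}" "card S \<le> N" for S
  proof -
    have "(\<Sum>y\<in>cube (3 * N). chi S (set_of (gen n y)))
        = (\<Sum>y\<in>cube (3 * N). chi S (out_set n N (seed_part N 0 y) (seed_part N N y) (seed_part N (N + N) y)))"
      by (intro sum.cong refl) (simp add: set_of_gen cube_def)
    also have "\<dots> = (\<Sum>A\<in>Pow {..<N}. \<Sum>B\<in>Pow {..<N}. \<Sum>C\<in>Pow {..<N}. chi S (out_set n N A B C))"
      by (rule sum_cube_seeds)
    finally show ?thesis
      unfolding card \<epsilon>_def using generator_small_bias [OF assms(1) N that n] by (simp add: seed_sum_def)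
  qed
  have "\<bar>(\<Sum>y\<in>cube (3 * N). dnf_fun \<phi> (set_of (gen n y))) / card (cube (3 * N)) - avg {..<n} (dnf_fun \<phi>)\<bar>
      \<le> \<delta> / 2 + (real M ^ 3 * (1 / 2) ^ k + \<epsilon> * (19 * real M ^ 3 * (8 * real w) ^ (32 * w * k)))"
  proof (rule width_dnf_fooled [OF _ _ _ assms(4-7) _ _ _ _ assms(8) bias])
    show "\<forall>t\<in>set \<phi>. length t \<le> w" using \<phi>(3) by (simp add: dnf_width_le_def)
    show "\<forall>t\<in>set \<phi>. \<forall>(i, b)\<in>set t. i \<in> {..<n}" using \<phi>(2) by (simp add: dnf_on_def)
    show "0 \<le> \<epsilon>" by (simp add: \<epsilon>_def)
    show "(\<lambda>y. set_of (gen n y)) ` cube (3 * N) \<subseteq> Pow {..<n}"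
      by (auto simp: set_of_def)
  qed simp_all
  also have "\<dots> \<le> \<delta>" using small unfolding \<epsilon>_def by linarith
  also have "(\<Sum>y\<in>cube (3 * N). dnf_fun \<phi> (set_of (gen n y))) / card (cube (3 * N))
      = measure_pmf.prob (pmf_of_set (cube (3 * N))) {y. f (gen n y)}"
    unfolding prob_cube using \<phi>(1,2) by (simp add: eval_dnf_sat_dnf)
  also have "avg {..<n} (dnf_fun \<phi>) = Bias n f"
    unfolding Bias_eq_avg
  proof (rule avg_cong)
    fix A assume "A \<subseteq> {..<n}"
    then have "set_of (map (\<lambda>i. i \<in> A) [0..<n]) = A" by (auto simp: set_of_def)
    then show "dnf_fun \<phi> A = of_bool (f (map (\<lambda>i. i \<in> A) [0..<n]))"
      using \<phi>(1,2) by (simp add: eval_dnf_sat_dnf)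
  qed
  finally show "\<bar>measure_pmf.prob (pmf_of_set (cube (3 * N))) {y. f (gen n y)} - Bias n f\<bar> \<le> \<delta>" .
qed

lemma explicit_gen:
  assumes "\<And>n w \<delta>. r n w \<delta> = 3 * 3 ^ m n w \<delta>"
  shows "explicit r (\<lambda>n w \<delta>. gen n)"
  unfolding explicit_def
proof (rule exI [of _ Prog], rule exI [of _ "207 :: nat"], intro allI impI ballI)
  fix n w :: nat and \<delta> :: real and y
  assume "1 \<le> n" and y: "y \<in> cube (r n w \<delta>)"
  define N :: nat where "N = 3 ^ m n w \<delta>"
  have N: "1 \<le> N" "length y = 3 * N" using y assms by (simp_all add: N_def cube_def)
  define sd where "sd = input_store n w \<delta> y ''seed''"
  have sd: "sd = seed_of y" by (rule ext) (simp add: sd_def input_store_def seed_of_def)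
  obtain k s where ks: "exec Prog (input_store n w \<delta> y) k s" "k \<le> (1 + (N - 0) * (1 + 1)) + (2 + n * (body_time N + 2))"
    "\<forall>i<n. s ''out'' i = seed_bit N sd (\<lambda>k. sd (N + k)) (\<lambda>k. sd (N + N + k)) i"
    using runs_Prog [OF N, of n w \<delta>] unfolding runs_def sd_def by blast
  define t where "t = r n w \<delta> + n"
  have t: "N \<le> t" "n \<le> t" "1 \<le> t" using assms \<open>1 \<le> n\<close> by (simp_all add: t_def N_def)
  have "(1 + (N - 0) * (1 + 1)) + (2 + n * (body_time N + 2)) \<le> 3 + 2 * N + n * (200 * N ^ 3 + 2)"
    using body_time_le [OF N(1)] by simp
  also have "\<dots> \<le> 3 + 2 * t + t * (200 * t ^ 3 + 2)"
    using t by (intro add_mono mult_mono power_mono) auto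
  also have "\<dots> = 3 + 4 * t + 200 * t ^ 4" by (simp add: algebra_simps power_numeral_reduce)
  \<comment> \<open>207 = 3 + 4 + 200. The exponent 4 is then raised to 207, as
    \<open>explicit\<close> uses one constant as factor and exponent.\<close>
  also have "\<dots> \<le> 207 * t ^ 4"
    using t(3) power_increasing [of 1 4 t] power_increasing [of 0 4 t] by simp
  also have "\<dots> \<le> 207 * t ^ 207" using t(3) by (intro mult_le_mono2 power_increasing) auto
  finally have "k \<le> 207 * t ^ 207" using ks(2) by linarith
  moreover have "out_values n s = map of_bool (gen n y)"
  proof -
    have "seed_bit N x z u i < 2" for x z u i by (simp add: seed_bit_def)
    then have "seed_bit N x z u i = of_bool (seed_bit N x z u i = 1)" for x z u i
      using less_2_cases by fastforce
    then have "s ''out'' i = of_bool (seed_bit N sd (\<lambda>k. sd (N + k)) (\<lambda>k. sd (N + N + k)) i = 1)" if "i < n" for i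
      using ks(3) that by metis
    then show ?thesis
      using N(2) by (simp add: out_values_def gen_def Let_def sd)
  qed
  ultimately show "\<exists>k s. exec Prog (input_store n w \<delta> y) k s \<and> k \<le> 207 * (r n w \<delta> + n) ^ 207 \<and>
      out_values n s = map of_bool (gen n y)"
    using ks(1) unfolding t_def by blast
qed

section \<open>Seed length\<close>

text \<open>Negative logarithms become 0, which keeps \<open>le_ceil_log\<close> true for arguments
  below 1.\<close>

definition ceil_log :: "real \<Rightarrow> nat" where
  "ceil_log x = nat \<lceil>log 2 x\<rceil>"

lemma le_ceil_log:
  assumes "0 < x"
  shows "x \<le> 2 ^ ceil_log x"
proof -
  have "log 2 x \<le> real (ceil_log x)" unfolding ceil_log_def by (rule real_nat_ceiling_ge)
  then have "2 powr log 2 x \<le> 2 powr real (ceil_log x)" by simp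
  then show ?thesis using assms by (simp add: powr_realpow)
qed

lemma ceil_log_le: "1 \<le> x \<Longrightarrow> real (ceil_log x) \<le> log 2 x + 1"
  unfolding ceil_log_def by (simp add: of_nat_nat ceiling_correct [THEN conjunct1])

definition log_err :: "real \<Rightarrow> nat" where
  "log_err \<delta> = ceil_log (1 / \<delta>)"

definition log_width :: "nat \<Rightarrow> real \<Rightarrow> nat" where
  "log_width w \<delta> = ceil_log (real (w + log_err \<delta>))"

text \<open>
  After sparsification there are \<open>M \<le> 2 ^ log_size\<close> terms, and \<open>order_bound\<close> is an order \<open>k\<close> with
  \<open>M\<^sup>3 / 2 ^ k \<le> \<delta> / 4\<close>. The number \<open>needed\<close> collects the exponents of two in the product of the
  bias, the coefficient norm \<open>19 M\<^sup>3 (8 w) ^ (32 w k)\<close> and \<open>4 / \<delta>\<close>, which \<open>2 ^ (2 * 3 ^ m)\<close> has to beat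
  when \<open>N = 3 ^ (m + 1)\<close>.
\<close>

definition log_size :: "nat \<Rightarrow> real \<Rightarrow> nat" where
  "log_size w \<delta> = w * (17 + 4 * log_width w \<delta>)"

definition order_bound :: "nat \<Rightarrow> real \<Rightarrow> nat" where
  "order_bound w \<delta> = 3 * log_size w \<delta> + log_err \<delta> + 2"

text \<open>The maximum with 1 permits absorbing the summand \<open>N\<close> of the bias bound into
  N^2 D.\<close>

definition index_bits :: "nat \<Rightarrow> nat" where
  "index_bits n = max 1 (ceil_log (real n))"

definition needed :: "nat \<Rightarrow> nat \<Rightarrow> real \<Rightarrow> nat" where
  "needed n w \<delta> = 8 + 3 * log_size w \<delta> + log_err \<delta>
    + 32 * (3 + log_width w \<delta>) * (w * order_bound w \<delta>) + ceil_log (real (index_bits n))"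

definition exponent :: "nat \<Rightarrow> nat \<Rightarrow> real \<Rightarrow> nat" where
  "exponent n w \<delta> = (LEAST m. needed n w \<delta> \<le> 3 ^ m)"

text \<open>Three ring elements with N = 3^(m + 1) bits each, where m is \<open>exponent\<close>.
  The shift by one fits the field size, which is at least 2^(2 * 3^m).\<close>

definition seed_len :: "nat \<Rightarrow> nat \<Rightarrow> real \<Rightarrow> nat" where
  "seed_len n w \<delta> = 3 * 3 ^ (exponent n w \<delta> + 1)"

lemma needed_le_power: "needed n w \<delta> \<le> 3 ^ exponent n w \<delta>"
  unfolding exponent_def
proof (rule LeastI)
  have "needed n w \<delta> < 2 ^ needed n w \<delta>" by (rule less_exp)
  also have "\<dots> \<le> 3 ^ needed n w \<delta>" by (rule power_mono) auto
  finally show "needed n w \<delta> \<le> 3 ^ needed n w \<delta>" by simp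
qed

text \<open>By minimality the power of 3 overshoots \<open>needed\<close> by less than a factor 3,
  and \<open>seed_len\<close> is 9 times that power. At exponent 0 the summand 8 in
  \<open>needed\<close> suffices.\<close>

lemma seed_len_le: "seed_len n w \<delta> \<le> 27 * needed n w \<delta>"
proof (cases "exponent n w \<delta>")
  case 0
  then show ?thesis by (simp add: seed_len_def needed_def)
next
  case (Suc m)
  then have "\<not> needed n w \<delta> \<le> 3 ^ m"
    unfolding exponent_def by (metis lessI not_less_Least)
  with Suc show ?thesis by (simp add: seed_len_def)
qed

text \<open>The bias contains N^2, at most 2^(4 (m + 1)); this lets it be paid for by one 3^m in the
  exponent.\<close>

lemma four_mult_le_power: "4 \<le> m \<Longrightarrow> 4 * (m + 1) \<le> (3 :: nat) ^ m"
  by (induction m rule: nat_induct_at_least) auto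

lemma fools_gen:
  assumes "1 \<le> n" "1 \<le> w" "0 < \<delta>" "\<delta> < 1"
  shows "fools \<delta> (seed_len n w \<delta>) n (gen n) (width_dnfs n w)"
proof -
  define q where "q = log_err \<delta>"
  define \<nu> where "\<nu> = log_width w \<delta>"
  define a where "a = log_size w \<delta>"
  define k where "k = order_bound w \<delta>"
  define D where "D = index_bits n"
  define \<mu> where "\<mu> = ceil_log (real D)"
  define m where "m = exponent n w \<delta>"
  define N :: nat where "N = 3 ^ (m + 1)"
  define M :: nat where "M = 2 ^ a"
  have q: "(1 / 2) ^ q \<le> \<delta>"
    using le_ceil_log [of "1 / \<delta>"] assms by (simp add: q_def log_err_def power_one_over field_simps)
  have wq: "real (w + q) \<le> 2 ^ \<nu>"
    using le_ceil_log [of "real (w + q)"] assms by (simp add: \<nu>_def log_width_def q_def)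
  have D: "n \<le> 2 ^ D" "1 \<le> D" "real D \<le> 2 ^ \<mu>"
  proof -
    have "real n \<le> 2 ^ ceil_log (real n)" using assms by (intro le_ceil_log) simp
    also have "\<dots> \<le> 2 ^ D" by (intro power_increasing) (simp_all add: D_def index_bits_def)
    finally show "n \<le> 2 ^ D" by (metis of_nat_le_iff of_nat_numeral of_nat_power)
    show "1 \<le> D" by (simp add: D_def index_bits_def)
    then show "real D \<le> 2 ^ \<mu>" unfolding \<mu>_def by (intro le_ceil_log) simp
  qed
  have R: "8 + 3 * a + q + 32 * (3 + \<nu>) * (w * k) + \<mu> \<le> 3 ^ m"
    using needed_le_power [of n w \<delta>] by (simp add: needed_def q_def \<nu>_def a_def k_def D_def \<mu>_def m_def)
  have k: "k = 3 * a + q + 2" by (simp add: k_def order_bound_def a_def q_def)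
  have wk: "w \<le> w * k" "1 \<le> w * k" using assms(2) by (simp_all add: k)
  \<comment> \<open>\<open>needed\<close> contains 32 * 3 * w * k, at least 96, whereas 3^3 =
    27.\<close>
  have m4: "4 \<le> m"
  proof (rule ccontr)
    assume "\<not> 4 \<le> m"
    then have "(3 :: nat) ^ m \<le> 3 ^ 3" by (intro power_increasing) auto
    moreover have "32 * 3 * 1 \<le> 32 * (3 + \<nu>) * (w * k)" using wk by (intro mult_le_mono) auto
    ultimately show False using R by simp
  qed
  have "fools \<delta> (3 * N) n (gen n) (width_dnfs n w)"
  proof (rule gen_fools [where l="m + 1" and D=D and M=M and k=k and q=q])
    show "(w + 1) * ((16 * (w + q)) ^ 4) ^ w \<le> M"
    proof -
      have "w + q \<le> 2 ^ \<nu>" using wq by (metis of_nat_le_iff of_nat_numeral of_nat_power)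
      then have "16 * (w + q) \<le> 2 ^ (4 + \<nu>)" by (simp add: power_add)
      then have "(16 * (w + q)) ^ 4 \<le> (2 ^ (4 + \<nu>)) ^ 4" by (rule power_mono) simp
      then have "((16 * (w + q)) ^ 4) ^ w \<le> ((2 ^ (4 + \<nu>)) ^ 4) ^ w" by (rule power_mono) simp
      moreover have "w + 1 \<le> 2 ^ w" using less_exp [of w] by (simp add: Suc_le_eq)
      ultimately have "(w + 1) * ((16 * (w + q)) ^ 4) ^ w \<le> 2 ^ w * ((2 ^ (4 + \<nu>)) ^ 4) ^ w"
        by (intro mult_le_mono)
      also have "\<dots> = 2 ^ (w + (4 + \<nu>) * 4 * w)" by (simp add: power_add power_mult)
      \<comment> \<open>The 17 in \<open>log_size\<close> is 1 + 16: one \<open>w\<close> for the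
        factor \<open>w + 1\<close>, and \<open>16 * w\<close> for the factor 16 in the
        base.\<close>
      also have "w + (4 + \<nu>) * 4 * w = a" by (simp add: a_def log_size_def \<nu>_def algebra_simps)
      finally show ?thesis by (simp add: M_def)
    qed
    have "3 * (w + 16 * w * k) \<le> 3 * (w * k + 16 * (w * k))" using wk by (intro mult_le_mono2 add_mono) auto
    also have "\<dots> \<le> 32 * (3 + \<nu>) * (w * k)" by (simp add: add_mult_distrib add_mult_distrib2)
    also have "\<dots> \<le> 3 ^ m" using R by linarith
    also have "\<dots> \<le> N" by (simp add: N_def)
    finally show "3 * (w + 16 * w * k) \<le> N" .
    show "real M ^ 3 * (1 / 2) ^ k \<le> \<delta> / 4"
    proof -
      have "real M ^ 3 * (1 / 2) ^ k = (1 / 2) ^ q / 4"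
        by (simp add: M_def k power_add power_one_over power_mult [symmetric] mult.commute field_simps)
      then show ?thesis using q by simp
    qed
    show "real (N\<^sup>2 * D + N) / 2 ^ (2 * 3 ^ (m + 1 - 1)) * (19 * real M ^ 3 * (8 * real w) ^ (32 * w * k)) \<le> \<delta> / 4"
    proof -
      have "real N \<le> 4 ^ (m + 1)" unfolding N_def of_nat_power by (intro power_mono) auto
      then have N2: "real N ^ 2 \<le> 2 ^ (4 * (m + 1))"
      proof -
        have "real N ^ 2 \<le> (4 ^ (m + 1)) ^ 2" using \<open>real N \<le> 4 ^ (m + 1)\<close> by (rule power_mono) simp
        also have "\<dots> = (4 ^ 2 :: real) ^ (m + 1)" by (simp only: power_mult [symmetric] mult.commute)
        also have "(4 ^ 2 :: real) = 2 ^ 4" by simp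
        finally show ?thesis by (simp only: power_mult)
      qed
      have "1 \<le> N" unfolding N_def by (rule one_le_power) simp
      then have N1: "1 \<le> real N" by simp
      have "real (N\<^sup>2 * D + N) \<le> real N ^ 2 * real D + real N ^ 2 * real D"
      proof -
        have "real N * 1 \<le> real N ^ 2 * real D"
          using N1 D(2) by (intro mult_mono) (auto simp: power2_eq_square)
        then show ?thesis unfolding of_nat_add of_nat_mult of_nat_power by linarith
      qed
      also have "\<dots> = 2 * (real N ^ 2 * real D)" by simp
      also have "\<dots> \<le> 2 * (2 ^ (4 * (m + 1)) * 2 ^ \<mu>)"
        using N2 D(3) by (intro mult_left_mono mult_mono) auto
      finally have A: "real (N\<^sup>2 * D + N) \<le> 2 ^ (1 + 4 * (m + 1) + \<mu>)" by (simp add: power_add)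
      have "real w \<le> real (w + q)" by simp
      also note wq
      finally have "real w \<le> 2 ^ \<nu>" .
      then have "8 * real w \<le> 2 ^ (3 + \<nu>)" by (simp add: power_add)
      then have "(8 * real w) ^ (32 * w * k) \<le> (2 ^ (3 + \<nu>)) ^ (32 * w * k)" by (rule power_mono) simp
      also have "\<dots> = 2 ^ ((3 + \<nu>) * (32 * w * k))" by (simp only: power_mult)
      finally have "19 * real M ^ 3 * (8 * real w) ^ (32 * w * k) \<le> 2 ^ 5 * 2 ^ (3 * a) * 2 ^ ((3 + \<nu>) * (32 * w * k))"
        by (intro mult_mono) (simp_all add: M_def power_mult [symmetric] mult.commute)
      then have B: "19 * real M ^ 3 * (8 * real w) ^ (32 * w * k) \<le> 2 ^ (5 + 3 * a + (3 + \<nu>) * (32 * w * k))"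
        by (simp only: power_add)
      have "real (N\<^sup>2 * D + N) * (19 * real M ^ 3 * (8 * real w) ^ (32 * w * k))
          \<le> 2 ^ (1 + 4 * (m + 1) + \<mu>) * 2 ^ (5 + 3 * a + (3 + \<nu>) * (32 * w * k))"
        using A B by (intro mult_mono) auto
      also have "\<dots> = 2 ^ (1 + 4 * (m + 1) + \<mu> + (5 + 3 * a + (3 + \<nu>) * (32 * w * k)))" by (simp only: power_add)
      also have "\<dots> \<le> 2 ^ (2 * 3 ^ m - (q + 2))"
      proof (rule power_increasing)
        \<comment> \<open>The exponent 2 * 3^m is spent twice: one 3^m covers \<open>needed\<close>,
          the other \<open>4 * (m + 1)\<close>. The 8 in \<open>needed\<close> is 1 + 5 + 2, from
          the two summands of the bias, from 19 \<le> 2^5 and from the 4 in \<delta> / 4.\<close>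
        have "(3 + \<nu>) * (32 * w * k) = 32 * (3 + \<nu>) * (w * k)" by simp
        then show "1 + 4 * (m + 1) + \<mu> + (5 + 3 * a + (3 + \<nu>) * (32 * w * k)) \<le> 2 * 3 ^ m - (q + 2)"
          using R four_mult_le_power [OF m4] by linarith
      qed simp
      also have "\<dots> = 2 ^ (2 * 3 ^ m) * ((1 / 2) ^ q / 4)"
      proof -
        have "q + 2 \<le> 2 * 3 ^ m" using R by linarith
        then show ?thesis by (simp add: power_diff power_one_over power_add field_simps)
      qed
      also have "\<dots> \<le> 2 ^ (2 * 3 ^ m) * (\<delta> / 4)" using q by (intro mult_left_mono) auto
      finally show ?thesis by (simp add: field_simps)
    qed
  qed (use assms q D k in \<open>simp_all add: N_def\<close>)
  then show ?thesis by (simp add: seed_len_def N_def m_def)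
qed

text \<open>The product of \<open>3 + log_width\<close> and \<open>w * order_bound\<close>
  dominates. With G = lg T, the first factor is O(G); the second is O(T G), since
  \<open>order_bound\<close> is O(w G + log (1 / \<delta>)) and T contains both w^2 and w lg (1 /
  \<delta>). This gives 32 * 4 * 54 = 6912, and 7000 leaves room for the other summands.\<close>

lemma needed_soft_bound:
  assumes "1 \<le> n" "1 \<le> w" "0 < \<delta>" "\<delta> < 1"
  defines "T \<equiv> (real w)\<^sup>2 + real w * lg (1 / \<delta>) + lg (lg (real n))"
  shows "real (needed n w \<delta>) \<le> 7000 * T * (lg T)\<^sup>2" and "2 \<le> lg T" and "0 \<le> T"
proof -
  define q where "q = log_err \<delta>"
  define \<nu> where "\<nu> = log_width w \<delta>"
  define a where "a = log_size w \<delta>"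
  define k where "k = order_bound w \<delta>"
  define \<mu> where "\<mu> = ceil_log (real (index_bits n))"
  define G where "G = lg T"
  have lg2: "2 \<le> lg x" for x by (simp add: lg_def)
  have lglog: "log 2 x \<le> lg x" for x by (simp add: lg_def)
  have w1: "1 \<le> real w" using assms by simp
  have G: "2 \<le> G" unfolding G_def by (rule lg2)
  then show "2 \<le> lg T" by (simp add: G_def)
  have w2: "real w \<le> (real w)\<^sup>2" using w1 by (simp add: power2_eq_square)
  have wl: "real w * 2 \<le> real w * lg (1 / \<delta>)" using w1 lg2 by (intro mult_left_mono) auto
  have T5: "5 \<le> T" using w1 w2 wl lg2 [of "lg (real n)"] unfolding T_def by linarith
  then show "0 \<le> T" by simp
  have q: "real q \<le> 2 * lg (1 / \<delta>)"
    using ceil_log_le [of "1 / \<delta>"] assms lglog [of "1 / \<delta>"] lg2 [of "1 / \<delta>"]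
    by (simp add: q_def log_err_def)
  have "0 \<le> lg (1 / \<delta>)" using lg2 [of "1 / \<delta>"] by linarith
  then have "lg (1 / \<delta>) \<le> real w * lg (1 / \<delta>)" using mult_right_mono [OF w1] by simp
  then have wlT: "real w * lg (1 / \<delta>) \<le> T" "lg (1 / \<delta>) \<le> T" "(real w)\<^sup>2 \<le> T" "real w \<le> T" "lg (lg (real n)) \<le> T"
    using lg2 [of "lg (real n)"] w2 wl w1 unfolding T_def by linarith+
  have "real w + 2 * lg (1 / \<delta>) \<le> 2 * T"
  proof -
    define W P where "W = (real w)\<^sup>2" and "P = real w * lg (1 / \<delta>)"
    have "T = W + P + lg (lg (real n))" by (simp only: T_def W_def P_def)
    moreover have "real w \<le> W" using w2 by (simp only: W_def)
    moreover have "lg (1 / \<delta>) \<le> P"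
      using \<open>lg (1 / \<delta>) \<le> real w * lg (1 / \<delta>)\<close> by (simp only: P_def)
    ultimately show ?thesis using lg2 [of "lg (real n)"] w1 by linarith
  qed
  then have wq: "real (w + q) \<le> 2 * T" using q by simp
  have \<nu>: "real \<nu> \<le> 2 * G"
  proof -
    have "real \<nu> \<le> log 2 (real (w + q)) + 1"
      unfolding \<nu>_def log_width_def q_def [symmetric] using assms by (intro ceil_log_le) simp
    also have "log 2 (real (w + q)) \<le> log 2 (2 * T)" using wq assms T5 by simp
    also have "log 2 (2 * T) = 1 + log 2 T" using T5 by (simp add: log_mult)
    finally show ?thesis using lglog [of T] G unfolding G_def by linarith
  qed
  have \<mu>: "real \<mu> \<le> 2 * T"
  proof -
    have "real (ceil_log (real n)) \<le> lg (real n) + 1"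
      using ceil_log_le [of "real n"] lglog [of "real n"] assms by simp
    then have ib: "real (index_bits n) \<le> 2 * lg (real n)" "1 \<le> real (index_bits n)"
      using lg2 [of "real n"] by (simp_all add: index_bits_def)
    have "real \<mu> \<le> log 2 (real (index_bits n)) + 1"
      unfolding \<mu>_def using ib by (intro ceil_log_le)
    also have "log 2 (real (index_bits n)) \<le> log 2 (2 * lg (real n))" using ib by simp
    also have "log 2 (2 * lg (real n)) = 1 + log 2 (lg (real n))"
      using lg2 [of "real n"] by (subst log_mult) auto
    finally have "real \<mu> \<le> 2 + lg (lg (real n))" using lglog [of "lg (real n)"] by linarith
    then show ?thesis using wlT(5) T5 by linarith
  qed
  have a: "real a \<le> 17 * real w * G"
  proof -
    have "real a = real w * (17 + 4 * real \<nu>)" by (simp add: a_def log_size_def \<nu>_def)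
    also have "\<dots> \<le> real w * (17 * G)" using \<nu> G by (intro mult_left_mono) auto
    finally show ?thesis by simp
  qed
  have wwG: "real w * real w * G \<le> T * G" using wlT(3) G by (intro mult_right_mono) (auto simp: power2_eq_square)
  have TG: "2 * T \<le> T * G" using G T5 mult_left_mono [of 2 G T] by simp
  have wk: "real (w * k) \<le> 54 * (T * G)"
  proof -
    have "real (w * k) = 3 * (real w * real a) + real w * real q + 2 * real w"
      by (simp add: k_def order_bound_def a_def q_def algebra_simps)
    moreover have "real w * real a \<le> 17 * (real w * real w * G)" using mult_left_mono [OF a, of "real w"] by simp
    moreover have "real w * real q \<le> 2 * T" using mult_left_mono [OF q, of "real w"] wlT(1) by simp
    ultimately show ?thesis using wwG TG wlT(4) by linarith
  qed
  have TGG: "2 * (T * G) \<le> T * G\<^sup>2" using mult_right_mono [OF TG, of G] G by (simp add: power2_eq_square)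
  have "real (32 * (3 + \<nu>) * (w * k)) \<le> 32 * (4 * G) * (54 * (T * G))"
  proof -
    have "real (32 * (3 + \<nu>) * (w * k)) = 32 * (3 + real \<nu>) * real (w * k)" by simp
    also have "\<dots> \<le> 32 * (4 * G) * (54 * (T * G))"
      using \<nu> G by (intro mult_mono wk) auto
    finally show ?thesis .
  qed
  then have main: "real (32 * (3 + \<nu>) * (w * k)) \<le> 6912 * (T * G\<^sup>2)" by (simp add: power2_eq_square mult_ac)
  have "real a \<le> 17 * (T * G)" using a mult_right_mono [OF wlT(4), of G] G by linarith
  moreover have "real q \<le> 2 * T" using q wlT(2) by linarith
  moreover have "real (needed n w \<delta>) = 8 + 3 * real a + real q + real (32 * (3 + \<nu>) * (w * k)) + real \<mu>"
    by (simp add: needed_def q_def \<nu>_def a_def k_def \<mu>_def)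
  ultimately have "real (needed n w \<delta>) \<le> 7000 * (T * G\<^sup>2)"
    using main \<mu> TG TGG T5 by linarith
  then show "real (needed n w \<delta>) \<le> 7000 * T * (lg T)\<^sup>2" by (simp add: G_def)
qed

text \<open>189000 = 27 * 7000. The same constant serves as exponent of the logarithm, where 2 would
  do, because \<open>lg T\<close> is at least 2.\<close>

lemma seed_len_soft_bound:
  assumes "1 \<le> n" "1 \<le> w" "0 < \<delta>" "\<delta> < 1"
  shows "real (seed_len n w \<delta>) \<le> soft_O_bound 189000 ((real w)\<^sup>2 + real w * lg (1 / \<delta>) + lg (lg (real n)))"
proof -
  define T where "T = (real w)\<^sup>2 + real w * lg (1 / \<delta>) + lg (lg (real n))"
  note T = needed_soft_bound [OF assms, folded T_def]
  have "real (seed_len n w \<delta>) \<le> 27 * real (needed n w \<delta>)"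
    using of_nat_mono [OF seed_len_le [of n w \<delta>], where 'a=real] by simp
  also have "\<dots> \<le> 189000 * T * (lg T)\<^sup>2" using T(1) by simp
  also have "(lg T)\<^sup>2 = lg T powr 2" using T(2) by (simp add: powr_numeral)
  also have "189000 * T * lg T powr 2 \<le> 189000 * T * lg T powr 189000"
    using T by (intro mult_left_mono powr_mono) auto
  finally show ?thesis unfolding soft_O_bound_def T_def .
qed

theorem theorem1p5:
  shows "\<exists>(r :: nat \<Rightarrow> nat \<Rightarrow> real \<Rightarrow> nat) (G :: nat \<Rightarrow> nat \<Rightarrow> real \<Rightarrow> bool list \<Rightarrow> bool list) (C :: real).
    explicit r G \<and>
    (\<forall>(n :: nat) (w :: nat) (\<delta> :: real). 1 \<le> n \<longrightarrow> 1 \<le> w \<longrightarrow> 0 < \<delta> \<longrightarrow> \<delta> < 1 \<longrightarrow>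
       G n w \<delta> \<in> cube (r n w \<delta>) \<rightarrow> cube n \<and>
       fools \<delta> (r n w \<delta>) n (G n w \<delta>) (width_dnfs n w) \<and>
       real (r n w \<delta>) \<le> soft_O_bound C ((real w)\<^sup>2 + real w * lg (1 / \<delta>) + lg (lg (real n))))"
proof (rule exI [of _ seed_len], rule exI [of _ "\<lambda>n w \<delta>. gen n"], rule exI [of _ 189000], intro conjI allI impI)
  show "explicit seed_len (\<lambda>n w \<delta>. gen n)"
    by (rule explicit_gen [where m="\<lambda>n w \<delta>. exponent n w \<delta> + 1"]) (simp add: seed_len_def)
qed (auto simp: cube_def intro: fools_gen seed_len_soft_bound)

end
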